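(* Consider the $d$-dimensional Gaussian Volterra principal-agent model described in the context, with $\Gamma$ symmetric positive definite. The optimal level of effort $\Gamma^{-1}\beta^*$ for the enlarged principal's problem $$V_{SB}(y)=\sup_{\beta\in\mathcal{A}}\mathbb{E}^{\Gamma^{-1}\beta}\big[U_P(X_T-Y_T^{y,\beta})\big]$$ is deterministic, and $\beta^*$ (attaining this supremum) is given by $$\beta^*_t=\big((\gamma_A+\gamma_P)I_d+\Gamma^{-1}\big)^{-1}\big(\gamma_PI_d+\Gamma^{-1}\big)K(T,t),\qquad t\le T.$$ The utility of the principal at time $0$, $V_{SB}=\sup_{y\ge y_0}V_{SB}(y)$, is given by $V_{SB}=V_{SB}(y_0)$ with $$V_{SB}(y)=-\exp\big(-\gamma_P(g_0(T)-y)+\phi_0\big),$$ $$\phi_0=\frac{\gamma_P}{2}\Big\langle K_T,\Big(\gamma_PI_d-(\gamma_PI_d+\Gamma^{-1})\big((\gamma_A+\gamma_P)I_d+\Gamma^{-1}\big)^{-1}(\gamma_PI_d+\Gamma^{-1})\Big)K_T\Big\rangle_{L^2},$$ where $K_T(s):=K(T,s)$ and $\langle f,g\rangle_{L^2}:=\int_0^T\langle f(s),g(s)\rangle ds$. The optimal contract $\xi^*$ for the enlarged principal's problem (attaining $V_{SB}$) is $$\xi^*=y_0+\int_0^Tf^*(\beta^*_s)\,ds+\int_0^T\langle\beta^*_s,dB_s\rangle .$$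
   Context: Setting. Let $T>0$, $d\ge1$, and let $(\Omega,\mathcal{F},\mathbb{F}=(\mathcal{F}_t)_{t\le T},\mathbb{P}_0)$ be a filtered probability space carrying a $d$-dimensional standard $\mathbb{F}$-Brownian motion $B$. $\langle\cdot,\cdot\rangle$ and $\|\cdot\|$ are the canonical inner product and norm of $\mathbb{R}^d$. Let $g_0:[0,T]\to\mathbb{R}$ be a measurable deterministic function and $K:[0,T]^2\to\mathbb{R}^d$ a measurable Volterra kernel, i.e. $K(t,s)=0$ for $s\ge t$, with $\sup_{t\le T}\int_0^T\|K(t,s)\|^2ds<\infty$. The (real-valued) aggregate output is $X_t=g_0(t)+\int_0^t\langle K(t,s),dB_s\rangle$. $\mathcal{A}$ is the set of $\mathbb{F}$-progressively measurable $\mathbb{R}^d$-valued processes $a$ for which there is $A>0$ with $\int_0^T\|a_s\|^2ds<A$, $\mathbb{P}_0$-a.s. For $a\in\mathcal{A}$, $\frac{d\mathbb{P}_a}{d\mathbb{P}_0}=\exp\big(\int_0^T\langle a_s,dB_s\rangle-\frac12\int_0^T\|a_s\|^2ds\big)$, with expectation $\mathbb{E}^a$. Preferences: $U_P(x)=-e^{-\gamma_Px}$, $U_A(x)=-e^{-\gamma_Ax}$ with $\gamma_P,\gamma_A>0$; the agent's reservation utility is $U_A(y_0)$, $y_0\in\mathbb{R}$. Effort cost: $k(a)=\frac12\langle a,\Gamma a\rangle$. Contracts: with $f^*(z)=\frac12\langle z,(\gamma_AI_d-\Gamma^{-1})z\rangle$, for $y\ge y_0$ and $\beta\in\mathcal{A}$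 set $Y_T^{y,\beta}=y+\int_0^Tf^*(\beta_s)ds+\int_0^T\langle\beta_s,dB_s\rangle$. The agent's best reply to the contract $Y_T^{y,\beta}$ is the effort $a=\Gamma^{-1}\beta$. In the "enlarged" problem the principal may offer any such contract, without requiring measurability with respect to the filtration generated by $X$. *)

theory Defs
  imports "HOL-Probability.Probability"
begin

text \<open>
  Stochastic setting. Time runs through \<open>[0,T]\<close>, as a subset of the reals; no usual conditions are
  imposed on the filtration. Processes are functions \<open>real \<Rightarrow> 'a \<Rightarrow> _\<close> whose values outside
  \<open>[0,T]\<close> are irrelevant.
\<close>

definition filtered_prob_space :: "'a measure \<Rightarrow> (real \<Rightarrow> 'a measure) \<Rightarrow> real \<Rightarrow> bool" where
  "filtered_prob_space M F T \<longleftrightarrow>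
     prob_space M \<and>
     (\<forall>t\<in>{0..T}. subalgebra M (F t)) \<and>
     (\<forall>t\<in>{0..T}. \<forall>s\<in>{0..t}. subalgebra (F t) (F s))"

definition brownian_motion ::
  "'a measure \<Rightarrow> (real \<Rightarrow> 'a measure) \<Rightarrow> real \<Rightarrow> (real \<Rightarrow> 'a \<Rightarrow> real ^ 'd) \<Rightarrow> bool" where
  "brownian_motion M F T B \<longleftrightarrow>
     (\<forall>t\<in>{0..T}. B t \<in> borel_measurable (F t)) \<and>
     (AE \<omega> in M. B 0 \<omega> = 0) \<and>
     (AE \<omega> in M. continuous_on {0..T} (\<lambda>t. B t \<omega>)) \<and>
     (\<forall>s t. 0 \<le> s \<and> s < t \<and> t \<le> T \<longrightarrow>
        distributed M lborel (\<lambda>\<omega>. B t \<omega> - B s \<omega>)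
          (\<lambda>x. ennreal (\<Prod>i\<in>UNIV. normal_density 0 (sqrt (t - s)) (x $ i))) \<and>
        prob_space.indep_set M (sets (F s))
          {(\<lambda>\<omega>. B t \<omega> - B s \<omega>) -` S \<inter> space M | S. S \<in> sets borel})"

definition progressively_measurable ::
  "(real \<Rightarrow> 'a measure) \<Rightarrow> real \<Rightarrow> (real \<Rightarrow> 'a \<Rightarrow> real ^ 'd) \<Rightarrow> bool" where
  "progressively_measurable F T a \<longleftrightarrow>
     (\<forall>t\<in>{0..T}. (\<lambda>(s, \<omega>). a s \<omega>) \<in> borel_measurable (restrict_space borel {0..t} \<Otimes>\<^sub>M F t))"

text \<open>
  The It\^o integral in its \<open>L\<^sup>2\<close> form. A simple integrand on \<open>[0,t]\<close> is given by grid points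
  \<open>0 \<le> \<tau> 0 \<le> \<dots> \<le> \<tau> n \<le> t\<close> and bounded \<open>F (\<tau> i)\<close>-measurable vectors \<open>\<xi> i\<close>, for \<open>i < n\<close>.
\<close>

definition simple_integrand ::
  "'a measure \<Rightarrow> (real \<Rightarrow> 'a measure) \<Rightarrow> real \<Rightarrow>
   nat \<Rightarrow> (nat \<Rightarrow> real) \<Rightarrow> (nat \<Rightarrow> 'a \<Rightarrow> real ^ 'd) \<Rightarrow> bool" where
  "simple_integrand M F t n \<tau> \<xi> \<longleftrightarrow>
     0 \<le> \<tau> 0 \<and> (\<forall>i<n. \<tau> i \<le> \<tau> (Suc i)) \<and> \<tau> n \<le> t \<and>
     (\<forall>i<n. \<xi> i \<in> borel_measurable (F (\<tau> i))) \<and>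
     (\<exists>C. \<forall>i<n. \<forall>\<omega>\<in>space M. norm (\<xi> i \<omega>) \<le> C)"

definition simple_process ::
  "nat \<Rightarrow> (nat \<Rightarrow> real) \<Rightarrow> (nat \<Rightarrow> 'a \<Rightarrow> real ^ 'd) \<Rightarrow> real \<Rightarrow> 'a \<Rightarrow> real ^ 'd" where
  "simple_process n \<tau> \<xi> s \<omega> = (\<Sum>i<n. indicator {\<tau> i<..\<tau> (Suc i)} s *\<^sub>R \<xi> i \<omega>)"

definition simple_integral ::
  "(real \<Rightarrow> 'a \<Rightarrow> real ^ 'd) \<Rightarrow>
   nat \<Rightarrow> (nat \<Rightarrow> real) \<Rightarrow> (nat \<Rightarrow> 'a \<Rightarrow> real ^ 'd) \<Rightarrow> 'a \<Rightarrow> real" where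
  "simple_integral B n \<tau> \<xi> \<omega> = (\<Sum>i<n. \<xi> i \<omega> \<bullet> (B (\<tau> (Suc i)) \<omega> - B (\<tau> i) \<omega>))"

definition is_ito_integral ::
  "'a measure \<Rightarrow> (real \<Rightarrow> 'a measure) \<Rightarrow> (real \<Rightarrow> 'a \<Rightarrow> real ^ 'd) \<Rightarrow> real \<Rightarrow>
   (real \<Rightarrow> 'a \<Rightarrow> real ^ 'd) \<Rightarrow> ('a \<Rightarrow> real) \<Rightarrow> bool" where
  "is_ito_integral M F B t a I \<longleftrightarrow>
     I \<in> borel_measurable M \<and>
     (\<exists>n \<tau> \<xi>.
        (\<forall>k::nat. simple_integrand M F t (n k) (\<tau> k) (\<xi> k)) \<and>
        (\<lambda>k. \<integral>\<^sup>+ \<omega>. (\<integral>\<^sup>+ s\<in>{0..t}.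
              ennreal ((norm (simple_process (n k) (\<tau> k) (\<xi> k) s \<omega> - a s \<omega>))\<^sup>2) \<partial>lborel) \<partial>M)
          \<longlonglongrightarrow> 0 \<and>
        (\<lambda>k. \<integral>\<^sup>+ \<omega>. ennreal ((simple_integral B (n k) (\<tau> k) (\<xi> k) \<omega> - I \<omega>)\<^sup>2) \<partial>M)
          \<longlonglongrightarrow> 0)"

text \<open>
  \<open>\<integral>\<^sub>0\<^sup>t \<langle>a\<^sub>s, dB\<^sub>s\<rangle>\<close>: some version, since \<open>is_ito_integral\<close> determines the integral only up to
  almost sure equality.
\<close>

definition ito_integral ::
  "'a measure \<Rightarrow> (real \<Rightarrow> 'a measure) \<Rightarrow> (real \<Rightarrow> 'a \<Rightarrow> real ^ 'd) \<Rightarrow> real \<Rightarrow>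
   (real \<Rightarrow> 'a \<Rightarrow> real ^ 'd) \<Rightarrow> 'a \<Rightarrow> real" where
  "ito_integral M F B t a = (SOME I. is_ito_integral M F B t a I)"

definition volterra_kernel :: "real \<Rightarrow> (real \<Rightarrow> real \<Rightarrow> real ^ 'd) \<Rightarrow> bool" where
  "volterra_kernel T K \<longleftrightarrow>
     (\<lambda>(t, s). K t s) \<in> borel_measurable (restrict_space borel ({0..T} \<times> {0..T})) \<and>
     (\<forall>t\<in>{0..T}. \<forall>s\<in>{0..T}. t \<le> s \<longrightarrow> K t s = 0) \<and>
     (SUP t\<in>{0..T}. \<integral>\<^sup>+ s\<in>{0..T}. ennreal ((norm (K t s))\<^sup>2) \<partial>lborel) < \<infinity>"

definition output_process ::
  "'a measure \<Rightarrow> (real \<Rightarrow> 'a measure) \<Rightarrow> (real \<Rightarrow> 'a \<Rightarrow> real ^ 'd) \<Rightarrow>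
   (real \<Rightarrow> real) \<Rightarrow> (real \<Rightarrow> real \<Rightarrow> real ^ 'd) \<Rightarrow> real \<Rightarrow> 'a \<Rightarrow> real" where
  "output_process M F B g0 K t \<omega> = g0 t + ito_integral M F B t (\<lambda>s _. K t s) \<omega>"

definition admissible ::
  "'a measure \<Rightarrow> (real \<Rightarrow> 'a measure) \<Rightarrow> real \<Rightarrow> (real \<Rightarrow> 'a \<Rightarrow> real ^ 'd) set" where
  "admissible M F T =
     {a. progressively_measurable F T a \<and>
         (\<exists>A>0. AE \<omega> in M. (\<integral>\<^sup>+ s\<in>{0..T}. ennreal ((norm (a s \<omega>))\<^sup>2) \<partial>lborel) < ennreal A)}"

definition effort_measure ::
  "'a measure \<Rightarrow> (real \<Rightarrow> 'a measure) \<Rightarrow> real \<Rightarrow> (real \<Rightarrow> 'a \<Rightarrow> real ^ 'd) \<Rightarrow>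
   (real \<Rightarrow> 'a \<Rightarrow> real ^ 'd) \<Rightarrow> 'a measure" where
  "effort_measure M F T B a =
     density M (\<lambda>\<omega>. ennreal (exp (ito_integral M F B T a \<omega>
                                   - 1/2 * (LBINT s:{0..T}. (norm (a s \<omega>))\<^sup>2))))"

definition cara_utility :: "real \<Rightarrow> real \<Rightarrow> real" where
  "cara_utility \<gamma> x = - exp (- \<gamma> * x)"

definition f_star :: "real \<Rightarrow> real ^ 'd ^ 'd \<Rightarrow> real ^ 'd \<Rightarrow> real" where
  "f_star \<gamma>A \<Gamma> z = 1/2 * (z \<bullet> ((\<gamma>A *\<^sub>R mat 1 - matrix_inv \<Gamma>) *v z))"

definition contract ::
  "'a measure \<Rightarrow> (real \<Rightarrow> 'a measure) \<Rightarrow> real \<Rightarrow> (real \<Rightarrow> 'a \<Rightarrow> real ^ 'd) \<Rightarrow>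
   real \<Rightarrow> real ^ 'd ^ 'd \<Rightarrow> real \<Rightarrow> (real \<Rightarrow> 'a \<Rightarrow> real ^ 'd) \<Rightarrow> 'a \<Rightarrow> real" where
  "contract M F T B \<gamma>A \<Gamma> y \<beta> \<omega> =
     y + (LBINT s:{0..T}. f_star \<gamma>A \<Gamma> (\<beta> s \<omega>)) + ito_integral M F B T \<beta> \<omega>"

text \<open>The agent's best reply to the contract with sensitivity process \<open>\<beta>\<close>.\<close>

definition best_reply ::
  "real ^ 'd ^ 'd \<Rightarrow> (real \<Rightarrow> 'a \<Rightarrow> real ^ 'd) \<Rightarrow> real \<Rightarrow> 'a \<Rightarrow> real ^ 'd" where
  "best_reply \<Gamma> \<beta> t \<omega> = matrix_inv \<Gamma> *v \<beta> t \<omega>"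

text \<open>
  \<open>E\<^sup>a[U\<^sub>P(X\<^sub>T - \<xi>)]\<close>. The Bochner integral of a non-integrable function is 0 by convention; the
  main theorem also asserts integrability for all contracts of the enlarged problem.
\<close>

definition principal_utility ::
  "'a measure \<Rightarrow> (real \<Rightarrow> 'a measure) \<Rightarrow> real \<Rightarrow> (real \<Rightarrow> 'a \<Rightarrow> real ^ 'd) \<Rightarrow>
   (real \<Rightarrow> real) \<Rightarrow> (real \<Rightarrow> real \<Rightarrow> real ^ 'd) \<Rightarrow> real \<Rightarrow>
   (real \<Rightarrow> 'a \<Rightarrow> real ^ 'd) \<Rightarrow> ('a \<Rightarrow> real) \<Rightarrow> real" where
  "principal_utility M F T B g0 K \<gamma>P a \<xi> =
     (\<integral>\<omega>. cara_utility \<gamma>P (output_process M F B g0 K T \<omega> - \<xi> \<omega>) \<partial>(effort_measure M F T B a))"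

text \<open>
  The suprema below are over non-empty sets of reals bounded above by 0, so \<open>Sup\<close> on the reals
  is the genuine supremum.
\<close>

definition V_SB_at ::
  "'a measure \<Rightarrow> (real \<Rightarrow> 'a measure) \<Rightarrow> real \<Rightarrow> (real \<Rightarrow> 'a \<Rightarrow> real ^ 'd) \<Rightarrow>
   (real \<Rightarrow> real) \<Rightarrow> (real \<Rightarrow> real \<Rightarrow> real ^ 'd) \<Rightarrow> real \<Rightarrow> real \<Rightarrow> real ^ 'd ^ 'd \<Rightarrow> real \<Rightarrow> real" where
  "V_SB_at M F T B g0 K \<gamma>P \<gamma>A \<Gamma> y =
     (SUP \<beta>\<in>admissible M F T.
        principal_utility M F T B g0 K \<gamma>P (best_reply \<Gamma> \<beta>) (contract M F T B \<gamma>A \<Gamma> y \<beta>))"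

definition V_SB ::
  "'a measure \<Rightarrow> (real \<Rightarrow> 'a measure) \<Rightarrow> real \<Rightarrow> (real \<Rightarrow> 'a \<Rightarrow> real ^ 'd) \<Rightarrow>
   (real \<Rightarrow> real) \<Rightarrow> (real \<Rightarrow> real \<Rightarrow> real ^ 'd) \<Rightarrow> real \<Rightarrow> real \<Rightarrow> real ^ 'd ^ 'd \<Rightarrow> real \<Rightarrow> real" where
  "V_SB M F T B g0 K \<gamma>P \<gamma>A \<Gamma> y0 = (SUP y\<in>{y0..}. V_SB_at M F T B g0 K \<gamma>P \<gamma>A \<Gamma> y)"

definition L2_inner :: "real \<Rightarrow> (real \<Rightarrow> real ^ 'd) \<Rightarrow> (real \<Rightarrow> real ^ 'd) \<Rightarrow> real" where
  "L2_inner T f g = (LBINT s:{0..T}. f s \<bullet> g s)"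

end

theory Submission
  imports Defs
begin

text \<open>Set \<open>h = \<Gamma>\<inverse>\<beta> + \<gamma>\<^sub>P \<beta> - \<gamma>\<^sub>P K\<^sub>T\<close>. By linearity of the Ito integral, the density of the effort measure times
  \<open>exp (- \<gamma>\<^sub>P (X\<^sub>T - Y\<^sub>T))\<close> is a constant times \<open>Z exp (\<integral> q(s, \<beta>\<^sub>s) ds)\<close>, where \<open>Z\<close> is the stochastic
  exponential of \<open>h\<close> and \<open>q(s, \<cdot>)\<close> is a deterministic quadratic form minimised at \<open>\<beta>*\<^sub>s\<close>. Completing the
  square gives \<open>\<integral> q = \<phi>\<^sub>0 + (\<gamma>\<^sub>P / 2) \<integral> \<langle>\<beta> - \<beta>*, ((\<gamma>\<^sub>A + \<gamma>\<^sub>P) I + \<Gamma>\<inverse>) (\<beta> - \<beta>*)\<rangle>\<close>, and \<open>E[Z] = 1\<close> because \<open>h\<close> has a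
  bounded quadratic variation; so the optimum and its uniqueness can be read off pathwise.

  An admissible \<open>a\<close> is approximated by the step process that uses, on each cell of the uniform grid, the
  average of \<open>a\<close> over the preceding cell. This choice is adapted, linear in \<open>a\<close>, and contracts the
  pathwise \<open>L\<^sup>2\<close> norm; hence linearity of the Ito integral needs no merging of grids, and the
  approximating exponentials are bounded in \<open>L\<^sup>2(P)\<close>, which lets \<open>E[Z] = 1\<close> pass to the limit.\<close>

text \<open>Two features of the definitions shape the work. \<open>ito_integral\<close> picks an
  arbitrary version through \<open>SOME\<close>, so the existence of an L2 limit, and its
  independence of the approximating sequence, must precede any calculation; linearity then holds
  only almost surely. Moreover, the bound in \<open>admissible\<close> holds off a null set that
  need not belong to \<open>F t\<close>, while simple integrands must be adapted and bounded
  everywhere; the averages are therefore truncated at a deterministic level. The same pathwise bound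
  stands in for Novikov's condition: on a grid, the squared exponential of \<open>h\<close> is the
  exponential of \<open>2 h\<close> times exp of the quadratic variation, so its mean is controlled
  by that bound.

  The matrices \<open>N\<close> and \<open>H\<close> come from the exponent itself. The terms
  \<open>(norm (G *v b))\<^sup>2\<close> in the effort density and in \<open>Z\<close> cancel; what
  is left has quadratic part \<open>\<gamma>P / 2 * (b \<bullet> (N *v b))\<close> and linear part
  \<open>- \<gamma>P * (b \<bullet> (H *v k))\<close>, hence the minimiser solves
  \<open>N *v b = H *v k\<close>.\<close>

abbreviation sq_norm :: "(real \<Rightarrow> 'b::real_normed_vector) \<Rightarrow> ennreal" where
  "sq_norm f \<equiv> \<integral>\<^sup>+s. ennreal ((norm (f s))\<^sup>2) \<partial>lborel"

abbreviation mean_square :: "'a measure \<Rightarrow> ('a \<Rightarrow> real) \<Rightarrow> ennreal" where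
  "mean_square M X \<equiv> \<integral>\<^sup>+w. ennreal ((X w)\<^sup>2) \<partial>M"

section \<open>Gaussian increments\<close>

lemma nn_integral_lborel_prod_cart:
  fixes f :: "'d::finite \<Rightarrow> real \<Rightarrow> ennreal"
  assumes [measurable]: "\<And>i. f i \<in> borel_measurable borel"
  shows "(\<integral>\<^sup>+x. (\<Prod>i\<in>UNIV. f i (x $ i)) \<partial>(lborel :: (real^'d) measure)) = (\<Prod>i\<in>UNIV. \<integral>\<^sup>+x. f i x \<partial>lborel)"
proof -
  \<comment> \<open>\<open>idx\<close> reads the coordinate off a basis vector, which turns products
    over \<open>Basis\<close> into products over \<open>UNIV\<close>.\<close>
  define idx where "idx b = (THE i. axis i (1::real) = b)" for b :: "real^'d"
  have idx: "idx (axis i 1) = i" for i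
    unfolding idx_def by (rule the_equality) (auto simp: axis_eq_axis)
  have B: "(Basis :: (real^'d) set) = (\<lambda>i. axis i 1) ` UNIV"
    by (auto simp: Basis_vec_def)
  have inj: "inj_on (\<lambda>i. axis i (1::real) :: real^'d) UNIV"
    by (auto simp: inj_on_def axis_eq_axis)
  have "(\<integral>\<^sup>+x. (\<Prod>b\<in>Basis. f (idx b) (x \<bullet> b)) \<partial>(lborel :: (real^'d) measure)) =
      (\<Prod>b\<in>(Basis :: (real^'d) set). \<integral>\<^sup>+x. f (idx b) x \<partial>lborel)"
    by (rule nn_integral_lborel_prod) auto
  then show ?thesis
    unfolding B by (simp add: prod.reindex[OF inj] idx inner_axis)
qed

text \<open>Completing the square in the exponent moves the exponential factor into the mean; the
  shifted normal density has mass 1.\<close>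

lemma nn_integral_normal_density_exp:
  assumes "\<sigma> > 0"
  shows "(\<integral>\<^sup>+x. ennreal (normal_density 0 \<sigma> x) * ennreal (exp (u * x)) \<partial>lborel) = ennreal (exp (\<sigma>\<^sup>2 * u\<^sup>2 / 2))"
proof -
  have "normal_density 0 \<sigma> x * exp (u * x) = exp (\<sigma>\<^sup>2 * u\<^sup>2 / 2) * normal_density (\<sigma>\<^sup>2 * u) \<sigma> x" for x
  proof -
    have "- x\<^sup>2 / (2 * \<sigma>\<^sup>2) + u * x = \<sigma>\<^sup>2 * u\<^sup>2 / 2 + - (x - \<sigma>\<^sup>2 * u)\<^sup>2 / (2 * \<sigma>\<^sup>2)"
      using assms by (simp add: field_simps power2_eq_square)
    then have "exp (- x\<^sup>2 / (2 * \<sigma>\<^sup>2)) * exp (u * x) = exp (\<sigma>\<^sup>2 * u\<^sup>2 / 2) * exp (- (x - \<sigma>\<^sup>2 * u)\<^sup>2 / (2 * \<sigma>\<^sup>2))"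
      by (simp only: exp_add[symmetric])
    then show ?thesis
      unfolding normal_density_def by simp
  qed
  then have "(\<integral>\<^sup>+x. ennreal (normal_density 0 \<sigma> x) * ennreal (exp (u * x)) \<partial>lborel)
      = (\<integral>\<^sup>+x. ennreal (exp (\<sigma>\<^sup>2 * u\<^sup>2 / 2)) * ennreal (normal_density (\<sigma>\<^sup>2 * u) \<sigma> x) \<partial>lborel)"
    by (simp add: ennreal_mult[symmetric])
  also have "\<dots> = ennreal (exp (\<sigma>\<^sup>2 * u\<^sup>2 / 2)) * (\<integral>\<^sup>+x. ennreal (normal_density (\<sigma>\<^sup>2 * u) \<sigma> x) \<partial>lborel)"
    by (rule nn_integral_cmult) auto
  also have "(\<integral>\<^sup>+x. ennreal (normal_density (\<sigma>\<^sup>2 * u) \<sigma> x) \<partial>lborel) = 1"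
    using assms by (subst nn_integral_eq_integral) auto
  finally show ?thesis by simp
qed

locale isotropic_gaussian = prob_space M for M :: "'a measure" +
  fixes X :: "'a \<Rightarrow> real ^ 'd" and \<sigma> :: real
  assumes sigma_pos: "\<sigma> > 0"
    and distributed_X: "distributed M lborel X (\<lambda>x. ennreal (\<Prod>i\<in>UNIV. normal_density 0 \<sigma> (x $ i)))"
begin

lemma measurable_X [measurable]: "X \<in> borel_measurable M"
  using distributed_measurable[OF distributed_X] by simp

lemma measurable_component [measurable]: "(\<lambda>w. X w $ i) \<in> borel_measurable M"
  by (rule measurable_compose[OF measurable_X borel_measurable_nth])

text \<open>The common source of the exponential moment, the marginals and the pairwise
  independence: each follows by choosing exponentials, indicators or the constant 1 as
  factors.\<close>

lemma nn_integral_prod: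
  assumes [measurable]: "\<And>i. f i \<in> borel_measurable borel"
  shows "(\<integral>\<^sup>+w. (\<Prod>i\<in>UNIV. f i (X w $ i)) \<partial>M)
      = (\<Prod>i\<in>UNIV. \<integral>\<^sup>+x. ennreal (normal_density 0 \<sigma> x) * f i x \<partial>lborel)"
proof -
  have "(\<integral>\<^sup>+w. (\<Prod>i\<in>UNIV. f i (X w $ i)) \<partial>M)
      = (\<integral>\<^sup>+x. ennreal (\<Prod>i\<in>UNIV. normal_density 0 \<sigma> (x $ i)) * (\<Prod>i\<in>UNIV. f i (x $ i)) \<partial>lborel)"
    by (rule distributed_nn_integral[OF distributed_X, symmetric]) measurable
  also have "\<dots> = (\<integral>\<^sup>+x. (\<Prod>i\<in>UNIV. ennreal (normal_density 0 \<sigma> (x $ i)) * f i (x $ i)) \<partial>(lborel :: (real^'d) measure))"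
    by (simp add: prod.distrib prod_ennreal)
  also have "\<dots> = (\<Prod>i\<in>UNIV. \<integral>\<^sup>+x. ennreal (normal_density 0 \<sigma> x) * f i x \<partial>lborel)"
    by (rule nn_integral_lborel_prod_cart) measurable
  finally show ?thesis .
qed

lemma nn_integral_exp: "(\<integral>\<^sup>+w. ennreal (exp (u \<bullet> X w)) \<partial>M) = ennreal (exp (\<sigma>\<^sup>2 * (norm u)\<^sup>2 / 2))"
proof -
  have "(\<integral>\<^sup>+w. ennreal (exp (u \<bullet> X w)) \<partial>M) = (\<integral>\<^sup>+w. (\<Prod>i\<in>UNIV. ennreal (exp (u $ i * (X w $ i)))) \<partial>M)"
    by (simp add: inner_vec_def exp_sum prod_ennreal)
  also have "\<dots> = (\<Prod>i\<in>UNIV. ennreal (exp (\<sigma>\<^sup>2 * (u $ i)\<^sup>2 / 2)))"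
    by (subst nn_integral_prod) (auto simp: nn_integral_normal_density_exp sigma_pos)
  also have "\<dots> = ennreal (exp (\<sigma>\<^sup>2 * (norm u)\<^sup>2 / 2))"
    unfolding power2_norm_eq_inner inner_vec_def
    by (simp add: prod_ennreal exp_sum[symmetric] sum_distrib_left sum_divide_distrib power2_eq_square)
  finally show ?thesis .
qed

lemma emeasure_component:
  assumes [measurable]: "A \<in> sets borel"
  shows "emeasure M ((\<lambda>w. X w $ i) -` A \<inter> space M) = (\<integral>\<^sup>+x. ennreal (normal_density 0 \<sigma> x) * indicator A x \<partial>lborel)"
proof -
  have "emeasure M ((\<lambda>w. X w $ i) -` A \<inter> space M) = (\<integral>\<^sup>+w. indicator A (X w $ i) \<partial>M)"
    by (subst nn_integral_indicator[of "(\<lambda>w. X w $ i) -` A \<inter> space M", symmetric], measurable)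
      (auto intro!: nn_integral_cong simp del: nn_integral_indicator split: split_indicator)
  also have "\<dots> = (\<integral>\<^sup>+w. (\<Prod>k\<in>UNIV. (if k = i then indicator A (X w $ k) else 1)) \<partial>M)"
    by (simp add: prod.delta)
  also have "\<dots> = (\<Prod>k\<in>UNIV. \<integral>\<^sup>+x. ennreal (normal_density 0 \<sigma> x) * (if k = i then indicator A x else 1) \<partial>lborel)"
    by (rule nn_integral_prod) measurable
  also have "\<dots> = (\<Prod>k\<in>UNIV. if k = i then (\<integral>\<^sup>+x. ennreal (normal_density 0 \<sigma> x) * indicator A x \<partial>lborel) else 1)"
    by (intro prod.cong refl) (auto simp: nn_integral_eq_integral sigma_pos)
  finally show ?thesis by (simp add: prod.delta)
qed

lemma distributed_component: "distributed M lborel (\<lambda>w. X w $ i) (normal_density 0 \<sigma>)"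
  unfolding distributed_def
proof (intro conjI)
  show "distr M lborel (\<lambda>w. X w $ i) = density lborel (\<lambda>x. ennreal (normal_density 0 \<sigma> x))"
    by (rule measure_eqI) (simp_all add: emeasure_distr emeasure_density emeasure_component)
qed measurable

text \<open>With indicators in two coordinates, \<open>nn_integral_prod\<close> evaluates
  rectangles, and rectangles determine the joint law.\<close>

lemma indep_components:
  assumes "i \<noteq> j"
  shows "indep_var borel (\<lambda>w. X w $ i) borel (\<lambda>w. X w $ j)"
  unfolding indep_var_distribution_eq
proof (intro conjI)
  interpret P: prob_space "distr M borel (\<lambda>w. X w $ k)" for k by (rule prob_space_distr) measurable
  show "distr M borel (\<lambda>w. X w $ i) \<Otimes>\<^sub>M distr M borel (\<lambda>w. X w $ j)
      = distr M (borel \<Otimes>\<^sub>M borel) (\<lambda>w. (X w $ i, X w $ j))"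
  proof (rule pair_measure_eqI)
    fix A C assume "A \<in> sets (distr M borel (\<lambda>w. X w $ i))" "C \<in> sets (distr M borel (\<lambda>w. X w $ j))"
    then have [measurable]: "A \<in> sets borel" "C \<in> sets borel" by auto
    have "emeasure (distr M (borel \<Otimes>\<^sub>M borel) (\<lambda>w. (X w $ i, X w $ j))) (A \<times> C)
        = (\<integral>\<^sup>+w. indicator A (X w $ i) * indicator C (X w $ j) \<partial>M)"
      by (subst emeasure_distr, measurable,
          subst nn_integral_indicator[of "(\<lambda>w. (X w $ i, X w $ j)) -` (A \<times> C) \<inter> space M", symmetric], measurable)
        (auto intro!: nn_integral_cong simp del: nn_integral_indicator split: split_indicator)
    also have "\<dots> = (\<integral>\<^sup>+w. (\<Prod>k\<in>UNIV. (if k = i then indicator A (X w $ k) else 1) * (if k = j then indicator C (X w $ k) else 1)) \<partial>M)"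
      by (simp add: prod.distrib)
    also have "\<dots> = (\<Prod>k\<in>UNIV. \<integral>\<^sup>+x. ennreal (normal_density 0 \<sigma> x) * ((if k = i then indicator A x else 1) * (if k = j then indicator C x else 1)) \<partial>lborel)"
      by (rule nn_integral_prod) measurable
    also have "\<dots> = (\<Prod>k\<in>UNIV. (if k = i then (\<integral>\<^sup>+x. ennreal (normal_density 0 \<sigma> x) * indicator A x \<partial>lborel) else 1)
        * (if k = j then (\<integral>\<^sup>+x. ennreal (normal_density 0 \<sigma> x) * indicator C x \<partial>lborel) else 1))"
      using assms by (intro prod.cong refl) (auto simp: nn_integral_eq_integral sigma_pos)
    also have "\<dots> = (\<integral>\<^sup>+x. ennreal (normal_density 0 \<sigma> x) * indicator A x \<partial>lborel)
        * (\<integral>\<^sup>+x. ennreal (normal_density 0 \<sigma> x) * indicator C x \<partial>lborel)"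
      by (simp add: prod.distrib)
    finally show "emeasure (distr M borel (\<lambda>w. X w $ i)) A * emeasure (distr M borel (\<lambda>w. X w $ j)) C
        = emeasure (distr M (borel \<Otimes>\<^sub>M borel) (\<lambda>w. (X w $ i, X w $ j))) (A \<times> C)"
      by (simp add: emeasure_distr emeasure_component)
  qed (auto intro: P.sigma_finite_measure_axioms)
qed measurable

lemma integrable_component: "integrable M (\<lambda>w. X w $ i)"
proof -
  have "integrable lborel (\<lambda>x. normal_density 0 \<sigma> x * x)"
    by (rule integrable_normal_moment_nz_1[OF sigma_pos])
  then show ?thesis
    by (subst distributed_integrable[OF distributed_component, where g="\<lambda>x. x", symmetric]) (auto simp: sigma_pos)
qed

lemma expectation_component: "expectation (\<lambda>w. X w $ i) = 0"
  using normal_distributed_expectation[OF sigma_pos distributed_component] .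

lemma integrable_component_mult: "integrable M (\<lambda>w. X w $ i * (X w $ j))"
proof (cases "i = j")
  case True
  have "integrable lborel (\<lambda>x. normal_density 0 \<sigma> x * x^2)"
    using integrable_normal_moment[OF sigma_pos, of 0 2] by simp
  then have "integrable M (\<lambda>w. (X w $ i)\<^sup>2)"
    by (subst distributed_integrable[OF distributed_component, where g="\<lambda>x. x\<^sup>2", symmetric]) (auto simp: sigma_pos)
  then show ?thesis using True by (simp add: power2_eq_square)
next
  case False
  then show ?thesis by (intro indep_var_integrable indep_components integrable_component)
qed

lemma expectation_component_mult:
  "expectation (\<lambda>w. X w $ i * (X w $ j)) = (if i = j then \<sigma>\<^sup>2 else 0)"
proof (cases "i = j")
  case True
  then show ?thesis
    using normal_distributed_variance[OF sigma_pos distributed_component, of i]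
    by (simp add: expectation_component power2_eq_square)
next
  case False
  then show ?thesis
    by (subst indep_var_lebesgue_integral[OF indep_components])
      (auto simp: integrable_component expectation_component)
qed

end

section \<open>Independence of Brownian increments from the past\<close>

locale brownian_filtration =
  fixes M :: "'a measure" and F :: "real \<Rightarrow> 'a measure" and T :: real
    and B :: "real \<Rightarrow> 'a \<Rightarrow> real ^ 'd"
  assumes T_pos: "T > 0"
    and filtered: "filtered_prob_space M F T"
    and brownian: "brownian_motion M F T B"

sublocale brownian_filtration \<subseteq> prob_space M
  using filtered by (simp add: filtered_prob_space_def)

context brownian_filtration
begin

lemma subalgebra_F: "0 \<le> t \<Longrightarrow> t \<le> T \<Longrightarrow> subalgebra M (F t)"
  using filtered by (simp add: filtered_prob_space_def)

lemma space_F: "0 \<le> t \<Longrightarrow> t \<le> T \<Longrightarrow> space (F t) = space M"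
  using subalgebra_F[of t] by (simp add: subalgebra_def)

lemma measurable_F_M: "f \<in> measurable (F t) N \<Longrightarrow> 0 \<le> t \<Longrightarrow> t \<le> T \<Longrightarrow> f \<in> measurable M N"
  by (rule measurable_from_subalg[OF subalgebra_F])

lemma measurable_F_mono: "f \<in> measurable (F s) N \<Longrightarrow> 0 \<le> s \<Longrightarrow> s \<le> t \<Longrightarrow> t \<le> T \<Longrightarrow> f \<in> measurable (F t) N"
  using filtered measurable_from_subalg[of "F t" "F s" f N] by (simp add: filtered_prob_space_def)

lemma measurable_B_F: "0 \<le> t \<Longrightarrow> t \<le> T \<Longrightarrow> B t \<in> borel_measurable (F t)"
  using brownian by (simp add: brownian_motion_def)

lemma measurable_B: "0 \<le> t \<Longrightarrow> t \<le> T \<Longrightarrow> B t \<in> borel_measurable M"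
  by (rule measurable_F_M[OF measurable_B_F])

lemma gaussian_increment:
  assumes "0 \<le> s" "s < t" "t \<le> T"
  shows "isotropic_gaussian M (\<lambda>w. B t w - B s w) (sqrt (t - s))"
  using brownian assms by unfold_locales (auto simp: brownian_motion_def)

lemma prob_increment_Int:
  assumes st: "0 \<le> s" "s < t" "t \<le> T" and "A \<in> sets (F s)" "S \<in> sets borel"
  shows "prob (A \<inter> ((\<lambda>w. B t w - B s w) -` S \<inter> space M)) = prob A * prob ((\<lambda>w. B t w - B s w) -` S \<inter> space M)"
proof -
  have "indep_set (sets (F s)) {(\<lambda>w. B t w - B s w) -` S \<inter> space M | S. S \<in> sets borel}"
    using brownian st by (auto simp: brownian_motion_def)
  from indep_setD[OF this assms(4)] assms(5) show ?thesis by blast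
qed

text \<open>\<open>brownian_motion\<close> gives independence of families of sets, while the moment
  computations need it for real random variables. Preimages of Borel sets form Int-stable
  generators, so the product formula on them suffices.\<close>

lemma indep_increment_compose:
  fixes Y :: "'a \<Rightarrow> real"
  assumes st: "0 \<le> s" "s < t" "t \<le> T" and Y: "Y \<in> borel_measurable (F s)" and h: "h \<in> borel_measurable borel"
  shows "indep_var borel Y borel (\<lambda>w. h (B t w - B s w))"
proof -
  interpret G: isotropic_gaussian M "\<lambda>w. B t w - B s w" "sqrt (t - s)"
    by (rule gaussian_increment[OF st])
  let ?h = "\<lambda>w. h (B t w - B s w)"
  have mY: "Y \<in> borel_measurable M"
    using measurable_F_M[OF Y] st by auto
  have mh: "?h \<in> borel_measurable M"
    using measurable_compose[OF G.measurable_X h] .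
  have stable: "Int_stable {f -` S \<inter> space M | S. S \<in> sets borel}" for f :: "'a \<Rightarrow> real"
  proof (rule Int_stableI)
    fix a b assume "a \<in> {f -` S \<inter> space M | S. S \<in> sets borel}" "b \<in> {f -` S \<inter> space M | S. S \<in> sets borel}"
    then obtain S S' where "S \<in> sets borel" "S' \<in> sets borel" "a = f -` S \<inter> space M" "b = f -` S' \<inter> space M"
      by blast
    then show "a \<inter> b \<in> {f -` S \<inter> space M | S. S \<in> sets borel}" by (intro CollectI exI[of _ "S \<inter> S'"]) auto
  qed
  have "indep_set {Y -` S \<inter> space M | S. S \<in> sets borel} {?h -` S \<inter> space M | S. S \<in> sets borel}"
  proof (rule indep_setI)
    fix a b assume "a \<in> {Y -` S \<inter> space M | S. S \<in> sets borel}" "b \<in> {?h -` S \<inter> space M | S. S \<in> sets borel}"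
    then obtain A C where AC: "A \<in> sets borel" "C \<in> sets borel"
      and ab: "a = Y -` A \<inter> space M" "b = ?h -` C \<inter> space M" by blast
    have "b = (\<lambda>w. B t w - B s w) -` (h -` C) \<inter> space M" using ab by auto
    moreover have "a \<in> sets (F s)"
      using measurable_sets[OF Y AC(1)] space_F[of s] st ab by simp
    moreover have "h -` C \<in> sets borel" using measurable_sets[OF h AC(2)] by simp
    ultimately show "prob (a \<inter> b) = prob a * prob b"
      using prob_increment_Int[OF st] by blast
  qed (use measurable_sets[OF mY] measurable_sets[OF mh] in auto)
  from indep_set_sigma_sets[OF this stable stable] show ?thesis
    unfolding indep_var_eq using mY mh by simp
qed

text \<open>Independence makes the joint law of the point and the increment a product; the first
  factor is the law of the identity as a map into \<open>F s\<close>. Fubini then freezes the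
  argument known at time \<open>s\<close>. This is needed where coefficient and increment do not
  separate into a product, as in an exponential.\<close>

lemma nn_integral_freeze:
  assumes st: "0 \<le> s" "s < t" "t \<le> T" and g: "g \<in> borel_measurable (F s \<Otimes>\<^sub>M borel)"
  shows "(\<integral>\<^sup>+w. g (w, B t w - B s w) \<partial>M) = (\<integral>\<^sup>+w. \<integral>\<^sup>+w'. g (w, B t w' - B s w') \<partial>M \<partial>M)"
proof -
  let ?D = "\<lambda>w. B t w - B s w"
  have D: "?D \<in> measurable M borel"
    using measurable_B[of s] measurable_B[of t] st by (intro borel_measurable_diff) auto
  have sub: "space (F s) = space M" "sets (F s) \<subseteq> sets M"
    using subalgebra_F[of s] st by (auto simp: subalgebra_def)
  then have id: "(\<lambda>w. w) \<in> measurable M (F s)"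
    by (auto simp: measurable_def Int_absorb2 sets.sets_into_space dest: subsetD)
  note [measurable] = id D g
  interpret D: prob_space "distr M borel ?D" by (rule prob_space_distr) measurable
  interpret I: prob_space "distr M (F s) (\<lambda>w. w)" by (rule prob_space_distr) measurable
  have eq: "distr M (F s) (\<lambda>w. w) \<Otimes>\<^sub>M distr M borel ?D = distr M (F s \<Otimes>\<^sub>M borel) (\<lambda>w. (w, ?D w))"
  proof (rule pair_measure_eqI)
    fix A S assume "A \<in> sets (distr M (F s) (\<lambda>w. w))" "S \<in> sets (distr M borel ?D)"
    then have [measurable]: "A \<in> sets (F s)" "S \<in> sets borel" by auto
    have "A \<inter> space M = A" using sets.sets_into_space[of A "F s"] sub by auto
    moreover have "(\<lambda>w. (w, ?D w)) -` (A \<times> S) \<inter> space M = A \<inter> (?D -` S \<inter> space M)"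
      by auto
    ultimately show "emeasure (distr M (F s) (\<lambda>w. w)) A * emeasure (distr M borel ?D) S
        = emeasure (distr M (F s \<Otimes>\<^sub>M borel) (\<lambda>w. (w, ?D w))) (A \<times> S)"
      using prob_increment_Int[OF st, of A S]
      by (simp add: emeasure_distr emeasure_eq_measure ennreal_mult[symmetric])
  qed (auto intro: D.sigma_finite_measure_axioms I.sigma_finite_measure_axioms)
  have "(\<integral>\<^sup>+w. g (w, ?D w) \<partial>M) = (\<integral>\<^sup>+z. g z \<partial>(distr M (F s \<Otimes>\<^sub>M borel) (\<lambda>w. (w, ?D w))))"
    by (subst nn_integral_distr) measurable
  also have "\<dots> = (\<integral>\<^sup>+w. \<integral>\<^sup>+x. g (w, x) \<partial>distr M borel ?D \<partial>distr M (F s) (\<lambda>w. w))"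
    unfolding eq[symmetric] by (subst D.nn_integral_fst[symmetric]) auto
  also have "\<dots> = (\<integral>\<^sup>+w. \<integral>\<^sup>+w'. g (w, ?D w') \<partial>M \<partial>M)"
    by (subst nn_integral_distr, measurable) (intro nn_integral_cong, subst nn_integral_distr, auto)
  finally show ?thesis .
qed

text \<open>The martingale property, by coordinates: each component of the increment has mean 0 and
  is independent of \<open>Y\<close> and \<open>\<eta>\<close>, which are known at time
  \<open>s\<close>.\<close>

lemma has_bochner_integral_increment_0:
  fixes Y :: "'a \<Rightarrow> real"
  assumes st: "0 \<le> s" "s \<le> t" "t \<le> T"
    and Y: "Y \<in> borel_measurable (F s)" "integrable M Y"
    and e: "\<eta> \<in> borel_measurable (F s)" "\<And>w. w \<in> space M \<Longrightarrow> norm (\<eta> w) \<le> C"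
  shows "has_bochner_integral M (\<lambda>w. Y w * (\<eta> w \<bullet> (B t w - B s w))) 0"
\<comment> \<open>The gaussian facts assume positive variance, so an increment of length zero is
  treated apart; grid points may coincide.\<close>
proof (cases "s = t")
  case True
  then show ?thesis by (simp add: has_bochner_integral_zero)
next
  case False
  with st have st': "0 \<le> s" "s < t" "t \<le> T" by auto
  interpret G: isotropic_gaussian M "\<lambda>w. B t w - B s w" "sqrt (t - s)"
    by (rule gaussian_increment[OF st'])
  have "has_bochner_integral M (\<lambda>w. (Y w * (\<eta> w $ j)) * ((B t w - B s w) $ j)) 0" for j
  proof -
    have mY: "(\<lambda>w. Y w * (\<eta> w $ j)) \<in> borel_measurable (F s)"
      using Y(1) measurable_compose[OF e(1) borel_measurable_nth, of j] by measurable
    have "integrable M (\<lambda>w. Y w * (\<eta> w $ j))"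
    proof (rule Bochner_Integration.integrable_bound[of _ "\<lambda>w. C * Y w"])
      show "AE w in M. norm (Y w * (\<eta> w $ j)) \<le> norm (C * Y w)"
      proof (rule AE_I2)
        fix w assume "w \<in> space M"
        have "\<bar>\<eta> w $ j\<bar> \<le> norm (\<eta> w)" by (rule component_le_norm_cart)
        also have "\<dots> \<le> \<bar>C\<bar>" using e(2)[OF \<open>w \<in> space M\<close>] by simp
        finally show "norm (Y w * (\<eta> w $ j)) \<le> norm (C * Y w)"
          by (simp add: abs_mult) (metis abs_ge_zero mult.commute mult_left_mono)
      qed
    qed (use Y measurable_F_M[OF mY] st in auto)
    note i = this G.integrable_component[of j]
    have ind: "indep_var borel (\<lambda>w. Y w * (\<eta> w $ j)) borel (\<lambda>w. (B t w - B s w) $ j)"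
      using indep_increment_compose[OF st' mY, of "\<lambda>x. x $ j"] by simp
    show ?thesis
      using indep_var_integrable[OF ind i] indep_var_lebesgue_integral[OF ind i] G.expectation_component[of j]
      by (simp add: has_bochner_integral_iff)
  qed
  then have "has_bochner_integral M (\<lambda>w. \<Sum>j\<in>UNIV. (Y w * (\<eta> w $ j)) * ((B t w - B s w) $ j)) (\<Sum>j\<in>(UNIV::'d set). 0)"
    by (intro has_bochner_integral_sum) auto
  then show ?thesis
    by (simp add: inner_vec_def sum_distrib_left mult.assoc)
qed

section \<open>Covariances of increments and the isometry for step integrands\<close>

lemma integrable_bounded_component_mult:
  fixes \<xi> \<eta> :: "'a \<Rightarrow> real ^ 'd"
  assumes "\<xi> \<in> borel_measurable M" "\<And>w. w \<in> space M \<Longrightarrow> norm (\<xi> w) \<le> C"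
    and "\<eta> \<in> borel_measurable M" "\<And>w. w \<in> space M \<Longrightarrow> norm (\<eta> w) \<le> D"
  shows "integrable M (\<lambda>w. \<xi> w $ i * (\<eta> w $ j))"
proof (rule integrable_const_bound[where B="C * D"])
  show "AE w in M. norm (\<xi> w $ i * (\<eta> w $ j)) \<le> C * D"
  proof (rule AE_I2)
    fix w assume w: "w \<in> space M"
    have "\<bar>\<xi> w $ i\<bar> \<le> C" "\<bar>\<eta> w $ j\<bar> \<le> D"
      using assms(2,4)[OF w] component_le_norm_cart[of "\<xi> w" i] component_le_norm_cart[of "\<eta> w" j] by auto
    then show "norm (\<xi> w $ i * (\<eta> w $ j)) \<le> C * D"
      by (auto simp: abs_mult intro!: mult_mono intro: order_trans[of 0 "\<bar>\<xi> w $ i\<bar>"])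
  qed
  show "(\<lambda>w. \<xi> w $ i * (\<eta> w $ j)) \<in> borel_measurable M"
    using measurable_compose[OF assms(1) borel_measurable_nth, of i]
      measurable_compose[OF assms(3) borel_measurable_nth, of j] by measurable
qed

text \<open>In coordinates, a product of two components of the increment is independent of its
  coefficient, with mean \<open>t - s\<close> on the diagonal and 0 off it. The diagonal terms
  reassemble the inner product.\<close>

lemma has_bochner_integral_increment_square:
  assumes st: "0 \<le> s" "s \<le> t" "t \<le> T"
    and x: "\<xi> \<in> borel_measurable (F s)" "\<And>w. w \<in> space M \<Longrightarrow> norm (\<xi> w) \<le> C"
    and e: "\<eta> \<in> borel_measurable (F s)" "\<And>w. w \<in> space M \<Longrightarrow> norm (\<eta> w) \<le> D"
  shows "has_bochner_integral M (\<lambda>w. (\<xi> w \<bullet> (B t w - B s w)) * (\<eta> w \<bullet> (B t w - B s w)))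
     ((t - s) * expectation (\<lambda>w. \<xi> w \<bullet> \<eta> w))"
proof (cases "s = t")
  case True
  then show ?thesis by (simp add: has_bochner_integral_zero)
next
  case False
  with st have st': "0 \<le> s" "s < t" "t \<le> T" by auto
  interpret G: isotropic_gaussian M "\<lambda>w. B t w - B s w" "sqrt (t - s)"
    by (rule gaussian_increment[OF st'])
  have mx: "\<xi> \<in> borel_measurable M" "\<eta> \<in> borel_measurable M"
    using measurable_F_M[OF x(1)] measurable_F_M[OF e(1)] st by auto
  note i = integrable_bounded_component_mult[OF mx(1) x(2) mx(2) e(2)]
  have *: "has_bochner_integral M (\<lambda>w. (\<xi> w $ i * (\<eta> w $ j)) * ((B t w - B s w) $ i * ((B t w - B s w) $ j)))
     (expectation (\<lambda>w. \<xi> w $ i * (\<eta> w $ j)) * (if i = j then t - s else 0))" for i j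
  proof -
    have mY: "(\<lambda>w. \<xi> w $ i * (\<eta> w $ j)) \<in> borel_measurable (F s)"
      using measurable_compose[OF x(1) borel_measurable_nth, of i] measurable_compose[OF e(1) borel_measurable_nth, of j] by measurable
    have ind: "indep_var borel (\<lambda>w. \<xi> w $ i * (\<eta> w $ j)) borel (\<lambda>w. (B t w - B s w) $ i * ((B t w - B s w) $ j))"
      using indep_increment_compose[OF st' mY, of "\<lambda>x. x $ i * (x $ j)"] by simp
    show ?thesis
      unfolding has_bochner_integral_iff
      using indep_var_integrable[OF ind i G.integrable_component_mult]
        indep_var_lebesgue_integral[OF ind i G.integrable_component_mult] G.expectation_component_mult[of i j] st
      by simp
  qed
  have "has_bochner_integral M (\<lambda>w. \<Sum>i\<in>UNIV. \<Sum>j\<in>UNIV. (\<xi> w $ i * (\<eta> w $ j)) * ((B t w - B s w) $ i * ((B t w - B s w) $ j)))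
     (\<Sum>i\<in>UNIV. \<Sum>j\<in>UNIV. expectation (\<lambda>w. \<xi> w $ i * (\<eta> w $ j)) * (if i = j then t - s else 0))"
    by (intro has_bochner_integral_sum *)
  moreover have "(\<Sum>i\<in>UNIV. \<Sum>j\<in>UNIV. expectation (\<lambda>w. \<xi> w $ i * (\<eta> w $ j)) * (if i = j then t - s else 0))
      = (t - s) * expectation (\<lambda>w. \<xi> w \<bullet> \<eta> w)"
  proof -
    have "expectation (\<lambda>w. \<xi> w \<bullet> \<eta> w) = (\<Sum>i\<in>UNIV. expectation (\<lambda>w. \<xi> w $ i * (\<eta> w $ i)))"
      unfolding inner_vec_def using i by (subst Bochner_Integration.integral_sum) auto
    moreover have "(\<Sum>j\<in>UNIV. expectation (\<lambda>w. \<xi> w $ i * (\<eta> w $ j)) * (if i = j then t - s else 0))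
        = (t - s) * expectation (\<lambda>w. \<xi> w $ i * (\<eta> w $ i))" for i
      by (simp add: if_distrib[of "\<lambda>x. _ * x"] cong: if_cong)
    ultimately show ?thesis by (simp add: sum_distrib_left)
  qed
  moreover have "(\<Sum>i\<in>UNIV. \<Sum>j\<in>UNIV. (\<xi> w $ i * (\<eta> w $ j)) * ((B t w - B s w) $ i * ((B t w - B s w) $ j)))
      = (\<xi> w \<bullet> (B t w - B s w)) * (\<eta> w \<bullet> (B t w - B s w))" for w
    unfolding inner_vec_def sum_product inner_real_def by (intro sum.cong refl) (simp only: ac_simps)
  ultimately show ?thesis by simp
qed

lemma borel_measurable_inner_increment:
  assumes "0 \<le> s" "s \<le> t" "t \<le> u" "u \<le> T" and "\<xi> \<in> borel_measurable (F s)"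
  shows "(\<lambda>w. \<xi> w \<bullet> (B t w - B s w)) \<in> borel_measurable (F u)"
  using measurable_F_mono[OF assms(5), of u] measurable_F_mono[OF measurable_B_F, of t u]
    measurable_F_mono[OF measurable_B_F, of s u] assms(1-4)
  by (intro borel_measurable_inner borel_measurable_diff) auto

text \<open>The first factor is known at time \<open>c\<close> and integrable, so it can play the
  part of \<open>Y\<close> in the martingale property. Its integrability comes from that same
  property with \<open>Y\<close> equal to 1.\<close>

lemma has_bochner_integral_disjoint_increments:
  assumes t: "0 \<le> a" "a \<le> b" "b \<le> c" "c \<le> d" "d \<le> T"
    and x: "\<xi> \<in> borel_measurable (F a)" "\<And>w. w \<in> space M \<Longrightarrow> norm (\<xi> w) \<le> C"
    and e: "\<eta> \<in> borel_measurable (F c)" "\<And>w. w \<in> space M \<Longrightarrow> norm (\<eta> w) \<le> D"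
  shows "has_bochner_integral M (\<lambda>w. (\<xi> w \<bullet> (B b w - B a w)) * (\<eta> w \<bullet> (B d w - B c w))) 0"
proof (rule has_bochner_integral_increment_0[OF _ _ _ _ _ e])
  show "integrable M (\<lambda>w. \<xi> w \<bullet> (B b w - B a w))"
  proof -
    have "has_bochner_integral M (\<lambda>w. 1 * (\<xi> w \<bullet> (B b w - B a w))) 0"
      by (rule has_bochner_integral_increment_0[OF _ _ _ _ _ x]) (use t in auto)
    then show ?thesis unfolding mult_1 by (rule integrable.intros)
  qed
qed (use t x in \<open>auto intro!: borel_measurable_inner_increment\<close>)

text \<open>The longer increment is split where the shorter one ends: the common part contributes
  the variance, the remainder is orthogonal.\<close>

lemma has_bochner_integral_same_start:
  assumes t: "0 \<le> c" "c \<le> b" "c \<le> d" "b \<le> T" "d \<le> T"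
    and x: "\<xi> \<in> borel_measurable (F c)" "\<And>w. w \<in> space M \<Longrightarrow> norm (\<xi> w) \<le> C"
    and e: "\<eta> \<in> borel_measurable (F c)" "\<And>w. w \<in> space M \<Longrightarrow> norm (\<eta> w) \<le> D"
  shows "has_bochner_integral M (\<lambda>w. (\<xi> w \<bullet> (B b w - B c w)) * (\<eta> w \<bullet> (B d w - B c w)))
    ((min b d - c) * expectation (\<lambda>w. \<xi> w \<bullet> \<eta> w))"
proof -
  have m: "\<zeta> \<in> borel_measurable (F u)" if "\<zeta> \<in> borel_measurable (F c)" "c \<le> u" "u \<le> T" for u and \<zeta> :: "'a \<Rightarrow> real^'d"
    using measurable_F_mono[OF that(1)] t that by auto
  show ?thesis
  proof (cases "b \<le> d")
    case True
    have "has_bochner_integral M (\<lambda>w. (\<xi> w \<bullet> (B b w - B c w)) * (\<eta> w \<bullet> (B b w - B c w))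
        + (\<xi> w \<bullet> (B b w - B c w)) * (\<eta> w \<bullet> (B d w - B b w)))
      ((b - c) * expectation (\<lambda>w. \<xi> w \<bullet> \<eta> w) + 0)"
      using t True m[OF e(1), of b]
      by (intro has_bochner_integral_add has_bochner_integral_increment_square[OF _ _ _ x e]
          has_bochner_integral_disjoint_increments[OF _ _ _ _ _ x _ e(2)]) auto
    then show ?thesis using True
      by (simp add: algebra_simps)
  next
    case False
    have "has_bochner_integral M (\<lambda>w. (\<xi> w \<bullet> (B d w - B c w)) * (\<eta> w \<bullet> (B d w - B c w))
        + (\<eta> w \<bullet> (B d w - B c w)) * (\<xi> w \<bullet> (B b w - B d w)))
      ((d - c) * expectation (\<lambda>w. \<xi> w \<bullet> \<eta> w) + 0)"
      using t False m[OF x(1), of d]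
      by (intro has_bochner_integral_add has_bochner_integral_increment_square[OF _ _ _ x e]
          has_bochner_integral_disjoint_increments[OF _ _ _ _ _ e _ x(2)]) auto
    then show ?thesis using False
      by (simp add: algebra_simps)
  qed
qed

text \<open>The increment that starts first is split at \<open>c\<close>. Its part before
  \<open>c\<close> is orthogonal to the other increment, and the rest starts at \<open>c\<close> as
  well.\<close>

lemma has_bochner_integral_increments_ordered:
  assumes t: "0 \<le> a" "a \<le> b" "c \<le> d" "b \<le> T" "d \<le> T" "a \<le> c"
    and x: "\<xi> \<in> borel_measurable (F a)" "\<And>w. w \<in> space M \<Longrightarrow> norm (\<xi> w) \<le> C"
    and e: "\<eta> \<in> borel_measurable (F c)" "\<And>w. w \<in> space M \<Longrightarrow> norm (\<eta> w) \<le> D"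
  shows "has_bochner_integral M (\<lambda>w. (\<xi> w \<bullet> (B b w - B a w)) * (\<eta> w \<bullet> (B d w - B c w)))
    (measure lborel ({a<..b} \<inter> {c<..d}) * expectation (\<lambda>w. \<xi> w \<bullet> \<eta> w))"
proof (cases "b \<le> c")
  case True
  then show ?thesis
    using has_bochner_integral_disjoint_increments[OF _ _ _ _ _ x e] t by simp
next
  case False
  have "has_bochner_integral M (\<lambda>w. (\<xi> w \<bullet> (B c w - B a w)) * (\<eta> w \<bullet> (B d w - B c w))
      + (\<xi> w \<bullet> (B b w - B c w)) * (\<eta> w \<bullet> (B d w - B c w)))
    (0 + (min b d - c) * expectation (\<lambda>w. \<xi> w \<bullet> \<eta> w))"
    using t False measurable_F_mono[OF x(1), of c]
    by (intro has_bochner_integral_add has_bochner_integral_same_start[OF _ _ _ _ _ _ x(2) e]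
        has_bochner_integral_disjoint_increments[OF _ _ _ _ _ x e]) auto
  note sum = this
  have "{a<..b} \<inter> {c<..d} = {c<..min b d}" using t by auto
  moreover have "measure lborel {c<..min b d} = min b d - c" using t False by simp
  ultimately have m: "measure lborel ({a<..b} \<inter> {c<..d}) = min b d - c" by (simp only:)
  show ?thesis
    unfolding m using sum by (simp add: algebra_simps)
qed

lemma has_bochner_integral_increments:
  assumes t: "0 \<le> a" "a \<le> b" "0 \<le> c" "c \<le> d" "b \<le> T" "d \<le> T"
    and x: "\<xi> \<in> borel_measurable (F a)" "\<And>w. w \<in> space M \<Longrightarrow> norm (\<xi> w) \<le> C"
    and e: "\<eta> \<in> borel_measurable (F c)" "\<And>w. w \<in> space M \<Longrightarrow> norm (\<eta> w) \<le> D"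
  shows "has_bochner_integral M (\<lambda>w. (\<xi> w \<bullet> (B b w - B a w)) * (\<eta> w \<bullet> (B d w - B c w)))
    (measure lborel ({a<..b} \<inter> {c<..d}) * expectation (\<lambda>w. \<xi> w \<bullet> \<eta> w))"
proof (cases "a \<le> c")
  case True
  then show ?thesis using has_bochner_integral_increments_ordered[OF _ _ _ _ _ _ x e] t by simp
next
  case False
  then show ?thesis using has_bochner_integral_increments_ordered[OF _ _ _ _ _ _ e x, of d b] t
    by (simp add: mult.commute Int_commute inner_commute)
qed

definition elementary :: "'j set \<Rightarrow> ('j \<Rightarrow> real) \<Rightarrow> ('j \<Rightarrow> real) \<Rightarrow> ('j \<Rightarrow> 'a \<Rightarrow> real ^ 'd) \<Rightarrow> bool" where
  "elementary J lo hi \<xi> \<longleftrightarrow> finite J \<and>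
     (\<forall>j\<in>J. 0 \<le> lo j \<and> lo j \<le> hi j \<and> hi j \<le> T \<and> \<xi> j \<in> borel_measurable (F (lo j))) \<and>
     (\<exists>C. \<forall>j\<in>J. \<forall>w\<in>space M. norm (\<xi> j w) \<le> C)"

lemma has_bochner_integral_norm_step_square:
  fixes v :: "'j \<Rightarrow> real ^ 'd" and lo hi :: "'j \<Rightarrow> real"
  assumes "finite J"
  shows "has_bochner_integral lborel (\<lambda>s. (norm (\<Sum>j\<in>J. indicator {lo j<..hi j} s *\<^sub>R v j))\<^sup>2)
    (\<Sum>i\<in>J. \<Sum>j\<in>J. measure lborel ({lo i<..hi i} \<inter> {lo j<..hi j}) * (v i \<bullet> v j))"
proof -
  have "has_bochner_integral lborel (\<lambda>s. \<Sum>i\<in>J. \<Sum>j\<in>J. indicator ({lo i<..hi i} \<inter> {lo j<..hi j}) s * (v i \<bullet> v j))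
    (\<Sum>i\<in>J. \<Sum>j\<in>J. measure lborel ({lo i<..hi i} \<inter> {lo j<..hi j}) * (v i \<bullet> v j))"
  proof (intro has_bochner_integral_sum has_bochner_integral_mult_left)
    fix i j
    show "has_bochner_integral lborel (indicator ({lo i<..hi i} \<inter> {lo j<..hi j})) (measure lborel ({lo i<..hi i} \<inter> {lo j<..hi j}))"
    proof (rule has_bochner_integral_real_indicator)
      have "emeasure lborel ({lo i<..hi i} \<inter> {lo j<..hi j}) \<le> emeasure lborel {lo i<..hi i}"
        by (intro emeasure_mono) auto
      also have "\<dots> < \<infinity>" by (cases "lo i \<le> hi i") auto
      finally show "emeasure lborel ({lo i<..hi i} \<inter> {lo j<..hi j}) < \<infinity>" .
    qed auto
  qed
  moreover have "(\<Sum>i\<in>J. \<Sum>j\<in>J. indicator ({lo i<..hi i} \<inter> {lo j<..hi j}) s * (v i \<bullet> v j))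
      = (norm (\<Sum>j\<in>J. indicator {lo j<..hi j} s *\<^sub>R v j))\<^sup>2" for s
    unfolding power2_norm_eq_inner inner_sum_left inner_sum_right
    by (subst sum.swap, intro sum.cong refl)
      (simp only: indicator_inter_arith inner_scaleR_left inner_scaleR_right inner_commute mult.assoc mult.left_commute)
  ultimately show ?thesis by simp
qed

text \<open>Both sides expand to the double sum \<open>?E\<close>, weighted by the lengths of the
  intersections: on the left through covariances of increments, on the right through products of
  indicators. The intervals may overlap, so differences of step integrals on unrelated grids are
  covered without a common refinement.\<close>

theorem elementary_isometry:
  assumes el: "elementary J lo hi \<xi>"
  shows "mean_square M (\<lambda>w. \<Sum>j\<in>J. \<xi> j w \<bullet> (B (hi j) w - B (lo j) w))
    = (\<integral>\<^sup>+w. sq_norm (\<lambda>s. \<Sum>j\<in>J. indicator {lo j<..hi j} s *\<^sub>R \<xi> j w) \<partial>M)"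
proof -
  let ?m = "\<lambda>i j. measure lborel ({lo i<..hi i} \<inter> {lo j<..hi j})"
  let ?E = "\<Sum>i\<in>J. \<Sum>j\<in>J. ?m i j * expectation (\<lambda>w. \<xi> i w \<bullet> \<xi> j w)"
  let ?S = "\<lambda>w. \<Sum>j\<in>J. \<xi> j w \<bullet> (B (hi j) w - B (lo j) w)"
  let ?R = "\<lambda>w. \<Sum>i\<in>J. \<Sum>j\<in>J. ?m i j * (\<xi> i w \<bullet> \<xi> j w)"
  obtain C where fin: "finite J"
    and t: "\<And>j. j \<in> J \<Longrightarrow> 0 \<le> lo j \<and> lo j \<le> hi j \<and> hi j \<le> T"
    and m: "\<And>j. j \<in> J \<Longrightarrow> \<xi> j \<in> borel_measurable (F (lo j))"
    and C: "\<And>j w. j \<in> J \<Longrightarrow> w \<in> space M \<Longrightarrow> norm (\<xi> j w) \<le> C"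
    using el unfolding elementary_def by blast
  have mM: "\<xi> j \<in> borel_measurable M" if "j \<in> J" for j
    using measurable_F_M[OF m[OF that]] t[OF that] by auto
  have "has_bochner_integral M (\<lambda>w. \<Sum>i\<in>J. \<Sum>j\<in>J. (\<xi> i w \<bullet> (B (hi i) w - B (lo i) w)) * (\<xi> j w \<bullet> (B (hi j) w - B (lo j) w))) ?E"
    using t by (intro has_bochner_integral_sum has_bochner_integral_increments[OF _ _ _ _ _ _ m C m C]) auto
  then have S: "has_bochner_integral M (\<lambda>w. (?S w)\<^sup>2) ?E"
    by (simp add: power2_eq_square sum_product)
  have int: "integrable M (\<lambda>w. \<xi> i w \<bullet> \<xi> j w)" if "i \<in> J" "j \<in> J" for i j
    unfolding inner_vec_def inner_real_def
    by (rule Bochner_Integration.integrable_sum)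
      (rule integrable_bounded_component_mult[OF mM[OF that(1)] C[OF that(1)] mM[OF that(2)] C[OF that(2)]])
  have R: "has_bochner_integral M ?R ?E"
    using int by (intro has_bochner_integral_sum has_bochner_integral_mult_right) (auto simp: has_bochner_integral_iff)
  \<comment> \<open>The sign of the double sum is not visible from its terms; it is the integral of
    a squared norm.\<close>
  have nn: "?R w \<ge> 0" for w
  proof -
    have "0 \<le> (\<integral>s. (norm (\<Sum>j\<in>J. indicator {lo j<..hi j} s *\<^sub>R \<xi> j w))\<^sup>2 \<partial>lborel)"
      by (rule integral_nonneg_AE) simp
    then show ?thesis
      unfolding has_bochner_integral_integral_eq[OF has_bochner_integral_norm_step_square[OF fin]] .
  qed
  have path: "sq_norm (\<lambda>s. \<Sum>j\<in>J. indicator {lo j<..hi j} s *\<^sub>R \<xi> j w) = ennreal (?R w)" for w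
    using nn_integral_eq_integral[of lborel "\<lambda>s. (norm (\<Sum>j\<in>J. indicator {lo j<..hi j} s *\<^sub>R \<xi> j w))\<^sup>2"]
      has_bochner_integral_norm_step_square[OF fin, of lo hi "\<lambda>j. \<xi> j w"]
    by (simp add: has_bochner_integral_iff)
  have "mean_square M ?S = ennreal ?E"
    using nn_integral_eq_integral[of M "\<lambda>w. (?S w)\<^sup>2"] S by (simp add: has_bochner_integral_iff)
  also have "\<dots> = (\<integral>\<^sup>+w. ennreal (?R w) \<partial>M)"
    using nn_integral_eq_integral[of M ?R] R nn by (simp add: has_bochner_integral_iff)
  finally show ?thesis by (simp add: path)
qed

section \<open>Stochastic exponentials of step integrands\<close>

abbreviation exp_density :: "nat \<Rightarrow> (nat \<Rightarrow> real) \<Rightarrow> (nat \<Rightarrow> 'a \<Rightarrow> real ^ 'd) \<Rightarrow> 'a \<Rightarrow> real" where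
  "exp_density n \<tau> \<xi> w \<equiv> exp (\<Sum>i<n. \<xi> i w \<bullet> (B (\<tau> (Suc i)) w - B (\<tau> i) w)
     - 1/2 * ((norm (\<xi> i w))\<^sup>2 * (\<tau> (Suc i) - \<tau> i)))"

lemma simple_grid:
  assumes "simple_integrand M F T n \<tau> \<xi>" "i \<le> j" "j \<le> n"
  shows "0 \<le> \<tau> i" "\<tau> i \<le> \<tau> j" "\<tau> j \<le> T"
proof -
  have mono: "\<tau> i \<le> \<tau> j" if "i \<le> j" "j \<le> n" for i j
    using that
  proof (induction rule: dec_induct)
    case (step k)
    then show ?case using assms(1) by (auto simp: simple_integrand_def intro: order_trans)
  qed simp
  show "\<tau> i \<le> \<tau> j" using mono assms by auto
  show "0 \<le> \<tau> i" using mono[of 0 i] assms by (auto simp: simple_integrand_def)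
  show "\<tau> j \<le> T" using mono[of j n] assms by (auto simp: simple_integrand_def)
qed

text \<open>Induction on the number of steps. With the past frozen, the gaussian exponential moment
  of the last increment is exactly what the quadratic term cancels, so the last factor integrates to
  1. Measurability at \<open>\<tau> m\<close> is carried through the induction because freezing
  requires it.\<close>

lemma expectation_exp_density:
  assumes si: "simple_integrand M F T n \<tau> \<xi>"
  shows "(\<integral>\<^sup>+w. ennreal (exp_density n \<tau> \<xi> w) \<partial>M) = 1"
proof -
  have "exp_density m \<tau> \<xi> \<in> borel_measurable (F (\<tau> m)) \<and> (\<integral>\<^sup>+w. ennreal (exp_density m \<tau> \<xi> w) \<partial>M) = 1" if "m \<le> n" for m
    using that
  proof (induction m)
    case 0
    then show ?case by (simp add: emeasure_space_1)
  next
    case (Suc m)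
    let ?s = "\<tau> m" and ?t = "\<tau> (Suc m)"
    let ?Z = "exp_density m \<tau> \<xi>"
    let ?g = "\<lambda>(w, x). ennreal (?Z w * exp (\<xi> m w \<bullet> x - 1/2 * ((norm (\<xi> m w))\<^sup>2 * (?t - ?s))))"
    have t: "0 \<le> ?s" "?s \<le> ?t" "?t \<le> T"
      using simple_grid[OF si, of m "Suc m"] Suc.prems by auto
    have Z: "?Z \<in> borel_measurable (F ?s)" and IH: "(\<integral>\<^sup>+w. ennreal (?Z w) \<partial>M) = 1"
      using Suc by auto
    have x: "\<xi> m \<in> borel_measurable (F ?s)"
      using si Suc.prems by (simp add: simple_integrand_def)
    have split: "exp_density (Suc m) \<tau> \<xi> w = ?Z w * exp (\<xi> m w \<bullet> (B ?t w - B ?s w) - 1/2 * ((norm (\<xi> m w))\<^sup>2 * (?t - ?s)))" for w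
      by (simp add: exp_add)
    have meas: "exp_density (Suc m) \<tau> \<xi> \<in> borel_measurable (F ?t)"
    proof -
      have [measurable]: "?Z \<in> borel_measurable (F ?t)" "\<xi> m \<in> borel_measurable (F ?t)"
        "B ?t \<in> borel_measurable (F ?t)" "B ?s \<in> borel_measurable (F ?t)"
        using measurable_F_mono[OF Z] measurable_F_mono[OF x] measurable_B_F[of ?t]
          measurable_F_mono[OF measurable_B_F[of ?s], of ?t] t by auto
      show ?thesis unfolding split by measurable
    qed
    have "(\<integral>\<^sup>+w. ennreal (exp_density (Suc m) \<tau> \<xi> w) \<partial>M) = 1"
    proof (cases "?s = ?t")
      case True
      then show ?thesis unfolding split using IH by simp
    next
      case False
      then have st: "0 \<le> ?s" "?s < ?t" "?t \<le> T" using t by auto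
      interpret G: isotropic_gaussian M "\<lambda>w. B ?t w - B ?s w" "sqrt (?t - ?s)"
        by (rule gaussian_increment[OF st])
      have [measurable]: "?Z \<in> borel_measurable (F ?s)" "\<xi> m \<in> borel_measurable (F ?s)" by fact+
      have g: "?g \<in> borel_measurable (F ?s \<Otimes>\<^sub>M borel)" by measurable
      have inner: "(\<integral>\<^sup>+w'. ?g (w, B ?t w' - B ?s w') \<partial>M) = ennreal (?Z w)" for w
      proof -
        let ?c = "?Z w * exp (- (1/2 * ((norm (\<xi> m w))\<^sup>2 * (?t - ?s))))"
        have "exp (x - c) = exp (- c) * exp x" for x c :: real
          by (simp add: exp_add[symmetric])
        then have "(\<integral>\<^sup>+w'. ?g (w, B ?t w' - B ?s w') \<partial>M)
            = (\<integral>\<^sup>+w'. ennreal ?c * ennreal (exp (\<xi> m w \<bullet> (B ?t w' - B ?s w'))) \<partial>M)"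
          by (intro nn_integral_cong) (simp only: prod.case ennreal_mult[symmetric] exp_ge_zero mult_nonneg_nonneg mult.assoc)
        also have "\<dots> = ennreal ?c * (\<integral>\<^sup>+w'. ennreal (exp (\<xi> m w \<bullet> (B ?t w' - B ?s w'))) \<partial>M)"
          by (rule nn_integral_cmult) (use G.measurable_X in measurable)
        also have "\<dots> = ennreal (?Z w)"
          unfolding G.nn_integral_exp using st
          by (simp add: ennreal_mult[symmetric] mult.assoc exp_add[symmetric] mult.commute)
        finally show ?thesis .
      qed
      have "(\<integral>\<^sup>+w. ennreal (exp_density (Suc m) \<tau> \<xi> w) \<partial>M) = (\<integral>\<^sup>+w. ?g (w, B ?t w - B ?s w) \<partial>M)"
        unfolding split by simp
      also have "\<dots> = (\<integral>\<^sup>+w. \<integral>\<^sup>+w'. ?g (w, B ?t w' - B ?s w') \<partial>M \<partial>M)"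
        by (rule nn_integral_freeze[OF st g])
      finally show ?thesis unfolding inner IH .
    qed
    with meas show ?case by blast
  qed
  then show ?thesis by blast
qed

end

section \<open>Averaging over the preceding grid cell\<close>

lemma power2_norm_diff_le: "(norm (x - y))\<^sup>2 \<le> 2 * (norm (x - z))\<^sup>2 + 2 * (norm (z - y))\<^sup>2"
  for x y z :: "'b::real_normed_vector"
proof -
  have "norm (x - y) \<le> norm (x - z) + norm (z - y)"
    using norm_triangle_ineq[of "x - z" "z - y"] by simp
  then have "(norm (x - y))\<^sup>2 \<le> (norm (x - z) + norm (z - y))\<^sup>2"
    by (intro power_mono) auto
  also have "\<dots> \<le> 2 * (norm (x - z))\<^sup>2 + 2 * (norm (z - y))\<^sup>2"
    using sum_squares_bound[of "norm (x - z)" "norm (z - y)"] by (simp add: power2_sum)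
  finally show ?thesis .
qed

lemma ennreal_power2_norm_diff_le:
  "ennreal ((norm (x - y))\<^sup>2) \<le> 2 * ennreal ((norm (x - z))\<^sup>2) + 2 * ennreal ((norm (z - y))\<^sup>2)"
  for x y z :: "'b::real_normed_vector"
proof -
  have "ennreal ((norm (x - y))\<^sup>2) \<le> ennreal (2 * (norm (x - z))\<^sup>2 + 2 * (norm (z - y))\<^sup>2)"
    by (intro ennreal_leI power2_norm_diff_le)
  also have "\<dots> = 2 * ennreal ((norm (x - z))\<^sup>2) + 2 * ennreal ((norm (z - y))\<^sup>2)"
    by (simp add: ennreal_mult)
  finally show ?thesis .
qed

lemma tendsto_0_ennrealI:
  fixes f :: "'i \<Rightarrow> ennreal"
  assumes "\<And>e::real. e > 0 \<Longrightarrow> eventually (\<lambda>n. f n < ennreal e) G"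
  shows "(f \<longlongrightarrow> 0) G"
proof (rule order_tendstoI)
  fix a :: ennreal assume "0 < a"
  then obtain b where b: "0 < b" "b < a" using dense by blast
  then have "b < top" by (metis less_top order_less_le_trans top_greatest not_le)
  then obtain e where "e > 0" "b = ennreal e" using b(1) by (cases b) (auto simp: ennreal_less_zero_iff)
  with assms[of e] b(2) show "eventually (\<lambda>n. f n < a) G"
    by (auto elim!: eventually_mono)
qed simp

section \<open>Square-integrable paths\<close>

definition L2fun :: "(real \<Rightarrow> 'b::euclidean_space) \<Rightarrow> bool" where
  "L2fun f \<longleftrightarrow> f \<in> borel_measurable borel \<and> sq_norm f < \<infinity>"

lemma L2fun_measurable [measurable_dest]: "L2fun f \<Longrightarrow> f \<in> borel_measurable borel"
  by (simp add: L2fun_def)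

lemma L2fun_bound:
  assumes "L2fun g" "f \<in> borel_measurable borel" "\<And>s. norm (f s) \<le> C * norm (g s)" "C \<ge> 0"
  shows "L2fun f"
proof -
  have "sq_norm f \<le> (\<integral>\<^sup>+s. ennreal (C\<^sup>2) * ennreal ((norm (g s))\<^sup>2) \<partial>lborel)"
    using power_mono[OF assms(3), where n=2] by (intro nn_integral_mono) (simp add: ennreal_mult[symmetric] power_mult_distrib)
  also have "\<dots> = ennreal (C\<^sup>2) * sq_norm g"
    using assms(1) by (intro nn_integral_cmult) (auto simp: L2fun_def)
  also have "\<dots> < \<infinity>" using assms(1) by (auto simp: L2fun_def ennreal_mult_less_top)
  finally show ?thesis using assms(2) by (simp add: L2fun_def)
qed

lemma L2fun_diff:
  assumes f: "L2fun f" and g: "L2fun g"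
  shows "L2fun (\<lambda>s. f s - g s)"
proof -
  note [measurable] = L2fun_measurable[OF f] L2fun_measurable[OF g]
  have "sq_norm (\<lambda>s. f s - g s)
      \<le> (\<integral>\<^sup>+s. 2 * ennreal ((norm (f s - 0))\<^sup>2) + 2 * ennreal ((norm (0 - g s))\<^sup>2) \<partial>lborel)"
    by (intro nn_integral_mono ennreal_power2_norm_diff_le)
  also have "\<dots> < \<infinity>"
    using f g by (subst nn_integral_add) (auto simp: nn_integral_cmult L2fun_def ennreal_mult_less_top)
  finally show ?thesis by (simp add: L2fun_def)
qed

lemma L2fun_zero: "L2fun (\<lambda>_. 0)"
  by (simp add: L2fun_def)

lemma L2fun_add: "L2fun f \<Longrightarrow> L2fun g \<Longrightarrow> L2fun (\<lambda>s. f s + g s)"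
  using L2fun_diff[of f "\<lambda>s. 0 - g s"] L2fun_diff[OF L2fun_zero, of g] by simp

lemma L2fun_const_interval: "L2fun (\<lambda>s. indicator {a..b::real} s *\<^sub>R v)" for v :: "'b::euclidean_space"
proof -
  have "sq_norm (\<lambda>s. indicator {a..b} s *\<^sub>R v) = (\<integral>\<^sup>+s. ennreal ((norm v)\<^sup>2) * indicator {a..b} s \<partial>lborel)"
    by (intro nn_integral_cong) (auto simp: indicator_def)
  also have "\<dots> < \<infinity>"
    using emeasure_bounded_finite[of "{a..b}"]
    by (subst nn_integral_cmult_indicator) (auto simp: ennreal_mult_less_top)
  finally show ?thesis by (simp add: L2fun_def)
qed

lemma L2fun_set_integrable:
  assumes f: "L2fun f"
  shows "set_integrable lborel {a<..b} f"
  unfolding set_integrable_def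
proof (rule integrableI_bounded)
  show "(\<lambda>x. indicator {a<..b} x *\<^sub>R f x) \<in> borel_measurable lborel"
    using L2fun_measurable[OF f] by simp
  \<comment> \<open>On a bounded interval this majorant is integrable, so square integrability
    implies integrability there.\<close>
  have *: "r \<le> 1 + r\<^sup>2" for r :: real
    using zero_le_power2[of "r - 1/2"] unfolding power2_diff by (simp add: power2_eq_square)
  have "(\<integral>\<^sup>+x. ennreal (norm (indicator {a<..b} x *\<^sub>R f x)) \<partial>lborel)
      \<le> (\<integral>\<^sup>+x. indicator {a<..b} x + ennreal ((norm (f x))\<^sup>2) \<partial>lborel)"
    using * by (intro nn_integral_mono) (auto simp: indicator_def ennreal_plus[symmetric] ennreal_1[symmetric] simp del: ennreal_plus ennreal_1)
  also have "\<dots> < \<infinity>"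
  proof -
    have "emeasure lborel {a<..b} < \<infinity>" by (cases "a \<le> b") auto
    then show ?thesis using f by (subst nn_integral_add) (auto simp: L2fun_def)
  qed
  finally show "(\<integral>\<^sup>+x. ennreal (norm (indicator {a<..b} x *\<^sub>R f x)) \<partial>lborel) < \<infinity>" .
qed

definition grid :: "real \<Rightarrow> nat \<Rightarrow> nat \<Rightarrow> real" where
  "grid T n i = real i * T / real n"

text \<open>Averaging over the \<^emph>\<open>preceding\<close> grid cell keeps the step process adapted. The functions are
  thought of as extended by zero outside \<open>[0,T]\<close>, so the average used on the first cell vanishes.\<close>

definition lagged_avg :: "real \<Rightarrow> nat \<Rightarrow> (real \<Rightarrow> 'b::euclidean_space) \<Rightarrow> nat \<Rightarrow> 'b" where
  "lagged_avg T n f i = (real n / T) *\<^sub>R (LBINT u:{(real i - 1) * T / real n<..real i * T / real n}. f u)"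

definition lagged_step :: "real \<Rightarrow> nat \<Rightarrow> (real \<Rightarrow> 'b::euclidean_space) \<Rightarrow> real \<Rightarrow> 'b" where
  "lagged_step T n f s = (\<Sum>i<n. indicator {real i * T / real n<..real (Suc i) * T / real n} s *\<^sub>R lagged_avg T n f i)"

lemma lagged_avg_add: "L2fun f \<Longrightarrow> L2fun g \<Longrightarrow> lagged_avg T n (\<lambda>s. f s + g s) i = lagged_avg T n f i + lagged_avg T n g i"
  unfolding lagged_avg_def by (simp add: set_integral_add L2fun_set_integrable scaleR_add_right)

lemma lagged_avg_diff: "L2fun f \<Longrightarrow> L2fun g \<Longrightarrow> lagged_avg T n (\<lambda>s. f s - g s) i = lagged_avg T n f i - lagged_avg T n g i"
  unfolding lagged_avg_def by (simp add: set_integral_diff L2fun_set_integrable scaleR_diff_right)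

lemma lagged_step_diff: "L2fun f \<Longrightarrow> L2fun g \<Longrightarrow> lagged_step T n (\<lambda>s. f s - g s) s = lagged_step T n f s - lagged_step T n g s"
  unfolding lagged_step_def by (simp add: lagged_avg_diff scaleR_diff_right sum_subtractf)

lemma lagged_step_measurable [measurable]: "lagged_step T n f \<in> borel_measurable borel"
  unfolding lagged_step_def[abs_def] by measurable

text \<open>Jensen's inequality on one cell, obtained by expanding the nonnegative integral of
  \<open>(norm (f s - ?m))\<^sup>2\<close> over that cell.\<close>

lemma lagged_avg_square_le:
  assumes f: "L2fun f" and "T > 0" "n > 0"
  shows "ennreal (T / real n * (norm (lagged_avg T n f i))\<^sup>2)
    \<le> (\<integral>\<^sup>+s. ennreal ((norm (f s))\<^sup>2) * indicator {(real i - 1) * T / real n<..real i * T / real n} s \<partial>lborel)"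
proof -
  let ?C = "{(real i - 1) * T / real n<..real i * T / real n}" and ?m = "lagged_avg T n f i" and ?h = "T / real n"
  note [measurable] = L2fun_measurable[OF f]
  have h: "?h > 0" using assms by simp
  have mC: "measure lborel ?C = ?h"
    using assms by (subst measure_lborel_Ioc) (auto simp: field_simps)
  have intf: "integrable lborel (\<lambda>s. indicator ?C s *\<^sub>R f s)"
    using L2fun_set_integrable[OF f] unfolding set_integrable_def by blast
  have int1: "integrable lborel (indicator ?C :: real \<Rightarrow> real)"
    by (rule integrable_real_indicator) (use assms in \<open>auto simp: field_simps\<close>)
  have int2: "integrable lborel (\<lambda>s. indicator ?C s * (norm (f s))\<^sup>2)"
  proof (rule integrableI_bounded)
    have "(\<integral>\<^sup>+s. ennreal (norm (indicator ?C s * (norm (f s))\<^sup>2)) \<partial>lborel) \<le> sq_norm f"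
      by (intro nn_integral_mono) (auto simp: indicator_def)
    then show "(\<integral>\<^sup>+s. ennreal (norm (indicator ?C s * (norm (f s))\<^sup>2)) \<partial>lborel) < \<infinity>"
      using f unfolding L2fun_def by (meson order_le_less_trans)
  qed measurable
  have I: "(\<integral>s. indicator ?C s *\<^sub>R f s \<partial>lborel) = ?h *\<^sub>R ?m"
    using assms by (simp add: lagged_avg_def set_lebesgue_integral_def)
  have "0 \<le> (\<integral>s. indicator ?C s * (norm (f s - ?m))\<^sup>2 \<partial>lborel)"
    by (rule integral_nonneg_AE) simp
  also have "\<dots> = (\<integral>s. indicator ?C s * (norm (f s))\<^sup>2 - 2 * ((indicator ?C s *\<^sub>R f s) \<bullet> ?m) + (norm ?m)\<^sup>2 * indicator ?C s \<partial>lborel)"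
    by (intro Bochner_Integration.integral_cong refl)
      (simp add: power2_norm_eq_inner inner_diff_left inner_diff_right inner_commute algebra_simps)
  also have "\<dots> = (\<integral>s. indicator ?C s * (norm (f s))\<^sup>2 \<partial>lborel) - 2 * ((?h *\<^sub>R ?m) \<bullet> ?m) + (norm ?m)\<^sup>2 * ?h"
  proof (rule has_bochner_integral_integral_eq, intro has_bochner_integral_add has_bochner_integral_diff has_bochner_integral_mult_right has_bochner_integral_inner_left)
    show "has_bochner_integral lborel (\<lambda>s. indicator ?C s *\<^sub>R f s) (?h *\<^sub>R ?m)"
      using intf I by (simp add: has_bochner_integral_iff)
    show "has_bochner_integral lborel (indicator ?C) ?h"
      using int1 mC by (simp add: has_bochner_integral_iff)
    show "has_bochner_integral lborel (\<lambda>s. indicator ?C s * (norm (f s))\<^sup>2) (\<integral>s. indicator ?C s * (norm (f s))\<^sup>2 \<partial>lborel)"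
      using int2 by (simp add: has_bochner_integral_iff)
  qed
  also have "\<dots> = (\<integral>s. indicator ?C s * (norm (f s))\<^sup>2 \<partial>lborel) - ?h * (norm ?m)\<^sup>2"
    by (simp add: power2_norm_eq_inner algebra_simps)
  finally have "?h * (norm ?m)\<^sup>2 \<le> (\<integral>s. indicator ?C s * (norm (f s))\<^sup>2 \<partial>lborel)" by simp
  then have "ennreal (?h * (norm ?m)\<^sup>2) \<le> ennreal (\<integral>s. indicator ?C s * (norm (f s))\<^sup>2 \<partial>lborel)"
    by (rule ennreal_leI)
  also have "\<dots> = (\<integral>\<^sup>+s. ennreal (indicator ?C s * (norm (f s))\<^sup>2) \<partial>lborel)"
    by (rule nn_integral_eq_integral[symmetric, OF int2]) simp
  also have "\<dots> = (\<integral>\<^sup>+s. ennreal ((norm (f s))\<^sup>2) * indicator ?C s \<partial>lborel)"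
    by (intro nn_integral_cong) (auto simp: indicator_def)
  finally show ?thesis .
qed

text \<open>The shift \<open>c\<close> serves both partitions: 0 for the cells that carry the step
  values, -1 for the cells averaged over.\<close>

lemma disjoint_grid_cells:
  assumes "T > 0" "n > (0::nat)"
  shows "s \<in> {(c + real i) * T / real n<..(c + real i + 1) * T / real n} \<Longrightarrow>
    s \<in> {(c + real j) * T / real n<..(c + real j + 1) * T / real n} \<Longrightarrow> i = j"
proof -
  assume a: "s \<in> {(c + real i) * T / real n<..(c + real i + 1) * T / real n}"
    "s \<in> {(c + real j) * T / real n<..(c + real j + 1) * T / real n}"
  have "real i < real j + 1"
  proof -
    have "(c + real i) * T / real n < (c + real j + 1) * T / real n" using a by auto
    then show ?thesis using assms by (simp add: divide_less_cancel)
  qed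
  moreover have "real j < real i + 1"
  proof -
    have "(c + real j) * T / real n < (c + real i + 1) * T / real n" using a by auto
    then show ?thesis using assms by (simp add: divide_less_cancel)
  qed
  ultimately show "i = j" by linarith
qed

text \<open>At most one indicator is active, so both sums collapse to the same index. As an
  elimination rule, a single case split evaluates a step function together with a companion sum such
  as that of its squared norms.\<close>

lemma sum_indicator_disjoint:
  fixes v :: "nat \<Rightarrow> 'b::real_vector" and w :: "nat \<Rightarrow> ennreal"
  assumes "\<forall>i j. s \<in> C i \<longrightarrow> s \<in> C j \<longrightarrow> i = j"
  obtains (cell) k where "k < n" "s \<in> C k" "(\<Sum>i<n. indicator (C i) s *\<^sub>R v i) = v k" "(\<Sum>i<n. w i * indicator (C i) s) = w k"
  | (outside) "\<forall>k<n. s \<notin> C k" "(\<Sum>i<n. indicator (C i) s *\<^sub>R v i) = 0" "(\<Sum>i<n. w i * indicator (C i) s) = 0"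
proof (cases "\<exists>k<n. s \<in> C k")
  case True
  then obtain k where k: "k < n" "s \<in> C k" by blast
  then have ind: "s \<in> C i \<longleftrightarrow> i = k" for i using assms by blast
  show ?thesis
  proof (rule cell[OF k])
    show "(\<Sum>i<n. indicator (C i) s *\<^sub>R v i) = v k"
      using k by (subst sum.remove[of _ k]) (auto simp: ind indicator_def intro!: sum.neutral)
    show "(\<Sum>i<n. w i * indicator (C i) s) = w k"
      using k by (subst sum.remove[of _ k]) (auto simp: ind indicator_def intro!: sum.neutral)
  qed
next
  case False
  then show ?thesis by (intro outside) (auto intro!: sum.neutral simp: indicator_def)
qed

text \<open>The right side is kept in grid increments because it is twice the term subtracted in the
  exponent of \<open>exp_density\<close>.\<close>

lemma nn_integral_lagged_step:
  assumes T: "T > 0" and n: "n > 0"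
  shows "sq_norm (lagged_step T n f)
    = ennreal (\<Sum>i<n. (norm (lagged_avg T n f i))\<^sup>2 * (grid T n (Suc i) - grid T n i))"
proof -
  let ?C = "\<lambda>i. {real i * T / real n<..real (Suc i) * T / real n}"
  have disjC: "\<forall>i j. s \<in> ?C i \<longrightarrow> s \<in> ?C j \<longrightarrow> i = j" for s
    using disjoint_grid_cells[OF T n, of s 0] by (simp add: add.commute)
  have g: "real i * T / real n \<le> real (Suc i) * T / real n" for i
    using T by (intro divide_right_mono mult_right_mono) auto
  have "ennreal ((norm (lagged_step T n f s))\<^sup>2) = (\<Sum>i<n. ennreal ((norm (lagged_avg T n f i))\<^sup>2) * indicator (?C i) s)" for s
    by (rule sum_indicator_disjoint[OF disjC[of s], of n "lagged_avg T n f" "\<lambda>i. ennreal ((norm (lagged_avg T n f i))\<^sup>2)"])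
      (simp_all only: lagged_step_def norm_zero power_zero_numeral ennreal_0)
  then have "sq_norm (lagged_step T n f)
      = (\<Sum>i<n. \<integral>\<^sup>+s. ennreal ((norm (lagged_avg T n f i))\<^sup>2) * indicator (?C i) s \<partial>lborel)"
    by (simp only:) (rule nn_integral_sum, measurable)
  also have "\<dots> = (\<Sum>i<n. ennreal ((norm (lagged_avg T n f i))\<^sup>2 * (grid T n (Suc i) - grid T n i)))"
  proof (intro sum.cong refl)
    fix i
    show "(\<integral>\<^sup>+s. ennreal ((norm (lagged_avg T n f i))\<^sup>2) * indicator (?C i) s \<partial>lborel)
        = ennreal ((norm (lagged_avg T n f i))\<^sup>2 * (grid T n (Suc i) - grid T n i))"
      using g[of i] by (subst nn_integral_cmult_indicator) (simp_all add: ennreal_mult grid_def)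
  qed
  also have "\<dots> = ennreal (\<Sum>i<n. (norm (lagged_avg T n f i))\<^sup>2 * (grid T n (Suc i) - grid T n i))"
    using g by (intro sum_ennreal mult_nonneg_nonneg) (auto simp: grid_def)
  finally show ?thesis .
qed

text \<open>A step cell is as long as the cell averaged over, so Jensen's inequality moves the mass
  back by one cell; the averaging cells are again disjoint, so no mass is counted twice.\<close>

lemma nn_integral_lagged_step_le:
  assumes f: "L2fun f" and T: "T > 0" and n: "n > 0"
  shows "sq_norm (lagged_step T n f) \<le> sq_norm f"
proof -
  let ?D = "\<lambda>i. {(real i - 1) * T / real n<..real i * T / real n}"
  note [measurable] = L2fun_measurable[OF f]
  have disjD: "\<forall>i j. s \<in> ?D i \<longrightarrow> s \<in> ?D j \<longrightarrow> i = j" for s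
    using disjoint_grid_cells[OF T n, of s "-1"] by (simp add: algebra_simps)
  have "grid T n (Suc i) - grid T n i = T / real n" for i
    by (simp add: grid_def add_divide_distrib distrib_right)
  then have "sq_norm (lagged_step T n f) = (\<Sum>i<n. ennreal (T / real n * (norm (lagged_avg T n f i))\<^sup>2))"
    using T by (subst sum_ennreal) (auto simp: nn_integral_lagged_step[OF T n] mult.commute)
  also have "\<dots> \<le> (\<Sum>i<n. \<integral>\<^sup>+s. ennreal ((norm (f s))\<^sup>2) * indicator (?D i) s \<partial>lborel)"
    by (intro sum_mono lagged_avg_square_le f T n)
  also have "\<dots> = (\<integral>\<^sup>+s. (\<Sum>i<n. ennreal ((norm (f s))\<^sup>2) * indicator (?D i) s) \<partial>lborel)"
    by (subst nn_integral_sum) auto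
  also have "\<dots> \<le> sq_norm f"
  proof (intro nn_integral_mono)
    fix s
    show "(\<Sum>i<n. ennreal ((norm (f s))\<^sup>2) * indicator (?D i) s) \<le> ennreal ((norm (f s))\<^sup>2)"
      by (rule sum_indicator_disjoint[OF disjD[of s], of n "\<lambda>_. 0 :: real" "\<lambda>i. ennreal ((norm (f s))\<^sup>2)"])
        (simp_all only: order_refl zero_le)
  qed
  finally show ?thesis .
qed

section \<open>L2 convergence of the lagged averages\<close>

definition avg_conv :: "real \<Rightarrow> (real \<Rightarrow> 'b::euclidean_space) \<Rightarrow> bool" where
  "avg_conv T f \<longleftrightarrow> (\<lambda>n. sq_norm (\<lambda>s. lagged_step T (Suc n) f s - f s)) \<longlonglongrightarrow> 0"

text \<open>A three-term estimate. By contraction, the averages of \<open>f\<close> and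
  \<open>g m\<close> are as close as \<open>f\<close> and \<open>g m\<close> themselves, uniformly
  in the number of cells.\<close>

lemma avg_conv_closed:
  assumes T: "T > 0" and f: "L2fun f" and g: "\<And>m. L2fun (g m)" and conv: "\<And>m. avg_conv T (g m)"
    and lim: "(\<lambda>m. sq_norm (\<lambda>s. g m s - f s)) \<longlonglongrightarrow> 0"
  shows "avg_conv T f"
  unfolding avg_conv_def
proof (rule tendsto_0_ennrealI)
  fix e :: real assume "e > 0"
  \<comment> \<open>The final bound is \<open>6 * a + 4 * b\<close>, where \<open>a\<close> is the
    squared distance of \<open>g m\<close> from \<open>f\<close> and \<open>b\<close> the averaging
    error of \<open>g m\<close>; these thresholds give each summand half of
    \<open>e\<close>.\<close>
  then have "0 < ennreal (e / 12)" "0 < ennreal (e / 8)" by simp_all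
  from order_tendstoD(2)[OF lim this(1)] obtain m
    where m: "sq_norm (\<lambda>s. g m s - f s) < ennreal (e / 12)" (is "?a < _")
    by (auto simp: eventually_sequentially)
  note [measurable] = L2fun_measurable[OF f] L2fun_measurable[OF g]
  show "\<forall>\<^sub>F n in sequentially. sq_norm (\<lambda>s. lagged_step T (Suc n) f s - f s) < ennreal e"
    using order_tendstoD(2)[OF conv[of m, unfolded avg_conv_def] \<open>0 < ennreal (e / 8)\<close>]
  proof eventually_elim
    case (elim n)
    let ?P = "lagged_step T (Suc n)"
    let ?b = "sq_norm (\<lambda>s. ?P (g m) s - g m s)"
    have c: "sq_norm (\<lambda>s. ?P f s - ?P (g m) s) \<le> ?a"
    proof -
      have "sq_norm (\<lambda>s. ?P f s - ?P (g m) s) = sq_norm (\<lambda>s. ?P (\<lambda>s. g m s - f s) s)"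
        by (simp add: lagged_step_diff[OF g f] norm_minus_commute)
      also have "\<dots> \<le> ?a"
        by (rule nn_integral_lagged_step_le[OF L2fun_diff[OF g f] T]) simp
      finally show ?thesis .
    qed
    have "sq_norm (\<lambda>s. ?P f s - f s)
        \<le> (\<integral>\<^sup>+s. 2 * ennreal ((norm (?P f s - ?P (g m) s))\<^sup>2) + 2 * (2 * ennreal ((norm (?P (g m) s - g m s))\<^sup>2) + 2 * ennreal ((norm (g m s - f s))\<^sup>2)) \<partial>lborel)"
      by (intro nn_integral_mono order_trans[OF ennreal_power2_norm_diff_le add_left_mono[OF mult_left_mono[OF ennreal_power2_norm_diff_le]]]) simp
    also have "\<dots> = 2 * sq_norm (\<lambda>s. ?P f s - ?P (g m) s) + 2 * (2 * ?b + 2 * ?a)"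
      by (simp add: nn_integral_add nn_integral_cmult)
    also have "\<dots> \<le> 2 * ?a + 2 * (2 * ?b + 2 * ?a)"
      by (intro add_right_mono mult_left_mono c) simp
    also have "\<dots> < ennreal e"
    proof -
      obtain a b where ab: "?a = ennreal a" "0 \<le> a" "?b = ennreal b" "0 \<le> b"
      proof
        have "?a \<noteq> top" "?b \<noteq> top" using m elim by auto
        then show "?a = ennreal (enn2real ?a)" "?b = ennreal (enn2real ?b)"
          by (simp_all add: ennreal_enn2real top.not_eq_extremum)
      qed simp_all
      have "a < e / 12" "b < e / 8" using m elim ab by (simp_all add: ennreal_less_iff)
      then have "2 * a + 2 * (2 * b + 2 * a) < e" by simp
      moreover have "2 * ?a + 2 * (2 * ?b + 2 * ?a) = ennreal (2 * a + 2 * (2 * b + 2 * a))"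
        using ab by (simp only: ennreal_plus ennreal_mult ennreal_numeral zero_le_numeral mult_nonneg_nonneg add_nonneg_nonneg)
      ultimately show ?thesis using \<open>e > 0\<close> by (simp only: ennreal_lessI)
    qed
    finally show ?case .
  qed
qed

lemma avg_conv_diff:
  assumes f: "L2fun f" "avg_conv T f" and g: "L2fun g" "avg_conv T g"
  shows "avg_conv T (\<lambda>s. f s - g s)"
  unfolding avg_conv_def
proof (rule tendsto_sandwich[OF _ _ tendsto_const])
  note [measurable] = L2fun_measurable[OF f(1)] L2fun_measurable[OF g(1)]
  let ?E = "\<lambda>n h. sq_norm (\<lambda>s. lagged_step T (Suc n) h s - h s)"
  have "?E n (\<lambda>s. f s - g s) \<le> 2 * ?E n f + 2 * ?E n g" for n
  proof -
    let ?P = "lagged_step T (Suc n)"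
    have "?E n (\<lambda>s. f s - g s) \<le> (\<integral>\<^sup>+s. 2 * ennreal ((norm (?P f s - f s))\<^sup>2) + 2 * ennreal ((norm (?P g s - g s))\<^sup>2) \<partial>lborel)"
    proof (intro nn_integral_mono)
      fix s
      have "?P (\<lambda>s. f s - g s) s - (f s - g s) = (?P f s - f s) - (?P g s - g s)"
        by (simp add: lagged_step_diff[OF f(1) g(1)])
      note e = this
      show "ennreal ((norm (?P (\<lambda>s. f s - g s) s - (f s - g s)))\<^sup>2) \<le> 2 * ennreal ((norm (?P f s - f s))\<^sup>2) + 2 * ennreal ((norm (?P g s - g s))\<^sup>2)"
        unfolding e using ennreal_power2_norm_diff_le[of "?P f s - f s" "?P g s - g s" 0]
        by (simp only: diff_0 diff_0_right norm_minus_cancel)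
    qed
    also have "\<dots> = 2 * ?E n f + 2 * ?E n g"
      by (simp add: nn_integral_add nn_integral_cmult)
    finally show ?thesis .
  qed
  then show "\<forall>\<^sub>F n in sequentially. ?E n (\<lambda>s. f s - g s) \<le> 2 * ?E n f + 2 * ?E n g"
    by simp
  have "(\<lambda>n. 2 * ?E n f + 2 * ?E n g) \<longlonglongrightarrow> 2 * 0 + 2 * 0"
    using f(2) g(2) unfolding avg_conv_def by (intro tendsto_add ennreal_tendsto_cmult) auto
  then show "(\<lambda>n. 2 * ?E n f + 2 * ?E n g) \<longlonglongrightarrow> 0" by simp
qed simp

lemma avg_conv_zero: "avg_conv T (\<lambda>_. 0)"
  by (simp add: avg_conv_def lagged_step_def lagged_avg_def)

lemma avg_conv_sum:
  assumes "finite I" "\<And>i. i \<in> I \<Longrightarrow> L2fun (f i)" "\<And>i. i \<in> I \<Longrightarrow> avg_conv T (f i)"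
  shows "L2fun (\<lambda>s. \<Sum>i\<in>I. f i s) \<and> avg_conv T (\<lambda>s. \<Sum>i\<in>I. f i s)"
  using assms
proof (induction I rule: finite_induct)
  case empty
  then show ?case by (simp add: L2fun_zero avg_conv_zero)
next
  case (insert i I)
  then have *: "L2fun (f i)" "avg_conv T (f i)" "L2fun (\<lambda>s. \<Sum>i\<in>I. f i s)" "avg_conv T (\<lambda>s. \<Sum>i\<in>I. f i s)" by auto
  \<comment> \<open>The sum is written as a difference of differences, so that
    \<open>avg_conv_diff\<close> applies twice.\<close>
  have "avg_conv T (\<lambda>s. f i s - (0 - (\<Sum>i\<in>I. f i s)))"
    by (intro avg_conv_diff L2fun_diff L2fun_zero avg_conv_zero *)
  moreover have "L2fun (\<lambda>s. f i s + (\<Sum>i\<in>I. f i s))"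
    by (intro L2fun_add *)
  ultimately show ?case using insert by simp
qed

text \<open>The averages are exact except on the first cell and near the endpoint \<open>x\<close>.
  The error is therefore bounded and lives on a set whose measure is of the order of the
  mesh.\<close>

lemma avg_conv_initial_interval:
  fixes v :: "'b::euclidean_space"
  assumes T: "T > 0"
  shows "avg_conv T (\<lambda>s. indicator ({..x} \<inter> {0..T}) s *\<^sub>R v)" (is "avg_conv T ?f")
  unfolding avg_conv_def
proof (rule tendsto_sandwich[OF _ _ tendsto_const])
  have L: "L2fun ?f"
    by (rule L2fun_bound[OF L2fun_const_interval[of 0 T v], of _ 1]) (auto simp: indicator_def)
  have "sq_norm (\<lambda>s. lagged_step T (Suc n) ?f s - ?f s) \<le> ennreal (16 * (norm v)\<^sup>2 * T / real (Suc n))" for n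
  proof -
    define N where "N = Suc n"
    have N: "N > 0" by (simp add: N_def)
    define h where "h = T / real N"
    have h: "h > 0" using T N by (simp add: h_def)
    let ?P = "lagged_step T N ?f"
    let ?C = "\<lambda>i. {real i * h<..(real i + 1) * h}"
    let ?D = "\<lambda>i. {(real i - 1) * h<..real i * h}"
    have mD: "measure lborel (?D i) = h" and eD: "emeasure lborel (?D i) = ennreal h" for i
      using h by (simp_all add: algebra_simps)
    have avg: "lagged_avg T N ?f i = (1 / h) *\<^sub>R (LBINT u:?D i. ?f u)" for i
      by (simp add: lagged_avg_def h_def)
    have avg_le: "norm (lagged_avg T N ?f i) \<le> norm v" for i
    proof -
      have "ennreal (h * (norm (lagged_avg T N ?f i))\<^sup>2) \<le> (\<integral>\<^sup>+s. ennreal ((norm (?f s))\<^sup>2) * indicator (?D i) s \<partial>lborel)"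
        using lagged_avg_square_le[OF L T N, of i] by (simp add: h_def)
      also have "\<dots> \<le> (\<integral>\<^sup>+s. ennreal ((norm v)\<^sup>2) * indicator (?D i) s \<partial>lborel)"
        by (intro nn_integral_mono) (auto simp: indicator_def)
      also have "\<dots> = ennreal (h * (norm v)\<^sup>2)"
        using h by (subst nn_integral_cmult_indicator, simp) (simp only: eD, simp add: ennreal_mult mult.commute)
      finally show ?thesis using h by (simp add: power_mono_iff)
    qed
    have P: "?P s = (\<Sum>i<N. indicator (?C i) s *\<^sub>R lagged_avg T N ?f i)" for s
      by (simp add: lagged_step_def h_def add.commute)
    have disj: "\<forall>i j. s \<in> ?C i \<longrightarrow> s \<in> ?C j \<longrightarrow> i = j" for s
      using disjoint_grid_cells[OF T N, of s 0] by (simp add: h_def)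
    have Nh: "real N * h = T" using N by (simp add: h_def)
    \<comment> \<open>Exceptional set: a cell that contains \<open>x\<close>, or whose predecessor
      does, lies within \<open>h\<close> before and \<open>2 * h\<close> after \<open>x\<close>, and
      the first cell is \<open>{0..h}\<close>. Total length \<open>4 * h\<close>, times the crude
      bound \<open>4 * (norm v)\<^sup>2\<close>, explains the constant 16.\<close>
    have pt: "(norm (?P s - ?f s))\<^sup>2 \<le> 4 * (norm v)\<^sup>2 * (indicator {x - h..x + 2 * h} s + indicator {0..h} s)" for s
    proof -
      have cr: "(norm (?P s - ?f s))\<^sup>2 \<le> 4 * (norm v)\<^sup>2"
      proof -
        have "norm (?P s) \<le> norm v"
          by (rule sum_indicator_disjoint[OF disj[of s], of N "lagged_avg T N ?f" "\<lambda>_. 0"])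
            (simp_all only: P avg_le norm_zero norm_ge_zero)
        moreover have "norm (?f s) \<le> norm v" by (simp add: indicator_def)
        ultimately have "norm (?P s - ?f s) \<le> 2 * norm v"
          using norm_triangle_ineq4[of "?P s" "?f s"] by linarith
        from power_mono[OF this, of 2] show ?thesis by (simp add: power_mult_distrib)
      qed
      show ?thesis
      proof (cases "s \<in> {x - h..x + 2 * h} \<or> s \<in> {0..h}")
        case True
        then have "1 \<le> (indicator {x - h..x + 2 * h} s + indicator {0..h} s :: real)" by (auto simp: indicator_def)
        from mult_left_mono[OF this, of "4 * (norm v)\<^sup>2"] cr show ?thesis by simp
      next
        case False
        have "?P s = ?f s"
        proof (rule sum_indicator_disjoint[OF disj[of s], of N "lagged_avg T N ?f" "\<lambda>_. 0"])
          fix k assume k: "k < N" "s \<in> ?C k" and Pk: "(\<Sum>i<N. indicator (?C i) s *\<^sub>R lagged_avg T N ?f i) = lagged_avg T N ?f k"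
          \<comment> \<open>The first cell averages over negative times, where the function
            vanishes, but it lies in the exceptional set.\<close>
          have "k \<noteq> 0" using k(2) False by (intro notI) auto
          then have k1: "real k - 1 \<ge> 0" by simp
          then have lo: "(real k - 1) * h \<ge> 0" using h by simp
          have "(real k + 1) * h \<le> real N * h" using k(1) h by (intro mult_right_mono) auto
          then have hi: "(real k + 1) * h \<le> T" using Nh by simp
          have s: "real k * h < s" "s \<le> real k * h + h" using k(2) by (auto simp: algebra_simps)
          have lo': "real k * h - h \<ge> 0" and hi': "real k * h + h \<le> T" using lo hi by (simp_all add: algebra_simps)
          \<comment> \<open>Cell \<open>k\<close> and its predecessor lie both before
            \<open>x\<close>, both after it, or \<open>x\<close> falls among them; the last case
            puts \<open>s\<close> into the exceptional set.\<close>
          consider "real k * h + h \<le> x" | "x \<le> real k * h - h" | "real k * h - h < x" "x < real k * h + h" by linarith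
          then show ?thesis
          proof cases
            case 1
            have "(LBINT u:?D k. ?f u) = (LBINT u:?D k. v)"
            proof (intro set_lebesgue_integral_cong allI impI)
              fix u assume "u \<in> ?D k"
              then have "real k * h - h < u" "u \<le> real k * h" by (auto simp: algebra_simps)
              with 1 lo' hi' h have "u \<in> {..x} \<inter> {0..T}" unfolding Int_iff atLeastAtMost_iff atMost_iff by linarith
              then show "?f u = v" by simp
            qed simp
            also have "\<dots> = h *\<^sub>R v"
              unfolding set_lebesgue_integral_def using mD[of k] eD[of k] by simp
            finally have I: "(LBINT u:?D k. ?f u) = h *\<^sub>R v" .
            have "lagged_avg T N ?f k = v" unfolding avg I using h by simp
            moreover have "?f s = v"
            proof -
              from 1 s lo' hi' h have "s \<in> {..x} \<inter> {0..T}" unfolding Int_iff atLeastAtMost_iff atMost_iff by linarith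
              then show ?thesis by simp
            qed
            ultimately show ?thesis using Pk by (simp only: P)
          next
            case 2
            have I: "(LBINT u:?D k. ?f u) = (LBINT u:?D k. 0)"
              using 2 by (intro set_lebesgue_integral_cong) (auto simp: indicator_def algebra_simps)
            have "lagged_avg T N ?f k = 0" unfolding avg I by simp
            moreover have "?f s = 0" using 2 s h by (auto simp: indicator_def)
            ultimately show ?thesis using Pk by (simp only: P)
          next
            case 3
            then show ?thesis using False s by auto
          qed
        next
          assume out: "\<forall>k<N. s \<notin> ?C k" and P0: "(\<Sum>i<N. indicator (?C i) s *\<^sub>R lagged_avg T N ?f i) = 0"
          have "\<not> (0 < s \<and> s \<le> T)"
          proof
            assume s: "0 < s \<and> s \<le> T"
            \<comment> \<open>Cells are open on the left and closed on the right, so the ceiling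
              minus one is the index of the cell containing \<open>s\<close>.\<close>
            define k where "k = nat (\<lceil>s / h\<rceil> - 1)"
            have c: "\<lceil>s / h\<rceil> \<ge> 1" using s h by (simp add: one_le_ceiling)
            then have k: "real k = of_int \<lceil>s / h\<rceil> - 1" by (simp add: k_def)
            have "real k < s / h" "s / h \<le> real k + 1" unfolding k by linarith+
            then have "s \<in> ?C k" using h by (auto simp: field_simps)
            moreover have "k < N"
            proof -
              have "s / h \<le> real N" using s h Nh by (simp add: field_simps)
              with \<open>real k < s / h\<close> show ?thesis by simp
            qed
            ultimately show False using out by blast
          qed
          then have "s \<notin> {0..T}" using False h by auto
          then show ?thesis using P0 by (simp only: P) (simp add: indicator_def)
        qed
        then show ?thesis by simp
      qed
    qed
    have "sq_norm (\<lambda>s. ?P s - ?f s)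
        \<le> (\<integral>\<^sup>+s. ennreal (4 * (norm v)\<^sup>2) * (indicator {x - h..x + 2 * h} s + indicator {0..h} s) \<partial>lborel)"
    proof (intro nn_integral_mono)
      fix s
      have "ennreal ((norm (?P s - ?f s))\<^sup>2) \<le> ennreal (4 * (norm v)\<^sup>2 * (indicator {x - h..x + 2 * h} s + indicator {0..h} s))"
        by (rule ennreal_leI[OF pt])
      also have "\<dots> = ennreal (4 * (norm v)\<^sup>2) * (indicator {x - h..x + 2 * h} s + indicator {0..h} s)"
        by (subst ennreal_mult) (auto simp: indicator_def)
      finally show "ennreal ((norm (?P s - ?f s))\<^sup>2) \<le> ennreal (4 * (norm v)\<^sup>2) * (indicator {x - h..x + 2 * h} s + indicator {0..h} s)" .
    qed
    also have "\<dots> = ennreal (4 * (norm v)\<^sup>2) * (ennreal (3 * h) + ennreal h)"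
      using h by (subst nn_integral_cmult, simp) (subst nn_integral_add, auto simp: algebra_simps)
    also have "\<dots> = ennreal (16 * (norm v)\<^sup>2 * T / real (Suc n))"
      using h by (simp add: ennreal_plus[symmetric] ennreal_mult[symmetric] h_def N_def mult.assoc del: ennreal_plus)
    finally show ?thesis by (simp add: N_def)
  qed
  then show "\<forall>\<^sub>F n in sequentially. sq_norm (\<lambda>s. lagged_step T (Suc n) ?f s - ?f s) \<le> ennreal (16 * (norm v)\<^sup>2 * T / real (Suc n))"
    by simp
  have "(\<lambda>n. (16 * (norm v)\<^sup>2 * T) / real (Suc n)) \<longlonglongrightarrow> 0"
    using LIMSEQ_Suc[OF lim_const_over_n] .
  from tendsto_ennrealI[OF this] show "(\<lambda>n. ennreal (16 * (norm v)\<^sup>2 * T / real (Suc n))) \<longlonglongrightarrow> 0"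
    by simp
qed simp

text \<open>Dynkin's argument, started from half-lines. Complements within \<open>[0,T]\<close> are
  differences, and disjoint unions are L2 limits of finite sums, to which
  \<open>avg_conv_closed\<close> applies.\<close>

lemma avg_conv_indicator:
  fixes v :: "'b::euclidean_space"
  assumes T: "T > 0" and A: "A \<in> sets (borel :: real measure)"
  shows "avg_conv T (\<lambda>s. indicator (A \<inter> {0..T}) s *\<^sub>R v)"
proof -
  have L: "L2fun (\<lambda>s. indicator (A \<inter> {0..T}) s *\<^sub>R v)" if "A \<in> sets borel" for A
    using that by (intro L2fun_bound[OF L2fun_const_interval[of 0 T v], of _ 1]) (auto simp: indicator_def)
  have sb: "sets (borel :: real measure) = sigma_sets UNIV (range (\<lambda>a. {..a}))"
    by (subst borel_eq_atMost) (simp add: sets_measure_of)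
  have "Int_stable (range (\<lambda>a::real. {..a}))"
    by (auto simp: Int_stable_def)
  moreover have "range (\<lambda>a::real. {..a}) \<subseteq> Pow UNIV" by simp
  moreover have "A \<in> sigma_sets UNIV (range (\<lambda>a. {..a}))" using A sb by simp
  ultimately show ?thesis
  proof (induction rule: sigma_sets_induct_disjoint)
    case (basic A)
    then show ?case using avg_conv_initial_interval[OF T] by auto
  next
    case empty
    then show ?case by (simp add: avg_conv_zero)
  next
    case (compl A)
    then have "A \<in> sets borel" using sb by simp
    \<comment> \<open>All of \<open>[0,T]\<close> is itself an initial interval, with endpoint
      \<open>T\<close>.\<close>
    then have "avg_conv T (\<lambda>s. indicator ({..T} \<inter> {0..T}) s *\<^sub>R v - indicator (A \<inter> {0..T}) s *\<^sub>R v)"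
      using compl by (intro avg_conv_diff avg_conv_initial_interval[OF T] L) auto
    moreover have "indicator ({..T} \<inter> {0..T}) s *\<^sub>R v - indicator (A \<inter> {0..T}) s *\<^sub>R v = indicator ((UNIV - A) \<inter> {0..T}) s *\<^sub>R v" for s
      by (auto simp: indicator_def)
    ultimately show ?case by simp
  next
    case (union A)
    then have m: "A i \<in> sets borel" for i using sb by auto
    let ?g = "\<lambda>m s. \<Sum>i<m. indicator (A i \<inter> {0..T}) s *\<^sub>R v"
    let ?f = "\<lambda>s. indicator ((\<Union>i. A i) \<inter> {0..T}) s *\<^sub>R v"
    have g: "?g m s = indicator ((\<Union>i<m. A i) \<inter> {0..T}) s *\<^sub>R v" for m s
    proof -
      have "indicator ((\<Union>i<m. A i) \<inter> {0..T}) s = (\<Sum>i<m. indicator (A i \<inter> {0..T}) s :: real)"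
      proof -
        have "disjoint_family_on (\<lambda>i. A i \<inter> {0..T}) {..<m}"
          using union(1) by (auto simp: disjoint_family_on_def)
        from indicator_UN_disjoint[OF finite_lessThan this, of s] show ?thesis by (simp add: Int_UN_distrib2)
      qed
      then show ?thesis by (simp add: scaleR_sum_left)
    qed
    have Lg: "L2fun (?g m)" "avg_conv T (?g m)" for m
      using avg_conv_sum[of "{..<m}" "\<lambda>i s. indicator (A i \<inter> {0..T}) s *\<^sub>R v" T] union L m by auto
    have mU: "(\<Union>i. A i) \<in> sets borel" using m by auto
    have "(\<lambda>m. sq_norm (\<lambda>s. ?g m s - ?f s)) \<longlonglongrightarrow> (\<integral>\<^sup>+s. 0 \<partial>(lborel :: real measure))"
    proof (rule nn_integral_dominated_convergence[where w="\<lambda>s. ennreal ((norm (indicator {0..T} s *\<^sub>R v))\<^sup>2)"])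
      show "AE s in lborel. ennreal ((norm (?g m s - ?f s))\<^sup>2) \<le> ennreal ((norm (indicator {0..T} s *\<^sub>R v))\<^sup>2)" for m
        unfolding g by (intro AE_I2 ennreal_leI power_mono) (auto simp: indicator_def)
      show "sq_norm (\<lambda>s. indicator {0..T} s *\<^sub>R v) < \<infinity>"
        using L2fun_const_interval[of 0 T v] by (simp add: L2fun_def)
      show "AE s in lborel. (\<lambda>m. ennreal ((norm (?g m s - ?f s))\<^sup>2)) \<longlonglongrightarrow> 0"
      proof (intro AE_I2 tendsto_eventually)
        fix s
        show "\<forall>\<^sub>F m in sequentially. ennreal ((norm (?g m s - ?f s))\<^sup>2) = 0"
        proof (cases "s \<in> (\<Union>i. A i)")
          case True
          then obtain i where "s \<in> A i" by blast
          then have "\<forall>m>i. ?g m s = ?f s" unfolding g by (auto simp: indicator_def)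
          then show ?thesis unfolding eventually_sequentially by (intro exI[of _ "Suc i"]) auto
        next
          case False
          then have "?g m s = ?f s" for m unfolding g by (auto simp: indicator_def)
          then show ?thesis by simp
        qed
      qed
    qed (use L2fun_measurable[OF Lg(1)] L2fun_measurable[OF L[OF mU]] in measurable)
    then have lim: "(\<lambda>m. sq_norm (\<lambda>s. ?g m s - ?f s)) \<longlonglongrightarrow> 0" by simp
    show ?case
      by (rule avg_conv_closed[OF T L[OF mU] Lg(1) Lg(2) lim])
  qed
qed

text \<open>Simple functions reduce to indicators, and general functions to simple ones by L2
  closure. The bound of the approximants by \<open>2 * norm (f s)\<close> does double duty: it makes
  them vanish outside \<open>[0,T]\<close>, and it dominates the squared error by
  \<open>9 * (norm (f s))\<^sup>2\<close>.\<close>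

theorem lagged_step_tendsto:
  fixes f :: "real \<Rightarrow> 'b::euclidean_space"
  assumes T: "T > 0" and f: "L2fun f" and supp: "\<And>s. s \<notin> {0..T} \<Longrightarrow> f s = 0"
  shows "(\<lambda>n. sq_norm (\<lambda>s. lagged_step T (Suc n) f s - f s)) \<longlonglongrightarrow> 0"
proof -
  have "f \<in> borel_measurable lborel" using L2fun_measurable[OF f] by simp
  from borel_measurable_implies_sequence_metric[OF this, of 0] obtain S where
    S': "\<forall>i. simple_function lborel (S i)" "\<forall>s\<in>space lborel. (\<lambda>i. S i s) \<longlonglongrightarrow> f s"
      "\<forall>i. \<forall>s\<in>space lborel. dist (S i s) 0 \<le> 2 * dist (f s) 0"
    by blast
  have S: "\<And>i. simple_function lborel (S i)" "\<And>s. (\<lambda>i. S i s) \<longlonglongrightarrow> f s" "\<And>i s. norm (S i s) \<le> 2 * norm (f s)"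
    using S' by simp_all
  have Sm [measurable]: "S i \<in> borel_measurable borel" for i
    using borel_measurable_simple_function[OF S(1)] by simp
  note [measurable] = L2fun_measurable[OF f]
  have L: "L2fun (S i)" for i
    by (rule L2fun_bound[OF f, of _ 2]) (use S in auto)
  have conv: "avg_conv T (S i)" for i
  proof -
    have fin: "finite (range (S i))" using simple_functionD(1)[OF S(1), of i] by simp
    have eq: "S i s = (\<Sum>y\<in>range (S i). indicator ((S i -` {y}) \<inter> {0..T}) s *\<^sub>R y)" for s
    proof -
      have "(\<Sum>y\<in>range (S i). indicator ((S i -` {y}) \<inter> {0..T}) s *\<^sub>R y) = (\<Sum>y\<in>range (S i). if y = S i s then indicator {0..T} s *\<^sub>R y else 0)"
        by (intro sum.cong refl) (auto simp: indicator_def)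
      also have "\<dots> = indicator {0..T} s *\<^sub>R S i s" using fin by (simp add: sum.delta)
      also have "\<dots> = S i s"
        using S(3)[of i s] supp[of s] by (auto simp: indicator_def)
      finally show ?thesis by simp
    qed
    have my: "S i -` {y} \<in> sets borel" for y
      using measurable_sets[OF Sm, of "{y}" i] by simp
    have "avg_conv T (\<lambda>s. \<Sum>y\<in>range (S i). indicator ((S i -` {y}) \<inter> {0..T}) s *\<^sub>R y)"
    proof (rule avg_conv_sum[THEN conjunct2, OF fin])
      fix y assume "y \<in> range (S i)"
      show "L2fun (\<lambda>s. indicator (S i -` {y} \<inter> {0..T}) s *\<^sub>R y)"
        using my[of y] by (intro L2fun_bound[OF L2fun_const_interval[of 0 T y], of _ 1]) (auto simp: indicator_def)
      show "avg_conv T (\<lambda>s. indicator (S i -` {y} \<inter> {0..T}) s *\<^sub>R y)"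
        by (rule avg_conv_indicator[OF T my])
    qed
    moreover have "S i = (\<lambda>s. \<Sum>y\<in>range (S i). indicator ((S i -` {y}) \<inter> {0..T}) s *\<^sub>R y)"
      by (rule ext) (rule eq)
    ultimately show ?thesis by simp
  qed
  have "(\<lambda>m. sq_norm (\<lambda>s. S m s - f s)) \<longlonglongrightarrow> (\<integral>\<^sup>+s. 0 \<partial>(lborel :: real measure))"
  proof (rule nn_integral_dominated_convergence[where w="\<lambda>s. ennreal 9 * ennreal ((norm (f s))\<^sup>2)"])
    show "AE s in lborel. ennreal ((norm (S m s - f s))\<^sup>2) \<le> ennreal 9 * ennreal ((norm (f s))\<^sup>2)" for m
    proof (rule AE_I2)
      fix s
      have "norm (S m s - f s) \<le> 3 * norm (f s)" using S(3)[of m s] norm_triangle_ineq4[of "S m s" "f s"] by linarith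
      from power_mono[OF this, of 2] have "(norm (S m s - f s))\<^sup>2 \<le> 9 * (norm (f s))\<^sup>2" by (simp add: power_mult_distrib)
      from ennreal_leI[OF this] show "ennreal ((norm (S m s - f s))\<^sup>2) \<le> ennreal 9 * ennreal ((norm (f s))\<^sup>2)"
        by (simp add: ennreal_mult)
    qed
    show "(\<integral>\<^sup>+s. ennreal 9 * ennreal ((norm (f s))\<^sup>2) \<partial>lborel) < \<infinity>"
      using f by (subst nn_integral_cmult) (auto simp: L2fun_def ennreal_mult_less_top)
    show "AE s in lborel. (\<lambda>m. ennreal ((norm (S m s - f s))\<^sup>2)) \<longlonglongrightarrow> 0"
    proof (rule AE_I2)
      fix s
      have "(\<lambda>m. (norm (S m s - f s))\<^sup>2) \<longlonglongrightarrow> (norm (f s - f s))\<^sup>2"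
        by (intro tendsto_intros S(2))
      from tendsto_ennrealI[OF this] show "(\<lambda>m. ennreal ((norm (S m s - f s))\<^sup>2)) \<longlonglongrightarrow> 0" by simp
    qed
  qed measurable
  then have "(\<lambda>m. sq_norm (\<lambda>s. S m s - f s)) \<longlonglongrightarrow> 0" by simp
  from avg_conv_closed[OF T f L conv this] show ?thesis by (simp add: avg_conv_def)
qed

section \<open>The Ito integral\<close>

text \<open>The path of \<open>a\<close> at \<open>w\<close> extended by zero to the whole line,
  with time as last argument, so that results on functions of time apply to
  \<open>clipped T a w\<close>. Values of \<open>a\<close> outside \<open>[0,T]\<close> are
  arbitrary.\<close>

definition clipped :: "real \<Rightarrow> (real \<Rightarrow> 'a \<Rightarrow> 'b::euclidean_space) \<Rightarrow> 'a \<Rightarrow> real \<Rightarrow> 'b" where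
  "clipped T a w s = indicator {0..T} s *\<^sub>R a s w"

lemma nn_integral_clipped:
  "(\<integral>\<^sup>+ s\<in>{0..T}. ennreal ((norm (a s w))\<^sup>2) \<partial>lborel) = sq_norm (clipped T a w)"
  by (intro nn_integral_cong) (auto simp: clipped_def indicator_def)

section \<open>Adapted step approximations\<close>

context brownian_filtration
begin

lemma progressive_jointly_measurable:
  assumes a: "progressively_measurable F T a" and t: "0 \<le> t" "t \<le> T"
  shows "(\<lambda>(s, w). clipped t a w s) \<in> borel_measurable (borel \<Otimes>\<^sub>M F t)"
proof -
  have [measurable]: "(\<lambda>(s, w). a s w) \<in> borel_measurable (restrict_space borel {0..t} \<Otimes>\<^sub>M F t)"
    using a t by (simp add: progressively_measurable_def)
  \<comment> \<open>Clamping time to \<open>[0,t]\<close> turns measurability on the restricted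
    space into measurability on the whole line; the indicator hides the clamped values.\<close>
  have [measurable]: "(\<lambda>s. max 0 (min t s)) \<in> measurable borel (restrict_space borel {0..t})"
    using t by (intro measurable_restrict_space2) auto
  have "(\<lambda>p. indicator {0..t} (fst p) *\<^sub>R (\<lambda>(s, w). a s w) (max 0 (min t (fst p)), snd p)) \<in> borel_measurable (borel \<Otimes>\<^sub>M F t)"
    by measurable
  moreover have "(\<lambda>p. indicator {0..t} (fst p) *\<^sub>R (\<lambda>(s, w). a s w) (max 0 (min t (fst p)), snd p)) = (\<lambda>(s, w). clipped t a w s)"
    by (auto simp: fun_eq_iff clipped_def indicator_def)
  ultimately show ?thesis by (simp only:)
qed

lemma progressive_jointly_measurable_M:
  assumes a: "progressively_measurable F T a"
  shows "(\<lambda>(s, w). clipped T a w s) \<in> borel_measurable (borel \<Otimes>\<^sub>M M)"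
proof -
  have "(\<lambda>w. w) \<in> measurable M (F T)"
    using subalgebra_F[of T] T_pos by (auto simp: subalgebra_def measurable_def Int_absorb2 sets.sets_into_space dest: subsetD)
  then have "(\<lambda>p. (fst p, snd p)) \<in> measurable (borel \<Otimes>\<^sub>M M) (borel \<Otimes>\<^sub>M F T)"
    by measurable
  from measurable_compose[OF this progressive_jointly_measurable[OF a]] T_pos
  show ?thesis by (simp add: case_prod_beta)
qed

lemma clipped_measurable:
  assumes "progressively_measurable F T a" "w \<in> space M"
  shows "clipped T a w \<in> borel_measurable borel"
proof -
  have "(\<lambda>s. (s, w)) \<in> measurable borel (borel \<Otimes>\<^sub>M M)" using assms(2) by simp
  from measurable_compose[OF this progressive_jointly_measurable_M[OF assms(1)]]
  show ?thesis by simp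
qed

lemma admissible_bound:
  assumes "a \<in> admissible M F T"
  obtains A where "A > 0"
    "AE w in M. L2fun (clipped T a w) \<and> sq_norm (clipped T a w) < ennreal A"
proof -
  from assms obtain A where A: "A > 0" "AE w in M. (\<integral>\<^sup>+ s\<in>{0..T}. ennreal ((norm (a s w))\<^sup>2) \<partial>lborel) < ennreal A"
    and pm: "progressively_measurable F T a"
    by (auto simp: admissible_def)
  have "AE w in M. L2fun (clipped T a w) \<and> sq_norm (clipped T a w) < ennreal A"
    using A(2) AE_space
  proof eventually_elim
    case (elim w)
    then show ?case
      unfolding nn_integral_clipped using clipped_measurable[OF pm] by (auto simp: L2fun_def intro: less_trans)
  qed
  with A(1) that show ?thesis by blast
qed

text \<open>The averaging cell ends at the grid point \<open>i\<close>. On it, clipping at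
  \<open>T\<close> and clipping at that point agree, so progressive measurability up to that time
  and Fubini suffice.\<close>

lemma lagged_avg_adapted:
  assumes a: "progressively_measurable F T a" and n: "n > 0" and i: "i \<le> n"
  shows "(\<lambda>w. lagged_avg T n (clipped T a w) i) \<in> borel_measurable (F (grid T n i))"
proof -
  let ?t = "grid T n i" and ?D = "{(real i - 1) * T / real n<..real i * T / real n}"
  have t: "0 \<le> ?t" "?t \<le> T"
    using T_pos n i by (auto simp: grid_def divide_le_eq mult.commute)
  note jm = progressive_jointly_measurable[OF a t]
  have "(\<lambda>p. indicator ?D (snd p) *\<^sub>R (\<lambda>(s, w). clipped ?t a w s) (snd p, fst p)) \<in> borel_measurable (F ?t \<Otimes>\<^sub>M lborel)"
    using measurable_compose[OF measurable_pair_swap', of "\<lambda>(s, w). clipped ?t a w s" borel "F ?t" borel] jm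
    by (intro borel_measurable_scaleR) (auto simp: case_prod_beta)
  then have "(\<lambda>(w, u). indicator ?D u *\<^sub>R clipped ?t a w u) \<in> borel_measurable (F ?t \<Otimes>\<^sub>M lborel)"
    by (simp add: case_prod_beta)
  from lborel.borel_measurable_lebesgue_integral[OF this]
  have m: "(\<lambda>w. \<integral>u. indicator ?D u *\<^sub>R clipped ?t a w u \<partial>lborel) \<in> borel_measurable (F ?t)" .
  have "lagged_avg T n (clipped T a w) i = (real n / T) *\<^sub>R (\<integral>u. indicator ?D u *\<^sub>R clipped ?t a w u \<partial>lborel)" for w
  proof -
    have "indicator ?D u *\<^sub>R clipped T a w u = indicator ?D u *\<^sub>R clipped ?t a w u" for u
      using t by (cases "u \<in> ?D") (auto simp: clipped_def indicator_def grid_def)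
    then show ?thesis by (simp only: lagged_avg_def set_lebesgue_integral_def)
  qed
  then show ?thesis using m by simp
qed

lemma lagged_avg_norm_le:
  assumes f: "L2fun f" and A: "sq_norm f < ennreal A" and n: "n > 0"
  shows "norm (lagged_avg T n f i) \<le> sqrt (A * real n / T)"
proof -
  have "ennreal (T / real n * (norm (lagged_avg T n f i))\<^sup>2)
      \<le> (\<integral>\<^sup>+s. ennreal ((norm (f s))\<^sup>2) * indicator {(real i - 1) * T / real n<..real i * T / real n} s \<partial>lborel)"
    by (rule lagged_avg_square_le[OF f T_pos n])
  also have "\<dots> \<le> sq_norm f"
    by (intro nn_integral_mono) (auto simp: indicator_def)
  also have "\<dots> < ennreal A" by (rule A)
  finally have "T / real n * (norm (lagged_avg T n f i))\<^sup>2 < A"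
    using T_pos by (subst (asm) ennreal_less_iff) auto
  then have "(norm (lagged_avg T n f i))\<^sup>2 \<le> A * real n / T"
    using T_pos n by (simp add: field_simps)
  then show ?thesis by (rule real_le_rsqrt)
qed

lemma grid_bounds:
  assumes "n > 0"
  shows "0 \<le> grid T n i" "grid T n i \<le> grid T n (Suc i)" "i \<le> n \<Longrightarrow> grid T n i \<le> T"
proof -
  show "0 \<le> grid T n i" using T_pos by (simp add: grid_def)
  show "grid T n i \<le> grid T n (Suc i)"
    unfolding grid_def using T_pos by (intro divide_right_mono mult_right_mono) auto
  assume "i \<le> n"
  then have "real i * T \<le> real n * T" using T_pos by (intro mult_right_mono) auto
  then show "grid T n i \<le> T" using assms by (simp add: grid_def divide_le_eq mult.commute)
qed

text \<open>The averages are bounded only almost surely, whereas \<open>simple_integrand\<close>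
  asks for a bound on all of \<open>space M\<close>. Truncation at the deterministic level
  \<open>C k\<close> restores the bound, keeps adaptedness, and changes the averages on a null set
  only.\<close>

lemma simple_approximation:
  assumes a: "a \<in> admissible M F T"
  obtains \<xi> where "\<And>k. simple_integrand M F T (Suc k) (grid T (Suc k)) (\<xi> k)"
    "AE w in M. \<forall>k i. \<xi> k i w = lagged_avg T (Suc k) (clipped T a w) i"
proof -
  from admissible_bound[OF a] obtain A where A:
    "A > 0" "AE w in M. L2fun (clipped T a w) \<and> sq_norm (clipped T a w) < ennreal A"
    by blast
  have pm: "progressively_measurable F T a" using a by (simp add: admissible_def)
  define C where "C k = sqrt (A * real (Suc k) / T)" for k
  define v where "v k i w = lagged_avg T (Suc k) (clipped T a w) i" for k i w
  define \<xi> where "\<xi> k i w = (if norm (v k i w) \<le> C k then v k i w else 0)" for k i w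
  show ?thesis
  proof (rule that[of \<xi>])
    fix k
    have "\<xi> k i \<in> borel_measurable (F (grid T (Suc k) i))" if "i < Suc k" for i
    proof -
      have [measurable]: "v k i \<in> borel_measurable (F (grid T (Suc k) i))"
        unfolding v_def by (rule lagged_avg_adapted[OF pm]) (use that in auto)
      show ?thesis unfolding \<xi>_def by measurable
    qed
    moreover have "norm (\<xi> k i w) \<le> C k" for i w
      using A(1) T_pos by (simp add: \<xi>_def C_def)
    ultimately show "simple_integrand M F T (Suc k) (grid T (Suc k)) (\<xi> k)"
      unfolding simple_integrand_def using grid_bounds[of "Suc k"] by auto
  next
    show "AE w in M. \<forall>k i. \<xi> k i w = lagged_avg T (Suc k) (clipped T a w) i"
      using A(2)
    proof eventually_elim
      case (elim w)
      then have "norm (v k i w) \<le> C k" for k i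
        unfolding v_def C_def by (intro lagged_avg_norm_le) auto
      then show ?case by (simp add: \<xi>_def v_def)
    qed
  qed
qed

lemma simple_process_outside:
  assumes si: "simple_integrand M F T n \<tau> \<xi>" and s: "s \<notin> {0..T}"
  shows "simple_process n \<tau> \<xi> s w = 0"
  unfolding simple_process_def
proof (rule sum.neutral, intro ballI)
  fix i assume "i \<in> {..<n}"
  then have "0 \<le> \<tau> i" "\<tau> (Suc i) \<le> T" using simple_grid[OF si, of i "Suc i"] by auto
  with s have "s \<notin> {\<tau> i<..\<tau> (Suc i)}" by auto
  then show "indicat_real {\<tau> i<..\<tau> (Suc i)} s *\<^sub>R \<xi> i w = 0" by simp
qed

lemma simple_process_measurable:
  assumes si: "simple_integrand M F T n \<tau> \<xi>"
  shows "(\<lambda>(w, s). simple_process n \<tau> \<xi> s w) \<in> borel_measurable (M \<Otimes>\<^sub>M borel)"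
proof -
  have [measurable]: "\<xi> i \<in> borel_measurable M" if "i < n" for i
    using si simple_grid[OF si, of i n] that
    by (intro measurable_F_M[of "\<xi> i" "\<tau> i"]) (auto simp: simple_integrand_def)
  show ?thesis
    unfolding simple_process_def case_prod_beta
    by (intro borel_measurable_sum borel_measurable_scaleR) auto
qed

lemma simple_integral_measurable:
  assumes si: "simple_integrand M F T n \<tau> \<xi>"
  shows "simple_integral B n \<tau> \<xi> \<in> borel_measurable M"
proof -
  have "(\<lambda>w. \<xi> i w \<bullet> (B (\<tau> (Suc i)) w - B (\<tau> i) w)) \<in> borel_measurable M" if "i < n" for i
  proof -
    have t: "0 \<le> \<tau> i" "\<tau> i \<le> \<tau> (Suc i)" "\<tau> (Suc i) \<le> T" using simple_grid[OF si, of i "Suc i"] that by auto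
    have "\<xi> i \<in> borel_measurable (F (\<tau> i))" using si that by (simp add: simple_integrand_def)
    from measurable_F_M[OF borel_measurable_inner_increment[OF t(1,2) order_refl t(3) this]] t
    show ?thesis by simp
  qed
  then show ?thesis
    unfolding simple_integral_def[abs_def] by (intro borel_measurable_sum) auto
qed

text \<open>The two step integrands are juxtaposed over a sum type, the second with a minus sign,
  and form one \<open>elementary\<close> family.\<close>

theorem simple_integral_diff_isometry:
  assumes x: "simple_integrand M F T n \<tau> \<xi>" and e: "simple_integrand M F T n' \<tau>' \<eta>"
  shows "mean_square M (\<lambda>w. simple_integral B n \<tau> \<xi> w - simple_integral B n' \<tau>' \<eta> w)
    = (\<integral>\<^sup>+w. sq_norm (\<lambda>s. simple_process n \<tau> \<xi> s w - simple_process n' \<tau>' \<eta> s w) \<partial>M)"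
proof -
  let ?J = "{..<n} <+> {..<n'}"
  let ?lo = "case_sum \<tau> \<tau>'" and ?hi = "case_sum (\<lambda>i. \<tau> (Suc i)) (\<lambda>i. \<tau>' (Suc i))"
  let ?z = "case_sum \<xi> (\<lambda>i w. - \<eta> i w)"
  obtain C where C: "\<forall>i<n. \<forall>w\<in>space M. norm (\<xi> i w) \<le> C" using x by (auto simp: simple_integrand_def)
  obtain D where D: "\<forall>i<n'. \<forall>w\<in>space M. norm (\<eta> i w) \<le> D" using e by (auto simp: simple_integrand_def)
  have "elementary ?J ?lo ?hi ?z"
    unfolding elementary_def
  proof (intro conjI)
    show "\<forall>j\<in>?J. 0 \<le> ?lo j \<and> ?lo j \<le> ?hi j \<and> ?hi j \<le> T \<and> ?z j \<in> borel_measurable (F (?lo j))"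
    proof
      fix j assume "j \<in> ?J"
      then show "0 \<le> ?lo j \<and> ?lo j \<le> ?hi j \<and> ?hi j \<le> T \<and> ?z j \<in> borel_measurable (F (?lo j))"
      proof (elim PlusE)
        fix i assume "i \<in> {..<n}" "j = Inl i"
        then show ?thesis
          using simple_grid[OF x, of i "Suc i"] x by (simp add: simple_integrand_def)
      next
        fix i assume "i \<in> {..<n'}" "j = Inr i"
        then show ?thesis
          using simple_grid[OF e, of i "Suc i"] e by (simp add: simple_integrand_def)
      qed
    qed
    show "\<exists>C. \<forall>j\<in>?J. \<forall>w\<in>space M. norm (?z j w) \<le> C"
      using C D by (intro exI[of _ "max C D"]) (auto simp: le_max_iff_disj)
  qed simp
  note iso = elementary_isometry[OF this]
  have 1: "(\<Sum>j\<in>?J. ?z j w \<bullet> (B (?hi j) w - B (?lo j) w)) = simple_integral B n \<tau> \<xi> w - simple_integral B n' \<tau>' \<eta> w" for w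
    by (simp add: sum.Plus simple_integral_def sum_negf)
  have 2: "(\<Sum>j\<in>?J. indicator {?lo j<..?hi j} s *\<^sub>R ?z j w) = simple_process n \<tau> \<xi> s w - simple_process n' \<tau>' \<eta> s w" for s w
    by (simp only: sum.Plus finite_lessThan sum.case simple_process_def scaleR_minus_right sum_negf diff_conv_add_uminus o_def)
  show ?thesis using iso unfolding 1 2 .
qed

end

text \<open>Completeness of L2. Nonnegativity of the variance of \<open>norm (X i w - X j w)\<close>
  turns the Cauchy property into one in L1, which yields an almost surely convergent subsequence;
  Fatou's lemma then gives convergence in mean square of the full sequence.\<close>

lemma (in prob_space) L2_cauchy_convergent:
  fixes X :: "nat \<Rightarrow> 'a \<Rightarrow> real"
  assumes m [measurable]: "\<And>k. X k \<in> borel_measurable M"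
    and fin: "\<And>k. mean_square M (X k) < \<infinity>"
    and cauchy: "\<And>e::real. e > 0 \<Longrightarrow> \<exists>N. \<forall>i\<ge>N. \<forall>j\<ge>N. mean_square M (\<lambda>w. X i w - X j w) < ennreal e"
  obtains Y where "Y \<in> borel_measurable M" "(\<lambda>k. mean_square M (\<lambda>w. X k w - Y w)) \<longlonglongrightarrow> 0"
proof -
  have sq: "integrable M (\<lambda>w. (X k w)\<^sup>2)" for k
    using fin[of k] by (intro integrableI_bounded) auto
  have int: "integrable M (X k)" for k
    by (rule square_integrable_imp_integrable[OF m sq])
  have sqd: "integrable M (\<lambda>w. (X i w - X j w)\<^sup>2)" for i j
  proof (rule Bochner_Integration.integrable_bound)
    show "integrable M (\<lambda>w. 2 * (X i w)\<^sup>2 + 2 * (X j w)\<^sup>2)" using sq by auto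
    have "(x - y)\<^sup>2 \<le> 2 * x\<^sup>2 + 2 * y\<^sup>2" for x y :: real
      using power2_norm_diff_le[of x y 0] by simp
    then show "AE w in M. norm ((X i w - X j w)\<^sup>2) \<le> norm (2 * (X i w)\<^sup>2 + 2 * (X j w)\<^sup>2)"
      by (intro AE_I2) simp
  qed measurable
  have L1: "\<exists>N. \<forall>i\<ge>N. \<forall>j\<ge>N. expectation (\<lambda>w. norm (X i w - X j w)) < e" if "e > 0" for e :: real
  proof -
    from cauchy[of "e\<^sup>2"] that obtain N where N: "\<And>i j. i \<ge> N \<Longrightarrow> j \<ge> N \<Longrightarrow> mean_square M (\<lambda>w. X i w - X j w) < ennreal (e\<^sup>2)"
      by auto
    have "expectation (\<lambda>w. norm (X i w - X j w)) < e" if ij: "i \<ge> N" "j \<ge> N" for i j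
    proof -
      let ?Z = "\<lambda>w. norm (X i w - X j w)"
      have iZ: "integrable M ?Z" using int by auto
      have sqZ: "integrable M (\<lambda>w. (?Z w)\<^sup>2)" using sqd by simp
      have "0 \<le> variance ?Z" by (rule variance_positive)
      then have "(expectation ?Z)\<^sup>2 \<le> expectation (\<lambda>w. (?Z w)\<^sup>2)"
        unfolding variance_eq[OF iZ sqZ] by (rule diff_ge_0_iff_ge[THEN iffD1])
      also have "ennreal (expectation (\<lambda>w. (?Z w)\<^sup>2)) < ennreal (e\<^sup>2)"
        using N[OF ij] nn_integral_eq_integral[OF sqZ] by simp
      then have "expectation (\<lambda>w. (?Z w)\<^sup>2) < e\<^sup>2" by (subst (asm) ennreal_less_iff) auto
      finally show ?thesis using \<open>e > 0\<close> by (simp add: power_less_imp_less_base)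
    qed
    then show ?thesis by blast
  qed
  obtain r where r: "strict_mono r" and ae: "AE w in M. Cauchy (\<lambda>i. X (r i) w)"
    using cauchy_L1_AE_cauchy_subseq[of M X, OF int L1] by blast
  define Y where "Y w = lim (\<lambda>i. X (r i) w)" for w
  have Y [measurable]: "Y \<in> borel_measurable M"
    unfolding Y_def by measurable
  have lim: "AE w in M. (\<lambda>i. X (r i) w) \<longlonglongrightarrow> Y w"
    using ae by eventually_elim (simp add: Y_def Cauchy_convergent_iff convergent_LIMSEQ_iff)
  have "(\<lambda>k. mean_square M (\<lambda>w. X k w - Y w)) \<longlonglongrightarrow> 0"
  proof (rule tendsto_0_ennrealI)
    fix e :: real assume "e > 0"
    then obtain N where N: "\<And>i j. i \<ge> N \<Longrightarrow> j \<ge> N \<Longrightarrow> mean_square M (\<lambda>w. X i w - X j w) < ennreal (e / 2)"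
      using cauchy[of "e / 2"] by auto
    have "mean_square M (\<lambda>w. X k w - Y w) < ennreal e" if k: "k \<ge> N" for k
    proof -
      have "mean_square M (\<lambda>w. X k w - Y w) = (\<integral>\<^sup>+w. liminf (\<lambda>i. ennreal ((X k w - X (r i) w)\<^sup>2)) \<partial>M)"
      proof (rule nn_integral_cong_AE)
        show "AE w in M. ennreal ((X k w - Y w)\<^sup>2) = liminf (\<lambda>i. ennreal ((X k w - X (r i) w)\<^sup>2))"
          using lim
        proof eventually_elim
          case (elim w)
          then have "(\<lambda>i. ennreal ((X k w - X (r i) w)\<^sup>2)) \<longlonglongrightarrow> ennreal ((X k w - Y w)\<^sup>2)"
            by (intro tendsto_ennrealI tendsto_intros)
          from lim_imp_Liminf[OF _ this] show ?case by simp
        qed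
      qed
      also have "\<dots> \<le> liminf (\<lambda>i. mean_square M (\<lambda>w. X k w - X (r i) w))"
        by (rule nn_integral_liminf) measurable
      also have "\<dots> \<le> ennreal (e / 2)"
      proof -
        have "\<forall>\<^sub>F i in sequentially. mean_square M (\<lambda>w. X k w - X (r i) w) \<le> ennreal (e / 2)"
          unfolding eventually_sequentially
          using N[OF k] seq_suble[OF r] by (meson order_trans less_imp_le)
        from Liminf_mono[OF this] show ?thesis by (simp add: Liminf_const)
      qed
      also have "\<dots> < ennreal e" using \<open>e > 0\<close> by (intro ennreal_lessI) auto
      finally show ?thesis .
    qed
    then show "\<forall>\<^sub>F k in sequentially. mean_square M (\<lambda>w. X k w - Y w) < ennreal e"
      by (auto simp: eventually_sequentially)
  qed
  with Y that show ?thesis by blast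
qed

lemma nn_integral_real_square_triangle:
  fixes X Y Z :: "'a \<Rightarrow> real"
  assumes [measurable]: "X \<in> borel_measurable M" "Y \<in> borel_measurable M" "Z \<in> borel_measurable M"
  shows "mean_square M (\<lambda>w. X w - Z w)
    \<le> 2 * mean_square M (\<lambda>w. X w - Y w) + 2 * mean_square M (\<lambda>w. Y w - Z w)"
proof -
  have "mean_square M (\<lambda>w. X w - Z w)
      \<le> (\<integral>\<^sup>+w. 2 * ennreal ((X w - Y w)\<^sup>2) + 2 * ennreal ((Y w - Z w)\<^sup>2) \<partial>M)"
    by (intro nn_integral_mono) (use ennreal_power2_norm_diff_le[where 'b=real] in simp)
  also have "\<dots> = 2 * mean_square M (\<lambda>w. X w - Y w) + 2 * mean_square M (\<lambda>w. Y w - Z w)"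
    by (simp add: nn_integral_add nn_integral_cmult)
  finally show ?thesis .
qed

section \<open>Existence and uniqueness of the integral\<close>

context brownian_filtration
begin

definition approx_error :: "nat \<Rightarrow> (nat \<Rightarrow> real) \<Rightarrow> (nat \<Rightarrow> 'a \<Rightarrow> real ^ 'd) \<Rightarrow> (real \<Rightarrow> 'a \<Rightarrow> real ^ 'd) \<Rightarrow> ennreal" where
  "approx_error n \<tau> \<xi> a = (\<integral>\<^sup>+ w. sq_norm (\<lambda>s. simple_process n \<tau> \<xi> s w - clipped T a w s) \<partial>M)"

lemma approx_error_eq:
  assumes si: "simple_integrand M F T n \<tau> \<xi>"
  shows "(\<integral>\<^sup>+ w. (\<integral>\<^sup>+ s\<in>{0..T}. ennreal ((norm (simple_process n \<tau> \<xi> s w - a s w))\<^sup>2) \<partial>lborel) \<partial>M) = approx_error n \<tau> \<xi> a"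
  unfolding approx_error_def
  using simple_process_outside[OF si]
  by (intro nn_integral_cong) (auto simp: clipped_def indicator_def)

lemma clipped_jointly_measurable:
  assumes "a \<in> admissible M F T"
  shows "(\<lambda>(w, s). clipped T a w s) \<in> borel_measurable (M \<Otimes>\<^sub>M borel)"
  using measurable_compose[OF measurable_pair_swap' progressive_jointly_measurable_M[of a]] assms
  by (simp add: admissible_def case_prod_beta)

text \<open>The engine of both existence and uniqueness: by the isometry, two simple integrands
  close to the same \<open>a\<close> have integrals close in mean square, whatever their
  grids.\<close>

lemma approx_error_triangle:
  assumes a: "a \<in> admissible M F T"
    and x: "simple_integrand M F T n \<tau> \<xi>" and e: "simple_integrand M F T n' \<tau>' \<eta>"
  shows "mean_square M (\<lambda>w. simple_integral B n \<tau> \<xi> w - simple_integral B n' \<tau>' \<eta> w)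
    \<le> 2 * approx_error n \<tau> \<xi> a + 2 * approx_error n' \<tau>' \<eta> a"
proof -
  have [measurable]: "(\<lambda>(w, s). clipped T a w s) \<in> borel_measurable (M \<Otimes>\<^sub>M lborel)"
    "(\<lambda>(w, s). simple_process n \<tau> \<xi> s w) \<in> borel_measurable (M \<Otimes>\<^sub>M lborel)"
    "(\<lambda>(w, s). simple_process n' \<tau>' \<eta> s w) \<in> borel_measurable (M \<Otimes>\<^sub>M lborel)"
    using clipped_jointly_measurable[OF a] simple_process_measurable[OF x] simple_process_measurable[OF e] by simp_all
  let ?p = "simple_process n \<tau> \<xi>" and ?q = "simple_process n' \<tau>' \<eta>" and ?a = "clipped T a"
  have "mean_square M (\<lambda>w. simple_integral B n \<tau> \<xi> w - simple_integral B n' \<tau>' \<eta> w)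
    = (\<integral>\<^sup>+w. sq_norm (\<lambda>s. ?p s w - ?q s w) \<partial>M)"
    by (rule simple_integral_diff_isometry[OF x e])
  also have "\<dots> \<le> (\<integral>\<^sup>+w. \<integral>\<^sup>+s. 2 * ennreal ((norm (?p s w - ?a w s))\<^sup>2) + 2 * ennreal ((norm (?q s w - ?a w s))\<^sup>2) \<partial>lborel \<partial>M)"
    by (intro nn_integral_mono) (metis ennreal_power2_norm_diff_le norm_minus_commute)
  also have "\<dots> = (\<integral>\<^sup>+w. 2 * sq_norm (\<lambda>s. ?p s w - ?a w s) + 2 * sq_norm (\<lambda>s. ?q s w - ?a w s) \<partial>M)"
    by (intro nn_integral_cong) (simp add: nn_integral_add nn_integral_cmult)
  also have "\<dots> = 2 * approx_error n \<tau> \<xi> a + 2 * approx_error n' \<tau>' \<eta> a"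
    unfolding approx_error_def by (simp add: nn_integral_add nn_integral_cmult)
  finally show ?thesis .
qed

lemma simple_integral_square_integrable:
  assumes x: "simple_integrand M F T n \<tau> \<xi>"
  shows "mean_square M (\<lambda>w. simple_integral B n \<tau> \<xi> w) < \<infinity>"
proof -
  from x have "\<exists>C. \<forall>i<n. \<forall>w\<in>space M. norm (\<xi> i w) \<le> C"
    by (simp add: simple_integrand_def)
  then obtain C where C: "\<And>i w. i < n \<Longrightarrow> w \<in> space M \<Longrightarrow> norm (\<xi> i w) \<le> C"
    by blast
  have "mean_square M (\<lambda>w. simple_integral B n \<tau> \<xi> w)
      = (\<integral>\<^sup>+w. sq_norm (\<lambda>s. simple_process n \<tau> \<xi> s w) \<partial>M)"
    \<comment> \<open>Subtracting the empty integrand turns the isometry for differences into the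
      plain one.\<close>
    using simple_integral_diff_isometry[OF x, of 0 "\<lambda>_. 0" "\<lambda>_ _. 0"] T_pos
    by (simp add: simple_integrand_def simple_integral_def simple_process_def)
  also have "\<dots> \<le> (\<integral>\<^sup>+w. \<integral>\<^sup>+s. ennreal ((real n * C)\<^sup>2) * indicator {0..T} s \<partial>lborel \<partial>M)"
  proof (intro nn_integral_mono)
    fix w s assume w: "w \<in> space M"
    have "norm (simple_process n \<tau> \<xi> s w) \<le> (\<Sum>i<n. norm (indicator {\<tau> i<..\<tau> (Suc i)} s *\<^sub>R \<xi> i w))"
      unfolding simple_process_def by (rule norm_sum)
    also have "\<dots> \<le> (\<Sum>i<n. C)"
      using C[OF _ w] by (intro sum_mono) (auto simp: indicator_def intro: order_trans[OF norm_ge_zero])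
    finally have "norm (simple_process n \<tau> \<xi> s w) \<le> real n * C" by simp
    from power_mono[OF this, of 2] show "ennreal ((norm (simple_process n \<tau> \<xi> s w))\<^sup>2) \<le> ennreal ((real n * C)\<^sup>2) * indicator {0..T} s"
      using simple_process_outside[OF x, of s w] by (cases "s \<in> {0..T}") (auto intro: ennreal_leI)
  qed
  also have "\<dots> < \<infinity>"
    using T_pos by (simp add: nn_integral_cmult_indicator emeasure_space_1 ennreal_mult[symmetric])
  finally show ?thesis .
qed

lemma simple_integrals_convergent:
  assumes a: "a \<in> admissible M F T" and x: "\<And>k. simple_integrand M F T (n k) (\<tau> k) (\<xi> k)"
    and lim: "(\<lambda>k. approx_error (n k) (\<tau> k) (\<xi> k) a) \<longlonglongrightarrow> 0"
  obtains I where "I \<in> borel_measurable M"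
    "(\<lambda>k. mean_square M (\<lambda>w. simple_integral B (n k) (\<tau> k) (\<xi> k) w - I w)) \<longlonglongrightarrow> 0"
proof (rule L2_cauchy_convergent[of "\<lambda>k. simple_integral B (n k) (\<tau> k) (\<xi> k)"])
  fix e :: real assume "e > 0"
  then have "0 < ennreal (e / 4)" by simp
  from order_tendstoD(2)[OF lim this] obtain N where N: "\<And>k. k \<ge> N \<Longrightarrow> approx_error (n k) (\<tau> k) (\<xi> k) a < ennreal (e / 4)"
    by (auto simp: eventually_sequentially)
  have "mean_square M (\<lambda>w. simple_integral B (n i) (\<tau> i) (\<xi> i) w - simple_integral B (n j) (\<tau> j) (\<xi> j) w) < ennreal e"
    if ij: "i \<ge> N" "j \<ge> N" for i j
  proof -
    have "mean_square M (\<lambda>w. simple_integral B (n i) (\<tau> i) (\<xi> i) w - simple_integral B (n j) (\<tau> j) (\<xi> j) w)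
        \<le> 2 * approx_error (n i) (\<tau> i) (\<xi> i) a + 2 * approx_error (n j) (\<tau> j) (\<xi> j) a"
      by (rule approx_error_triangle[OF a x x])
    also have "\<dots> < 2 * ennreal (e / 4) + 2 * ennreal (e / 4)"
      using N[OF ij(1)] N[OF ij(2)] by (intro add_strict_mono ennreal_mult_strict_left_mono) auto
    also have "\<dots> = ennreal e"
      using \<open>e > 0\<close> ennreal_mult[of 2 "e / 4"] ennreal_plus[of "e/2" "e/2"] by (simp del: ennreal_plus)
    finally show ?thesis .
  qed
  then show "\<exists>N. \<forall>i\<ge>N. \<forall>j\<ge>N. mean_square M (\<lambda>w. simple_integral B (n i) (\<tau> i) (\<xi> i) w - simple_integral B (n j) (\<tau> j) (\<xi> j) w) < ennreal e"
    by blast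
qed (use x simple_integral_measurable simple_integral_square_integrable that in blast)+

lemma simple_process_eq_lagged_step:
  assumes "\<forall>i. \<xi> i w = lagged_avg T n f i"
  shows "simple_process n (grid T n) \<xi> s w = lagged_step T n f s"
  using assms by (simp only: simple_process_def lagged_step_def grid_def)

text \<open>Dominated convergence over the sample space: along almost every path the averages
  converge, and by contraction the error is at most \<open>4 * A\<close>, with \<open>A\<close> the
  bound from admissibility.\<close>

lemma lagged_approx_error:
  assumes a: "a \<in> admissible M F T"
    and x: "\<And>k. simple_integrand M F T (Suc k) (grid T (Suc k)) (\<xi> k)"
    and eq: "AE w in M. \<forall>k i. \<xi> k i w = lagged_avg T (Suc k) (clipped T a w) i"
  shows "(\<lambda>k. approx_error (Suc k) (grid T (Suc k)) (\<xi> k) a) \<longlonglongrightarrow> 0"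
proof -
  from admissible_bound[OF a] obtain A where A:
    "A > 0" "AE w in M. L2fun (clipped T a w) \<and> sq_norm (clipped T a w) < ennreal A"
    by blast
  have [measurable]: "(\<lambda>(w, s). clipped T a w s) \<in> borel_measurable (M \<Otimes>\<^sub>M lborel)"
    using clipped_jointly_measurable[OF a] by simp
  have [measurable]: "(\<lambda>(w, s). simple_process (Suc k) (grid T (Suc k)) (\<xi> k) s w) \<in> borel_measurable (M \<Otimes>\<^sub>M lborel)" for k
    using simple_process_measurable[OF x[of k]] by simp
  let ?u = "\<lambda>k w. sq_norm (\<lambda>s. simple_process (Suc k) (grid T (Suc k)) (\<xi> k) s w - clipped T a w s)"
  have "(\<lambda>k. \<integral>\<^sup>+w. ?u k w \<partial>M) \<longlonglongrightarrow> (\<integral>\<^sup>+w. 0 \<partial>M)"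
  proof (rule nn_integral_dominated_convergence[where w="\<lambda>_. 4 * ennreal A"])
    show "(\<integral>\<^sup>+w. 4 * ennreal A \<partial>M) < \<infinity>"
      by (simp add: emeasure_space_1 ennreal_mult_less_top)
    show "AE w in M. (\<lambda>k. ?u k w) \<longlonglongrightarrow> 0"
      using A(2) eq
    proof eventually_elim
      case (elim w)
      then have "?u k w = sq_norm (\<lambda>s. lagged_step T (Suc k) (clipped T a w) s - clipped T a w s)" for k
        by (subst simple_process_eq_lagged_step[of "\<xi> k" w "Suc k" "clipped T a w"]) auto
      then show ?case
        using lagged_step_tendsto[OF T_pos, of "clipped T a w"] elim by (simp add: clipped_def)
    qed
    show "AE w in M. ?u k w \<le> 4 * ennreal A" for k
      using A(2) eq
    proof eventually_elim
      case (elim w)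
      let ?f = "clipped T a w" and ?P = "lagged_step T (Suc k) (clipped T a w)"
      have f: "L2fun ?f" and fA: "sq_norm ?f \<le> ennreal A" using elim by auto
      note [measurable] = L2fun_measurable[OF f]
      have "?u k w = sq_norm (\<lambda>s. ?P s - ?f s)"
        using elim by (subst simple_process_eq_lagged_step[of "\<xi> k" w "Suc k" "clipped T a w"]) auto
      also have "\<dots> \<le> (\<integral>\<^sup>+ s. 2 * ennreal ((norm (?P s))\<^sup>2) + 2 * ennreal ((norm (?f s))\<^sup>2) \<partial>lborel)"
        by (intro nn_integral_mono) (use ennreal_power2_norm_diff_le[of _ _ 0] in simp)
      also have "\<dots> = 2 * sq_norm ?P + 2 * sq_norm ?f"
        by (simp add: nn_integral_add nn_integral_cmult)
      also have "\<dots> \<le> 2 * ennreal A + 2 * ennreal A"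
        using order_trans[OF nn_integral_lagged_step_le[OF f T_pos] fA, of "Suc k"] fA
        by (intro add_mono mult_left_mono) auto
      also have "\<dots> = 4 * ennreal A" by (simp flip: distrib_right)
      finally show ?case .
    qed
  qed measurable
  then show ?thesis by (simp add: approx_error_def)
qed

text \<open>Supplies the witness that the choice in \<open>ito_integral\<close> requires.\<close>

theorem ito_integral_is_ito_integral:
  assumes a: "a \<in> admissible M F T"
  shows "is_ito_integral M F B T a (ito_integral M F B T a)"
proof -
  from simple_approximation[OF a] obtain \<xi> where x: "\<And>k. simple_integrand M F T (Suc k) (grid T (Suc k)) (\<xi> k)"
    and eq: "AE w in M. \<forall>k i. \<xi> k i w = lagged_avg T (Suc k) (clipped T a w) i"
    by blast
  note lim = lagged_approx_error[OF a x eq]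
  from simple_integrals_convergent[OF a x lim] obtain I where
    "I \<in> borel_measurable M"
    "(\<lambda>k. mean_square M (\<lambda>w. simple_integral B (Suc k) (grid T (Suc k)) (\<xi> k) w - I w)) \<longlonglongrightarrow> 0"
    by blast
  with x lim have "is_ito_integral M F B T a I"
    unfolding is_ito_integral_def
    by (intro conjI exI[of _ Suc] exI[of _ "\<lambda>k. grid T (Suc k)"] exI[of _ \<xi>]) (simp_all add: approx_error_eq)
  then show ?thesis unfolding ito_integral_def by (rule someI[of "is_ito_integral M F B T a"])
qed

abbreviation "Ito \<equiv> ito_integral M F B T"

lemma ito_integral_measurable: "a \<in> admissible M F T \<Longrightarrow> Ito a \<in> borel_measurable M"
  using ito_integral_is_ito_integral by (simp add: is_ito_integral_def)

text \<open>The chosen version comes with some approximating sequence of its own.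
  \<open>approx_error_triangle\<close> compares that sequence with the given one term by term, so
  every approximation of \<open>a\<close> leads to the same limit.\<close>

theorem simple_integrals_tendsto_ito_integral:
  assumes a: "a \<in> admissible M F T" and x: "\<And>k. simple_integrand M F T (n k) (\<tau> k) (\<xi> k)"
    and lim: "(\<lambda>k. approx_error (n k) (\<tau> k) (\<xi> k) a) \<longlonglongrightarrow> 0"
  shows "(\<lambda>k. mean_square M (\<lambda>w. simple_integral B (n k) (\<tau> k) (\<xi> k) w - Ito a w)) \<longlonglongrightarrow> 0"
    (is "?D \<longlonglongrightarrow> 0")
proof -
  from ito_integral_is_ito_integral[OF a] obtain n' \<tau>' \<eta> where e: "\<And>k. simple_integrand M F T (n' k) (\<tau>' k) (\<eta> k)"
    and raw: "(\<lambda>k. \<integral>\<^sup>+ w. (\<integral>\<^sup>+ s\<in>{0..T}. ennreal ((norm (simple_process (n' k) (\<tau>' k) (\<eta> k) s w - a s w))\<^sup>2) \<partial>lborel) \<partial>M) \<longlonglongrightarrow> 0"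
    and conv: "(\<lambda>k. mean_square M (\<lambda>w. simple_integral B (n' k) (\<tau>' k) (\<eta> k) w - Ito a w)) \<longlonglongrightarrow> 0"
      (is "?E \<longlonglongrightarrow> 0")
    unfolding is_ito_integral_def by blast
  from raw have lim': "(\<lambda>k. approx_error (n' k) (\<tau>' k) (\<eta> k) a) \<longlonglongrightarrow> 0"
    by (simp only: approx_error_eq[OF e])
  show ?thesis
  proof (rule tendsto_sandwich[OF _ _ tendsto_const])
    let ?R = "\<lambda>k. 2 * (2 * approx_error (n k) (\<tau> k) (\<xi> k) a + 2 * approx_error (n' k) (\<tau>' k) (\<eta> k) a) + 2 * ?E k"
    have "?D k \<le> ?R k" for k
      by (rule order_trans[OF nn_integral_real_square_triangle[OF simple_integral_measurable[OF x[of k]] simple_integral_measurable[OF e[of k]] ito_integral_measurable[OF a]]])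
        (intro add_right_mono mult_left_mono approx_error_triangle a x e, simp)
    then show "\<forall>\<^sub>F k in sequentially. ?D k \<le> ?R k" by simp
    have "?R \<longlonglongrightarrow> 2 * (2 * 0 + 2 * 0) + 2 * 0"
      by (intro tendsto_add ennreal_tendsto_cmult lim lim' conv) auto
    then show "?R \<longlonglongrightarrow> 0" by simp
  qed simp
qed

end

section \<open>Linearity and the exponential martingale\<close>

lemma nn_integral_square_limit_unique:
  fixes X :: "nat \<Rightarrow> 'a \<Rightarrow> real"
  assumes m: "\<And>k. X k \<in> borel_measurable M" "Y \<in> borel_measurable M" "Z \<in> borel_measurable M"
    and Y: "(\<lambda>k. mean_square M (\<lambda>w. X k w - Y w)) \<longlonglongrightarrow> 0"
    and Z: "(\<lambda>k. mean_square M (\<lambda>w. X k w - Z w)) \<longlonglongrightarrow> 0"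
  shows "AE w in M. Y w = Z w"
proof -
  note [measurable] = m
  let ?d = "mean_square M (\<lambda>w. Y w - Z w)"
  let ?R = "\<lambda>k. 2 * mean_square M (\<lambda>w. X k w - Y w) + 2 * mean_square M (\<lambda>w. X k w - Z w)"
  have le: "?d \<le> ?R k" for k
    using nn_integral_real_square_triangle[OF m(2) m(1)[of k] m(3)] by (simp add: power2_commute)
  have "?R \<longlonglongrightarrow> 2 * 0 + 2 * 0"
    by (intro tendsto_add ennreal_tendsto_cmult Y Z) auto
  then have "?d \<le> 0"
    by (intro tendsto_lowerbound[where f="?R" and F=sequentially]) (use le in auto)
  then have "AE w in M. ennreal ((Y w - Z w)\<^sup>2) = 0"
    by (subst (asm) le_zero_eq, subst (asm) nn_integral_0_iff_AE) auto
  then show ?thesis by eventually_elim (simp add: ennreal_eq_0_iff)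
qed

text \<open>A bound on the second moments makes the sequence uniformly integrable.\<close>

lemma (in prob_space) nn_integral_limit_eq_1:
  fixes Z :: "nat \<Rightarrow> 'a \<Rightarrow> real"
  assumes m [measurable]: "\<And>k. Z k \<in> borel_measurable M" "Y \<in> borel_measurable M"
    and nn: "\<And>k w. 0 \<le> Z k w" "\<And>w. 0 \<le> Y w"
    and one: "\<And>k. (\<integral>\<^sup>+w. ennreal (Z k w) \<partial>M) = 1"
    and sq: "\<And>k. mean_square M (Z k) \<le> ennreal C"
    and lim: "AE w in M. (\<lambda>k. Z k w) \<longlonglongrightarrow> Y w"
  shows "(\<integral>\<^sup>+w. ennreal (Y w) \<partial>M) = 1"
proof (rule antisym)
  have "(\<integral>\<^sup>+w. ennreal (Y w) \<partial>M) = (\<integral>\<^sup>+w. liminf (\<lambda>k. ennreal (Z k w)) \<partial>M)"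
  proof (rule nn_integral_cong_AE)
    show "AE w in M. ennreal (Y w) = liminf (\<lambda>k. ennreal (Z k w))"
      using lim
    proof eventually_elim
      case (elim w)
      from lim_imp_Liminf[OF _ tendsto_ennrealI[OF this]] show ?case by simp
    qed
  qed
  also have "\<dots> \<le> liminf (\<lambda>k. \<integral>\<^sup>+w. ennreal (Z k w) \<partial>M)"
    by (rule nn_integral_liminf) measurable
  also have "\<dots> = 1" by (simp add: one Liminf_const)
  finally show "(\<integral>\<^sup>+w. ennreal (Y w) \<partial>M) \<le> 1" .
next
  \<comment> \<open>Truncation at \<open>R\<close> loses at most \<open>z\<^sup>2 / R\<close>, hence
    at most \<open>C / R\<close> in mean, uniformly in the index. The bounded part passes to the
    limit by dominated convergence, and \<open>R\<close> then grows.\<close>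
  have bound: "1 \<le> (\<integral>\<^sup>+w. ennreal (Y w) \<partial>M) + ennreal (C / R)" if R: "R > 0" for R :: real
  proof -
    have "1 \<le> (\<integral>\<^sup>+w. ennreal (min (Z k w) R) \<partial>M) + ennreal (C / R)" for k
    proof -
      have "z \<le> min z R + z\<^sup>2 / R" if "z \<ge> 0" for z :: real
      proof (cases "z \<le> R")
        case False
        then have "z * R \<le> z * z" using that R by (intro mult_left_mono) auto
        then have "z \<le> z\<^sup>2 / R" using R by (simp add: field_simps power2_eq_square)
        then show ?thesis using R False by simp
      qed (use R in simp)
      then have "ennreal (Z k w) \<le> ennreal (min (Z k w) R) + ennreal (1 / R) * ennreal ((Z k w)\<^sup>2)" for w
        using nn(1)[of k w] R by (simp add: ennreal_plus[symmetric] ennreal_mult[symmetric] ennreal_leI del: ennreal_plus)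
      then have "(\<integral>\<^sup>+w. ennreal (Z k w) \<partial>M) \<le> (\<integral>\<^sup>+w. ennreal (min (Z k w) R) + ennreal (1 / R) * ennreal ((Z k w)\<^sup>2) \<partial>M)"
        by (intro nn_integral_mono)
      also have "\<dots> = (\<integral>\<^sup>+w. ennreal (min (Z k w) R) \<partial>M) + ennreal (1 / R) * mean_square M (Z k)"
        by (simp add: nn_integral_add nn_integral_cmult)
      also have "\<dots> \<le> (\<integral>\<^sup>+w. ennreal (min (Z k w) R) \<partial>M) + ennreal (1 / R) * ennreal C"
        by (intro add_left_mono mult_left_mono sq) simp
      also have "ennreal (1 / R) * ennreal C = ennreal (C / R)"
        using R by (simp add: ennreal_mult'[symmetric])
      finally show ?thesis by (simp add: one)
    qed
    moreover have "(\<lambda>k. (\<integral>\<^sup>+w. ennreal (min (Z k w) R) \<partial>M) + ennreal (C / R)) \<longlonglongrightarrow> (\<integral>\<^sup>+w. ennreal (min (Y w) R) \<partial>M) + ennreal (C / R)"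
    proof (intro tendsto_add tendsto_const, rule nn_integral_dominated_convergence[where w="\<lambda>_. ennreal R"])
      show "AE w in M. (\<lambda>k. ennreal (min (Z k w) R)) \<longlonglongrightarrow> ennreal (min (Y w) R)"
        using lim by eventually_elim (intro tendsto_ennrealI tendsto_min tendsto_const)
    qed (auto intro!: ennreal_leI simp: emeasure_space_1)
    ultimately have "1 \<le> (\<integral>\<^sup>+w. ennreal (min (Y w) R) \<partial>M) + ennreal (C / R)"
      by (intro tendsto_lowerbound[where F=sequentially]) auto
    also have "\<dots> \<le> (\<integral>\<^sup>+w. ennreal (Y w) \<partial>M) + ennreal (C / R)"
      by (intro add_right_mono nn_integral_mono ennreal_leI) simp
    finally show ?thesis .
  qed
  have "(\<lambda>k. C / real (Suc k)) \<longlonglongrightarrow> 0"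
    using LIMSEQ_Suc[OF lim_const_over_n] .
  from tendsto_add[OF tendsto_const tendsto_ennrealI[OF this]]
  have "(\<lambda>k. (\<integral>\<^sup>+w. ennreal (Y w) \<partial>M) + ennreal (C / real (Suc k))) \<longlonglongrightarrow> (\<integral>\<^sup>+w. ennreal (Y w) \<partial>M) + ennreal 0" .
  then have "1 \<le> (\<integral>\<^sup>+w. ennreal (Y w) \<partial>M) + ennreal 0"
    by (rule tendsto_lowerbound) (use bound in auto)
  then show "1 \<le> (\<integral>\<^sup>+w. ennreal (Y w) \<partial>M)" by simp
qed

text \<open>Contraction gives the upper bound. The lower bound uses a weighted triangle inequality
  with factors \<open>1 + \<delta>\<close> and \<open>1 + 1 / \<delta>\<close>, so that the squared
  norm of the average enters with a factor close to 1.\<close>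

lemma lagged_step_norm_tendsto:
  fixes f :: "real \<Rightarrow> 'b::euclidean_space"
  assumes T: "T > 0" and f: "L2fun f" and supp: "\<And>s. s \<notin> {0..T} \<Longrightarrow> f s = 0"
  shows "(\<lambda>n. sq_norm (\<lambda>s. lagged_step T (Suc n) f s)) \<longlonglongrightarrow> sq_norm f"
    (is "?Q \<longlonglongrightarrow> ?q")
proof (rule order_tendstoI)
  note [measurable] = L2fun_measurable[OF f]
  have up: "?Q n \<le> ?q" for n by (rule nn_integral_lagged_step_le[OF f T]) simp
  then show "\<forall>\<^sub>F n in sequentially. ?Q n < b" if "?q < b" for b
    by (intro always_eventually allI order_le_less_trans[OF up that])
  fix b assume b: "b < ?q"
  have "?q \<noteq> top" using f by (simp add: L2fun_def top.not_eq_extremum)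
  then obtain q where q: "?q = ennreal q" "q \<ge> 0" by (cases ?q) auto
  from b have "b \<noteq> top" by auto
  then obtain c where c: "b = ennreal c" "c \<ge> 0" by (cases b) auto
  have cq: "c < q" using b q c by (simp add: ennreal_less_iff)
  \<comment> \<open>The gap between \<open>c\<close> and \<open>q\<close> is halved: one half pays
    for the factor \<open>1 + \<delta>\<close>, since \<open>\<delta> * q < e\<close>, the other for
    the approximation error, since \<open>(1 + 1 / \<delta>) * \<eta> = e\<close>.\<close>
  define e where "e = (q - c) / 2"
  define \<delta> where "\<delta> = e / (q + 1)"
  have e: "e > 0" and d: "\<delta> > 0" using cq q by (auto simp: e_def \<delta>_def)
  have dq: "\<delta> * q < e"
  proof -
    have "\<delta> * q < \<delta> * (q + 1)" using d by simp
    also have "\<dots> = e" using q by (simp add: \<delta>_def)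
    finally show ?thesis .
  qed
  define \<eta> where "\<eta> = e / (1 + 1 / \<delta>)"
  have h: "\<eta> > 0" using e d by (simp add: \<eta>_def add_pos_pos)
  then have "0 < ennreal \<eta>" by simp
  have "(\<lambda>n. sq_norm (\<lambda>s. lagged_step T (Suc n) f s - f s)) \<longlonglongrightarrow> 0"
    by (rule lagged_step_tendsto[OF T f]) (rule supp)
  from order_tendstoD(2)[OF this \<open>0 < ennreal \<eta>\<close>]
  show "\<forall>\<^sub>F n in sequentially. b < ?Q n"
  proof eventually_elim
    case (elim n)
    let ?d = "sq_norm (\<lambda>s. lagged_step T (Suc n) f s - f s)"
    have pt: "(norm y)\<^sup>2 \<le> (1 + \<delta>) * (norm x)\<^sup>2 + (1 + 1 / \<delta>) * (norm (x - y))\<^sup>2" for x y :: 'b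
    proof -
      have "norm y \<le> norm x + norm (x - y)" using norm_triangle_ineq4[of x "x - y"] by simp
      then have "(norm y)\<^sup>2 \<le> (norm x + norm (x - y))\<^sup>2" by (intro power_mono) auto
      moreover have "2 * norm x * norm (x - y) \<le> \<delta> * (norm x)\<^sup>2 + 1 / \<delta> * (norm (x - y))\<^sup>2"
      proof -
        have "0 \<le> (sqrt \<delta> * norm x - norm (x - y) / sqrt \<delta>)\<^sup>2" by simp
        also have "\<dots> = \<delta> * (norm x)\<^sup>2 + 1 / \<delta> * (norm (x - y))\<^sup>2 - 2 * norm x * norm (x - y)"
          using d by (simp add: power2_diff power_mult_distrib power_divide field_simps)
        finally show ?thesis by simp
      qed
      ultimately show ?thesis by (simp add: power2_sum algebra_simps)
    qed
    have "?Q n < top" using up[of n] unfolding q(1) by (rule order_le_less_trans) simp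
    then have "?Q n \<noteq> top" by simp
    then obtain Q where Q: "?Q n = ennreal Q" "Q \<ge> 0" by (cases "?Q n") auto
    have Qq: "Q \<le> q" using up[of n] Q q by (simp add: ennreal_le_iff)
    have "?d \<noteq> top" using elim by auto
    then obtain D where D: "?d = ennreal D" "D \<ge> 0" by (cases "?d") auto
    have D\<eta>: "D < \<eta>" using elim D by (simp add: ennreal_less_iff)
    have "?q \<le> (\<integral>\<^sup>+s. ennreal (1 + \<delta>) * ennreal ((norm (lagged_step T (Suc n) f s))\<^sup>2)
        + ennreal (1 + 1 / \<delta>) * ennreal ((norm (lagged_step T (Suc n) f s - f s))\<^sup>2) \<partial>lborel)"
    proof (intro nn_integral_mono)
      fix s
      have "ennreal ((norm (f s))\<^sup>2) \<le> ennreal ((1 + \<delta>) * (norm (lagged_step T (Suc n) f s))\<^sup>2 + (1 + 1 / \<delta>) * (norm (lagged_step T (Suc n) f s - f s))\<^sup>2)"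
        by (intro ennreal_leI pt)
      also have "\<dots> = ennreal (1 + \<delta>) * ennreal ((norm (lagged_step T (Suc n) f s))\<^sup>2) + ennreal (1 + 1 / \<delta>) * ennreal ((norm (lagged_step T (Suc n) f s - f s))\<^sup>2)"
        using d by (subst ennreal_plus) (auto simp: ennreal_mult simp del: ennreal_plus)
      finally show "ennreal ((norm (f s))\<^sup>2) \<le> ennreal (1 + \<delta>) * ennreal ((norm (lagged_step T (Suc n) f s))\<^sup>2) + ennreal (1 + 1 / \<delta>) * ennreal ((norm (lagged_step T (Suc n) f s - f s))\<^sup>2)" .
    qed
    also have "\<dots> = ennreal (1 + \<delta>) * ennreal Q + ennreal (1 + 1 / \<delta>) * ennreal D"
      by (simp add: nn_integral_add nn_integral_cmult Q D del: ennreal_plus)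
    also have "\<dots> = ennreal ((1 + \<delta>) * Q + (1 + 1 / \<delta>) * D)"
      using d Q(2) D(2) by (subst (3) ennreal_plus) (auto simp: ennreal_mult simp del: ennreal_plus)
    finally have "q \<le> (1 + \<delta>) * Q + (1 + 1 / \<delta>) * D"
      unfolding q using d Q(2) D(2) by (subst (asm) ennreal_le_iff) auto
    moreover have "\<delta> * Q \<le> \<delta> * q" using d Qq by (intro mult_left_mono) auto
    moreover have "(1 + 1 / \<delta>) * D < e"
    proof -
      have p: "1 + 1 / \<delta> > 0" using d by (simp add: add_pos_pos)
      then have "(1 + 1 / \<delta>) * D < (1 + 1 / \<delta>) * \<eta>" using D\<eta> by (intro mult_strict_left_mono)
      also have "\<dots> = e" using p by (simp add: \<eta>_def)
      finally show ?thesis .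
    qed
    ultimately have "q < Q + 2 * e" using dq by (simp add: algebra_simps)
    moreover have "2 * e = q - c" by (simp add: e_def)
    ultimately have "c < Q" by linarith
    then show ?case using Q c by (simp add: ennreal_less_iff)
  qed
qed

context brownian_filtration
begin

text \<open>The step integral with untruncated averages: a truncation level depends on the integrand
  and would destroy linearity. Almost surely it equals the truncated integral of
  \<open>simple_approximation\<close>.\<close>

definition lagged_integral :: "nat \<Rightarrow> (real \<Rightarrow> 'a \<Rightarrow> real ^ 'd) \<Rightarrow> 'a \<Rightarrow> real" where
  "lagged_integral k a w = (\<Sum>i<Suc k. lagged_avg T (Suc k) (clipped T a w) i
     \<bullet> (B (grid T (Suc k) (Suc i)) w - B (grid T (Suc k) i) w))"

lemma lagged_integral_measurable:
  assumes "a \<in> admissible M F T"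
  shows "lagged_integral k a \<in> borel_measurable M"
proof -
  have "(\<lambda>w. lagged_avg T (Suc k) (clipped T a w) i \<bullet> (B (grid T (Suc k) (Suc i)) w - B (grid T (Suc k) i) w)) \<in> borel_measurable M"
    if "i < Suc k" for i
  proof -
    have t: "0 \<le> grid T (Suc k) i" "grid T (Suc k) i \<le> grid T (Suc k) (Suc i)" "grid T (Suc k) (Suc i) \<le> T"
      using grid_bounds[of "Suc k"] that by auto
    have "(\<lambda>w. lagged_avg T (Suc k) (clipped T a w) i) \<in> borel_measurable (F (grid T (Suc k) i))"
      using assms that by (intro lagged_avg_adapted) (auto simp: admissible_def)
    from measurable_F_M[OF borel_measurable_inner_increment[OF t(1,2) order_refl t(3) this]] t
    show ?thesis by simp
  qed
  then show ?thesis
    unfolding lagged_integral_def[abs_def] by (intro borel_measurable_sum) auto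
qed

theorem lagged_integral_tendsto:
  assumes a: "a \<in> admissible M F T"
  shows "(\<lambda>k. mean_square M (\<lambda>w. lagged_integral k a w - Ito a w)) \<longlonglongrightarrow> 0"
proof -
  from simple_approximation[OF a] obtain \<xi> where x: "\<And>k. simple_integrand M F T (Suc k) (grid T (Suc k)) (\<xi> k)"
    and eq: "AE w in M. \<forall>k i. \<xi> k i w = lagged_avg T (Suc k) (clipped T a w) i"
    by blast
  have "mean_square M (\<lambda>w. lagged_integral k a w - Ito a w)
      = mean_square M (\<lambda>w. simple_integral B (Suc k) (grid T (Suc k)) (\<xi> k) w - Ito a w)" for k
    using eq by (intro nn_integral_cong_AE, eventually_elim) (simp only: simple_integral_def lagged_integral_def)
  then show ?thesis
    using simple_integrals_tendsto_ito_integral[OF a x lagged_approx_error[OF a x eq]] by simp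
qed

lemma admissible_linear:
  assumes a: "a \<in> admissible M F T" and L: "bounded_linear L"
  shows "(\<lambda>s w. L (a s w)) \<in> admissible M F T"
proof -
  have [measurable]: "L \<in> borel_measurable borel"
    using L by (intro borel_measurable_continuous_onI linear_continuous_on)
  have "progressively_measurable F T a" using a by (simp add: admissible_def)
  then have pm: "progressively_measurable F T (\<lambda>s w. L (a s w))"
    unfolding progressively_measurable_def
    using measurable_compose[of "\<lambda>(s, w). a s w" _ borel L borel] by (auto simp: case_prod_beta)
  from admissible_bound[OF a] obtain A where A:
    "A > 0" "AE w in M. L2fun (clipped T a w) \<and> sq_norm (clipped T a w) < ennreal A"
    by blast
  obtain K where K: "K > 0" "\<And>x. norm (L x) \<le> norm x * K"
    using bounded_linear.pos_bounded[OF L] by blast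
  \<comment> \<open>The bound in \<open>admissible\<close> is strict, hence the added 1.\<close>
  have "AE w in M. (\<integral>\<^sup>+ s\<in>{0..T}. ennreal ((norm (L (a s w)))\<^sup>2) \<partial>lborel) < ennreal (K\<^sup>2 * A + 1)"
    using A(2)
  proof eventually_elim
    case (elim w)
    then have f: "L2fun (clipped T a w)" by simp
    note [measurable] = L2fun_measurable[OF f]
    have "(\<integral>\<^sup>+ s\<in>{0..T}. ennreal ((norm (L (a s w)))\<^sup>2) \<partial>lborel) \<le> (\<integral>\<^sup>+ s. ennreal (K\<^sup>2) * ennreal ((norm (clipped T a w s))\<^sup>2) \<partial>lborel)"
    proof (intro nn_integral_mono)
      fix s
      have "(norm (L (a s w)))\<^sup>2 \<le> K\<^sup>2 * (norm (a s w))\<^sup>2"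
        using power_mono[OF K(2)[of "a s w"], of 2] by (simp add: power_mult_distrib mult.commute)
      from ennreal_leI[OF this]
      show "ennreal ((norm (L (a s w)))\<^sup>2) * indicator {0..T} s \<le> ennreal (K\<^sup>2) * ennreal ((norm (clipped T a w s))\<^sup>2)"
        by (auto simp: clipped_def indicator_def ennreal_mult)
    qed
    also have "\<dots> = ennreal (K\<^sup>2) * sq_norm (clipped T a w)"
      by (rule nn_integral_cmult) measurable
    also have "\<dots> \<le> ennreal (K\<^sup>2) * ennreal A" using elim by (intro mult_left_mono) auto
    also have "\<dots> = ennreal (K\<^sup>2 * A)" using A(1) by (simp add: ennreal_mult)
    also have "\<dots> < ennreal (K\<^sup>2 * A + 1)" using A(1) by (intro ennreal_lessI) (auto intro!: add_nonneg_pos)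
    finally show ?case .
  qed
  moreover have "K\<^sup>2 * A + 1 > 0" using A(1) by (auto intro!: add_nonneg_pos)
  ultimately show ?thesis using pm unfolding admissible_def by blast
qed

lemma admissible_add:
  assumes a: "a \<in> admissible M F T" and b: "b \<in> admissible M F T"
  shows "(\<lambda>s w. a s w + b s w) \<in> admissible M F T"
proof -
  have "progressively_measurable F T a" "progressively_measurable F T b" using a b by (auto simp: admissible_def)
  then have pm: "progressively_measurable F T (\<lambda>s w. a s w + b s w)"
    unfolding progressively_measurable_def case_prod_beta by (intro ballI borel_measurable_add) auto
  from admissible_bound[OF a] obtain A where A:
    "A > 0" "AE w in M. L2fun (clipped T a w) \<and> sq_norm (clipped T a w) < ennreal A"
    by blast
  from admissible_bound[OF b] obtain A' where A':
    "A' > 0" "AE w in M. L2fun (clipped T b w) \<and> sq_norm (clipped T b w) < ennreal A'"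
    by blast
  have "AE w in M. (\<integral>\<^sup>+ s\<in>{0..T}. ennreal ((norm (a s w + b s w))\<^sup>2) \<partial>lborel) < ennreal (2 * A + 2 * A' + 1)"
    using A(2) A'(2)
  proof eventually_elim
    case (elim w)
    then have f: "L2fun (clipped T a w)" "L2fun (clipped T b w)" by auto
    note [measurable] = L2fun_measurable[OF f(1)] L2fun_measurable[OF f(2)]
    have "(\<integral>\<^sup>+ s\<in>{0..T}. ennreal ((norm (a s w + b s w))\<^sup>2) \<partial>lborel)
        \<le> (\<integral>\<^sup>+ s. 2 * ennreal ((norm (clipped T a w s))\<^sup>2) + 2 * ennreal ((norm (clipped T b w s))\<^sup>2) \<partial>lborel)"
    proof (intro nn_integral_mono)
      fix s
      show "ennreal ((norm (a s w + b s w))\<^sup>2) * indicator {0..T} s \<le> 2 * ennreal ((norm (clipped T a w s))\<^sup>2) + 2 * ennreal ((norm (clipped T b w s))\<^sup>2)"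
        using ennreal_power2_norm_diff_le[of "a s w" "- b s w" 0] by (auto simp: clipped_def indicator_def)
    qed
    also have "\<dots> = 2 * sq_norm (clipped T a w) + 2 * sq_norm (clipped T b w)"
      by (simp add: nn_integral_add nn_integral_cmult)
    also have "\<dots> \<le> 2 * ennreal A + 2 * ennreal A'" using elim by (intro add_mono mult_left_mono) auto
    also have "\<dots> = ennreal (2 * A + 2 * A')" using A(1) A'(1) by (simp add: ennreal_mult)
    also have "\<dots> < ennreal (2 * A + 2 * A' + 1)" using A(1) A'(1) by (intro ennreal_lessI) auto
    finally show ?case .
  qed
  moreover have "2 * A + 2 * A' + 1 > 0" using A(1) A'(1) by auto
  ultimately show ?thesis using pm unfolding admissible_def by blast
qed

text \<open>For square-integrable paths, thus almost surely, the approximating integrals are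
  additive for every \<open>k\<close>, all on the same grid. Both sides are then mean-square limits
  of one sequence.\<close>

theorem ito_integral_add:
  assumes a: "a \<in> admissible M F T" and b: "b \<in> admissible M F T"
  shows "AE w in M. Ito (\<lambda>s w. a s w + b s w) w = Ito a w + Ito b w"
proof -
  let ?ab = "\<lambda>s w. a s w + b s w" and ?I = "Ito"
  have ab: "?ab \<in> admissible M F T" by (rule admissible_add[OF a b])
  note [measurable] = ito_integral_measurable[OF a] ito_integral_measurable[OF b] ito_integral_measurable[OF ab]
    lagged_integral_measurable[OF a] lagged_integral_measurable[OF b] lagged_integral_measurable[OF ab]
  have eq: "AE w in M. \<forall>k. lagged_integral k ?ab w = lagged_integral k a w + lagged_integral k b w"
  proof -
    from admissible_bound[OF a] have "AE w in M. L2fun (clipped T a w)" by (metis (no_types, lifting) eventually_mono)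
    moreover from admissible_bound[OF b] have "AE w in M. L2fun (clipped T b w)" by (metis (no_types, lifting) eventually_mono)
    ultimately show ?thesis
    proof eventually_elim
      case (elim w)
      have "clipped T ?ab w = (\<lambda>s. clipped T a w s + clipped T b w s)"
        by (simp add: clipped_def fun_eq_iff scaleR_add_right)
      then have "lagged_avg T (Suc k) (clipped T ?ab w) i = lagged_avg T (Suc k) (clipped T a w) i + lagged_avg T (Suc k) (clipped T b w) i" for k i
        using lagged_avg_add[OF elim] by simp
      then show ?case by (simp add: lagged_integral_def inner_add_left sum.distrib del: sum.lessThan_Suc)
    qed
  qed
  have "(\<lambda>k. mean_square M (\<lambda>w. lagged_integral k ?ab w - (?I a w + ?I b w))) \<longlonglongrightarrow> 0"
  proof (rule tendsto_sandwich[OF _ _ tendsto_const])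
    let ?D = "\<lambda>k c. mean_square M (\<lambda>w. lagged_integral k c w - ?I c w)"
    have "mean_square M (\<lambda>w. lagged_integral k ?ab w - (?I a w + ?I b w)) \<le> 2 * ?D k a + 2 * ?D k b" for k
    proof -
      have "mean_square M (\<lambda>w. lagged_integral k ?ab w - (?I a w + ?I b w))
          \<le> (\<integral>\<^sup>+w. 2 * ennreal ((lagged_integral k a w - ?I a w)\<^sup>2) + 2 * ennreal ((lagged_integral k b w - ?I b w)\<^sup>2) \<partial>M)"
      proof (intro nn_integral_mono_AE, use eq in eventually_elim)
        fix w assume "\<forall>k. lagged_integral k ?ab w = lagged_integral k a w + lagged_integral k b w"
        then have e: "lagged_integral k ?ab w - (?I a w + ?I b w) = (lagged_integral k a w - ?I a w) - (?I b w - lagged_integral k b w)"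
          by simp
        show "ennreal ((lagged_integral k ?ab w - (?I a w + ?I b w))\<^sup>2) \<le> 2 * ennreal ((lagged_integral k a w - ?I a w)\<^sup>2) + 2 * ennreal ((lagged_integral k b w - ?I b w)\<^sup>2)"
          unfolding e using ennreal_power2_norm_diff_le[of "lagged_integral k a w - ?I a w" "?I b w - lagged_integral k b w" 0]
          by (simp add: power2_commute[of "?I b w"])
      qed
      also have "\<dots> = 2 * ?D k a + 2 * ?D k b"
        by (simp add: nn_integral_add nn_integral_cmult)
      finally show ?thesis .
    qed
    then show "\<forall>\<^sub>F k in sequentially. mean_square M (\<lambda>w. lagged_integral k ?ab w - (?I a w + ?I b w)) \<le> 2 * ?D k a + 2 * ?D k b"
      by simp
    have "(\<lambda>k. 2 * ?D k a + 2 * ?D k b) \<longlonglongrightarrow> 2 * 0 + 2 * 0"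
      by (intro tendsto_add ennreal_tendsto_cmult lagged_integral_tendsto a b) auto
    then show "(\<lambda>k. 2 * ?D k a + 2 * ?D k b) \<longlonglongrightarrow> 0" by simp
  qed simp
  from nn_integral_square_limit_unique[OF _ _ _ lagged_integral_tendsto[OF ab] this] show ?thesis by simp
qed

text \<open>The argument for sums again, except that averages are homogeneous along every path; only
  the uniqueness of mean-square limits introduces a null set.\<close>

theorem ito_integral_scaleR:
  assumes a: "a \<in> admissible M F T"
  shows "AE w in M. Ito (\<lambda>s w. c *\<^sub>R a s w) w = c * Ito a w"
proof -
  let ?ca = "\<lambda>s w. c *\<^sub>R a s w" and ?I = Ito
  have ca: "?ca \<in> admissible M F T" by (rule admissible_linear[OF a bounded_linear_scaleR_right])
  note [measurable] = ito_integral_measurable[OF a] ito_integral_measurable[OF ca]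
    lagged_integral_measurable[OF a] lagged_integral_measurable[OF ca]
  have avg: "lagged_avg T n (clipped T ?ca w) i = c *\<^sub>R lagged_avg T n (clipped T a w) i" for n i w
  proof -
    have "clipped T ?ca w = (\<lambda>s. c *\<^sub>R clipped T a w s)"
      by (simp add: clipped_def fun_eq_iff)
    then show ?thesis by (simp add: lagged_avg_def)
  qed
  have "mean_square M (\<lambda>w. lagged_integral k ?ca w - c * ?I a w)
      = ennreal (c\<^sup>2) * mean_square M (\<lambda>w. lagged_integral k a w - ?I a w)" for k
  proof -
    have "lagged_integral k ?ca w - c * ?I a w = c * (lagged_integral k a w - ?I a w)" for w
      by (simp add: lagged_integral_def avg right_diff_distrib sum_distrib_left del: sum.lessThan_Suc)
    then have "mean_square M (\<lambda>w. lagged_integral k ?ca w - c * ?I a w)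
        = (\<integral>\<^sup>+w. ennreal (c\<^sup>2) * ennreal ((lagged_integral k a w - ?I a w)\<^sup>2) \<partial>M)"
      by (simp add: power_mult_distrib ennreal_mult)
    also have "\<dots> = ennreal (c\<^sup>2) * mean_square M (\<lambda>w. lagged_integral k a w - ?I a w)"
      by (rule nn_integral_cmult) measurable
    finally show ?thesis .
  qed
  moreover have "(\<lambda>k. ennreal (c\<^sup>2) * mean_square M (\<lambda>w. lagged_integral k a w - ?I a w)) \<longlonglongrightarrow> ennreal (c\<^sup>2) * 0"
    by (intro ennreal_tendsto_cmult lagged_integral_tendsto a) simp
  ultimately have "(\<lambda>k. mean_square M (\<lambda>w. lagged_integral k ?ca w - c * ?I a w)) \<longlonglongrightarrow> 0"
    by simp
  from nn_integral_square_limit_unique[OF _ _ _ lagged_integral_tendsto[OF ca] this] show ?thesis by simp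
qed

end

lemma L2fun_square_integrable: "L2fun f \<Longrightarrow> integrable lborel (\<lambda>s. (norm (f s))\<^sup>2)"
  by (rule integrableI_bounded) (auto simp: L2fun_def)

lemma set_integral_clipped_square:
  assumes "L2fun (clipped T a w)"
  shows "sq_norm (clipped T a w) = ennreal (LBINT s:{0..T}. (norm (a s w))\<^sup>2)"
proof -
  have "(LBINT s:{0..T}. (norm (a s w))\<^sup>2) = (\<integral>s. (norm (clipped T a w s))\<^sup>2 \<partial>lborel)"
    unfolding set_lebesgue_integral_def
    by (intro Bochner_Integration.integral_cong refl) (auto simp: clipped_def indicator_def)
  then show ?thesis
    using nn_integral_eq_integral[OF L2fun_square_integrable[OF assms]] by simp
qed

section \<open>The stochastic exponential of an admissible process\<close>

context brownian_filtration
begin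

lemma set_integral_measurable:
  fixes g :: "real ^ 'd \<Rightarrow> real"
  assumes a: "a \<in> admissible M F T" and g [measurable]: "g \<in> borel_measurable borel"
  shows "(\<lambda>w. LBINT s:{0..T}. g (a s w)) \<in> borel_measurable M"
proof -
  have [measurable]: "(\<lambda>(w, s). clipped T a w s) \<in> borel_measurable (M \<Otimes>\<^sub>M lborel)"
    using clipped_jointly_measurable[OF a] by simp
  have "(\<lambda>w. \<integral>s. indicator {0..T} s *\<^sub>R g (clipped T a w s) \<partial>lborel) \<in> borel_measurable M"
    by measurable
  moreover have "indicator {0..T} s *\<^sub>R g (clipped T a w s) = indicator {0..T} s *\<^sub>R g (a s w)" for s w
    by (auto simp: clipped_def indicator_def)
  ultimately show ?thesis unfolding set_lebesgue_integral_def by (simp only:)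
qed

theorem expectation_exponential:
  assumes h: "h \<in> admissible M F T"
  shows "(\<integral>\<^sup>+w. ennreal (exp (Ito h w - 1/2 * (LBINT s:{0..T}. (norm (h s w))\<^sup>2))) \<partial>M) = 1"
proof -
  let ?I = "Ito h" and ?q = "\<lambda>w. LBINT s:{0..T}. (norm (h s w))\<^sup>2"
  from simple_approximation[OF h] obtain \<xi> where x: "\<And>k. simple_integrand M F T (Suc k) (grid T (Suc k)) (\<xi> k)"
    and eq: "AE w in M. \<forall>k i. \<xi> k i w = lagged_avg T (Suc k) (clipped T h w) i"
    by blast
  from admissible_bound[OF h] obtain A where A:
    "A > 0" "AE w in M. L2fun (clipped T h w) \<and> sq_norm (clipped T h w) < ennreal A"
    by blast
  define S where "S k = simple_integral B (Suc k) (grid T (Suc k)) (\<xi> k)" for k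
  define Q where "Q k w = (\<Sum>i<Suc k. (norm (\<xi> k i w))\<^sup>2 * (grid T (Suc k) (Suc i) - grid T (Suc k) i))" for k w
  define Z where "Z k w = exp (S k w - 1/2 * Q k w)" for k w
  have Smeas [measurable]: "S k \<in> borel_measurable M" for k
    unfolding S_def by (rule simple_integral_measurable[OF x])
  have Qmeas [measurable]: "Q k \<in> borel_measurable M" for k
  proof -
    have "\<xi> k i \<in> borel_measurable M" if "i < Suc k" for i
      using x[of k] simple_grid[OF x[of k], of i "Suc k"] that
      by (intro measurable_F_M[of "\<xi> k i" "grid T (Suc k) i"]) (auto simp: simple_integrand_def)
    then show ?thesis unfolding Q_def[abs_def]
      by (intro borel_measurable_sum borel_measurable_times borel_measurable_power borel_measurable_norm) auto
  qed
  have Imeas [measurable]: "?I \<in> borel_measurable M" by (rule ito_integral_measurable[OF h])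
  have qmeas [measurable]: "?q \<in> borel_measurable M" by (rule set_integral_measurable[OF h]) measurable
  \<comment> \<open>The scalar \<open>c\<close> is taken to be 1 for the mean of \<open>Z\<close>
    and 2 for its second moment.\<close>
  have density: "exp_density (Suc k) (grid T (Suc k)) (\<lambda>i w. c *\<^sub>R \<xi> k i w) w = exp (c * S k w - 1/2 * (c\<^sup>2 * Q k w))" for k w c
    unfolding S_def Q_def simple_integral_def
    by (simp only: sum_subtractf sum_distrib_left inner_scaleR_left norm_scaleR power_mult_distrib power2_abs mult.assoc)
  have scaled: "simple_integrand M F T (Suc k) (grid T (Suc k)) (\<lambda>i w. c *\<^sub>R \<xi> k i w)" for k c
  proof -
    from x[of k] obtain C where C: "\<forall>i<Suc k. \<forall>w\<in>space M. norm (\<xi> k i w) \<le> C"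
      unfolding simple_integrand_def by blast
    then have "\<exists>C. \<forall>i<Suc k. \<forall>w\<in>space M. norm (c *\<^sub>R \<xi> k i w) \<le> C"
      by (intro exI[of _ "\<bar>c\<bar> * C"]) (auto intro: mult_left_mono)
    then show ?thesis
      using x[of k] by (simp add: simple_integrand_def borel_measurable_scaleR)
  qed
  have one: "(\<integral>\<^sup>+w. ennreal (Z k w) \<partial>M) = 1" for k
    using expectation_exp_density[OF scaled[of k 1]] unfolding density Z_def by simp
  have pathQ: "AE w in M. \<forall>k. ennreal (Q k w) = sq_norm (\<lambda>s. lagged_step T (Suc k) (clipped T h w) s)"
    using eq by eventually_elim (simp only: nn_integral_lagged_step[OF T_pos zero_less_Suc] Q_def, simp)
  \<comment> \<open>\<open>(Z k w)\<^sup>2\<close> carries \<open>- Q k w\<close> in its exponent,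
    the mean-one density of the doubled integrand carries \<open>- 2 * Q k w\<close>. The quotient
    is \<open>exp (Q k w)\<close>, and contraction gives \<open>Q k w \<le> A\<close> almost
    surely.\<close>
  have sq: "mean_square M (Z k) \<le> ennreal (exp A)" for k
  proof -
    let ?E = "\<lambda>w. exp (2 * S k w - 1/2 * (2\<^sup>2 * Q k w))"
    have "mean_square M (Z k) \<le> (\<integral>\<^sup>+w. ennreal (exp A) * ennreal (?E w) \<partial>M)"
    proof (rule nn_integral_mono_AE, use A(2) pathQ in eventually_elim)
      case (elim w)
      then have "ennreal (Q k w) < ennreal A"
        using nn_integral_lagged_step_le[of "clipped T h w" T "Suc k"] T_pos by (auto intro: le_less_trans)
      then have "Q k w \<le> A" using A(1) by (auto simp: ennreal_less_iff not_le intro: ccontr)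
      moreover have "(Z k w)\<^sup>2 = exp (Q k w) * ?E w"
        by (simp add: Z_def exp_add[symmetric] exp_double[symmetric] algebra_simps)
      ultimately have "(Z k w)\<^sup>2 \<le> exp A * ?E w" by (simp add: mult_right_mono)
      from ennreal_leI[OF this] show ?case by (simp add: ennreal_mult)
    qed
    also have "\<dots> = ennreal (exp A) * (\<integral>\<^sup>+w. ennreal (?E w) \<partial>M)"
      by (rule nn_integral_cmult) measurable
    also have "\<dots> = ennreal (exp A)"
      using expectation_exp_density[OF scaled[of k 2]] unfolding density by simp
    finally show ?thesis .
  qed
  have Qlim: "AE w in M. (\<lambda>k. Q k w) \<longlonglongrightarrow> ?q w"
    using A(2) pathQ
  proof eventually_elim
    case (elim w)
    then have f: "L2fun (clipped T h w)" by simp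
    have "(\<lambda>k. ennreal (Q k w)) \<longlonglongrightarrow> ennreal (?q w)"
      using lagged_step_norm_tendsto[OF T_pos f] elim set_integral_clipped_square[OF f] by (simp add: clipped_def)
    moreover have "0 \<le> Q k w" for k
      unfolding Q_def using grid_bounds(2)[of "Suc k"] by (intro sum_nonneg mult_nonneg_nonneg) (auto simp: )
    moreover have "0 \<le> ?q w"
      unfolding set_lebesgue_integral_def by (rule integral_nonneg_AE) (auto simp: indicator_def)
    ultimately show ?case by (simp add: tendsto_ennreal_iff)
  qed
  have Slim: "(\<lambda>k. mean_square M (\<lambda>w. S k w - ?I w)) \<longlonglongrightarrow> 0"
    unfolding S_def by (rule simple_integrals_tendsto_ito_integral[OF h x lagged_approx_error[OF h x eq]])
  \<comment> \<open>Passing to an almost surely convergent subsequence requires integrable squared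
    differences; the limit \<open>Slim\<close> yields their finiteness from some index on, hence the
    shift by \<open>N\<close>.\<close>
  obtain N where N: "\<And>k. k \<ge> N \<Longrightarrow> mean_square M (\<lambda>w. S k w - ?I w) < 1"
    using order_tendstoD(2)[OF Slim, of 1] by (auto simp: eventually_sequentially)
  have int: "integrable M (\<lambda>w. (S (k + N) w - ?I w)\<^sup>2)" for k
    using N[of "k + N"] by (intro integrableI_bounded) (auto intro: less_trans)
  have "(\<lambda>k. ennreal (\<integral>w. (S (k + N) w - ?I w)\<^sup>2 \<partial>M)) \<longlonglongrightarrow> ennreal 0"
    using LIMSEQ_ignore_initial_segment[OF Slim, of N] nn_integral_eq_integral[OF int] by simp
  then have "(\<lambda>k. \<integral>w. norm ((S (k + N) w - ?I w)\<^sup>2) \<partial>M) \<longlonglongrightarrow> 0"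
    by (subst (asm) tendsto_ennreal_iff) auto
  from tendsto_L1_AE_subseq[OF int this] obtain r where r: "strict_mono r"
    and ae: "AE w in M. (\<lambda>k. (S (r k + N) w - ?I w)\<^sup>2) \<longlonglongrightarrow> 0"
    by blast
  \<comment> \<open>A subsequence is enough, because mean 1 and the second-moment bound hold for
    every index.\<close>
  have lim: "AE w in M. (\<lambda>k. Z (r k + N) w) \<longlonglongrightarrow> exp (?I w - 1/2 * ?q w)"
    using ae Qlim
  proof eventually_elim
    case (elim w)
    have "(\<lambda>k. sqrt ((S (r k + N) w - ?I w)\<^sup>2)) \<longlonglongrightarrow> sqrt 0"
      by (intro tendsto_real_sqrt elim(1))
    then have "(\<lambda>k. S (r k + N) w - ?I w) \<longlonglongrightarrow> 0"
      by (simp add: tendsto_rabs_zero_iff)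
    then have S: "(\<lambda>k. S (r k + N) w) \<longlonglongrightarrow> ?I w" by (rule LIM_zero_cancel)
    have "strict_mono (\<lambda>k. r k + N)" using r by (auto simp: strict_mono_def)
    from LIMSEQ_subseq_LIMSEQ[OF elim(2) this] have Q: "(\<lambda>k. Q (r k + N) w) \<longlonglongrightarrow> ?q w"
      by (simp add: comp_def)
    show ?case unfolding Z_def by (intro tendsto_exp tendsto_diff tendsto_mult tendsto_const S Q)
  qed
  show ?thesis
    by (rule nn_integral_limit_eq_1[OF _ _ _ _ _ sq lim]) (use one in \<open>auto simp: Z_def[abs_def]\<close>)
qed

lemma deterministic_admissible:
  fixes f :: "real \<Rightarrow> real ^ 'd"
  assumes m: "f \<in> borel_measurable (restrict_space borel {0..T})"
    and fin: "(\<integral>\<^sup>+ s\<in>{0..T}. ennreal ((norm (f s))\<^sup>2) \<partial>lborel) < \<infinity>"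
  shows "(\<lambda>s _. f s) \<in> admissible M F T"
proof -
  have "progressively_measurable F T (\<lambda>s _. f s)"
    unfolding progressively_measurable_def
  proof
    fix t assume t: "t \<in> {0..T}"
    have "(\<lambda>s. s) \<in> measurable (restrict_space borel {0..t}) (restrict_space borel {0..T})"
      using t by (intro measurable_restrict_space2 measurable_restrict_space1) (auto simp: space_restrict_space)
    from measurable_compose[OF this m] have "f \<in> borel_measurable (restrict_space borel {0..t})" .
    from measurable_compose[OF measurable_fst this, of "F t"]
    show "(\<lambda>(s, w). f s) \<in> borel_measurable (restrict_space borel {0..t} \<Otimes>\<^sub>M F t)" by (simp add: case_prod_beta)
  qed
  moreover obtain A where "(\<integral>\<^sup>+ s\<in>{0..T}. ennreal ((norm (f s))\<^sup>2) \<partial>lborel) = ennreal A" "A \<ge> 0"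
    using fin by (cases "\<integral>\<^sup>+ s\<in>{0..T}. ennreal ((norm (f s))\<^sup>2) \<partial>lborel") auto
  then have "\<exists>A>0. AE w in M. (\<integral>\<^sup>+ s\<in>{0..T}. ennreal ((norm (f s))\<^sup>2) \<partial>lborel) < ennreal A"
    by (intro exI[of _ "A + 1"]) (auto intro!: ennreal_lessI)
  ultimately show ?thesis by (simp add: admissible_def)
qed

lemma kernel_admissible:
  fixes K :: "real \<Rightarrow> real \<Rightarrow> real ^ 'd"
  assumes "volterra_kernel T K"
  shows "(\<lambda>s _. K T s) \<in> admissible M F T"
proof (rule deterministic_admissible)
  have m: "(\<lambda>(t, s). K t s) \<in> borel_measurable (restrict_space borel ({0..T} \<times> {0..T}))"
    and sup: "(SUP t\<in>{0..T}. \<integral>\<^sup>+ s\<in>{0..T}. ennreal ((norm (K t s))\<^sup>2) \<partial>lborel) < \<infinity>"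
    using assms by (auto simp: volterra_kernel_def)
  have "(\<lambda>s. (T, s)) \<in> measurable (restrict_space borel {0..T}) (restrict_space borel ({0..T} \<times> {0..T}))"
    using T_pos by (intro measurable_restrict_space2 measurable_restrict_space1 borel_measurable_Pair) (auto simp: space_restrict_space)
  from measurable_compose[OF this m] show "K T \<in> borel_measurable (restrict_space borel {0..T})" by simp
  have "(\<integral>\<^sup>+ s\<in>{0..T}. ennreal ((norm (K T s))\<^sup>2) \<partial>lborel) \<le> (SUP t\<in>{0..T}. \<integral>\<^sup>+ s\<in>{0..T}. ennreal ((norm (K t s))\<^sup>2) \<partial>lborel)"
    using T_pos by (intro SUP_upper) auto
  with sup show "(\<integral>\<^sup>+ s\<in>{0..T}. ennreal ((norm (K T s))\<^sup>2) \<partial>lborel) < \<infinity>" by (rule order_le_less_trans[rotated])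
qed

text \<open>An equality of functions, not only almost surely: both sides choose from the same set of versions.\<close>

lemma ito_integral_cong_AE:
  assumes "AE w in M. AE s in lborel. s \<in> {0..T} \<longrightarrow> a s w = b s w"
  shows "Ito a = Ito b"
proof -
  have "(\<integral>\<^sup>+ w. (\<integral>\<^sup>+ s\<in>{0..T}. ennreal ((norm (simple_process n \<tau> \<xi> s w - a s w))\<^sup>2) \<partial>lborel) \<partial>M)
      = (\<integral>\<^sup>+ w. (\<integral>\<^sup>+ s\<in>{0..T}. ennreal ((norm (simple_process n \<tau> \<xi> s w - b s w))\<^sup>2) \<partial>lborel) \<partial>M)" for n \<tau> \<xi>
  proof (rule nn_integral_cong_AE, use assms in eventually_elim)
    case (elim w)
    show ?case
      by (rule nn_integral_cong_AE, use elim in eventually_elim) (auto simp: indicator_def)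
  qed
  then have "is_ito_integral M F B T a = is_ito_integral M F B T b"
    unfolding is_ito_integral_def fun_eq_iff by simp
  then show ?thesis unfolding ito_integral_def by simp
qed

end

section \<open>The principal's problem\<close>

text \<open>A positive definite matrix has trivial kernel and is therefore invertible. Applied to
  both \<open>\<Gamma>\<close> and \<open>N\<close>.\<close>

lemma matrix_inv_mult_vec:
  fixes A :: "real ^ 'n ^ 'n"
  assumes "\<And>x. x \<noteq> 0 \<Longrightarrow> x \<bullet> (A *v x) > 0"
  shows "A *v (matrix_inv A *v x) = x" "matrix_inv A *v (A *v x) = x"
proof -
  have "x = 0" if "A *v x = 0" for x using assms[of x] that by force
  then have "\<exists>C. C ** A = mat 1" unfolding matrix_left_invertible_ker by blast
  then have "invertible A" by (simp add: invertible_left_inverse)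
  then have "A ** matrix_inv A = mat 1 \<and> matrix_inv A ** A = mat 1"
    unfolding matrix_inv_def invertible_def by (rule someI_ex)
  then show "A *v (matrix_inv A *v x) = x" "matrix_inv A *v (A *v x) = x"
    by (simp_all add: matrix_vector_mul_assoc)
qed

lemma abs_quadratic_form_le: "\<bar>x \<bullet> (A *v x)\<bar> \<le> onorm ((*v) A) * (norm x)\<^sup>2" for A :: "real ^ 'd ^ 'd"
proof -
  have "\<bar>x \<bullet> (A *v x)\<bar> \<le> norm x * norm (A *v x)" by (rule Cauchy_Schwarz_ineq2)
  also have "\<dots> \<le> norm x * (onorm ((*v) A) * norm x)"
    by (intro mult_left_mono onorm matrix_vector_mul_bounded_linear) simp
  finally show ?thesis by (simp add: power2_eq_square mult_ac)
qed

lemma set_integrable_quadratic: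
  fixes A :: "real ^ 'd ^ 'd"
  assumes f: "L2fun (clipped T a w)"
  shows "set_integrable lborel {0..T} (\<lambda>s. a s w \<bullet> (A *v a s w))"
    and "set_integrable lborel {0..T} (\<lambda>s. (norm (a s w))\<^sup>2)"
proof -
  have Am [measurable]: "(*v) A \<in> borel_measurable borel"
    by (intro borel_measurable_continuous_onI linear_continuous_on matrix_vector_mul_bounded_linear)
  note [measurable] = L2fun_measurable[OF f]
  have sq: "integrable lborel (\<lambda>s. (norm (clipped T a w s))\<^sup>2)" by (rule L2fun_square_integrable[OF f])
  have "integrable lborel (\<lambda>s. clipped T a w s \<bullet> (A *v clipped T a w s))"
  proof (rule Bochner_Integration.integrable_bound)
    show "integrable lborel (\<lambda>s. onorm ((*v) A) * (norm (clipped T a w s))\<^sup>2)" using sq by simp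
    show "AE s in lborel. norm (clipped T a w s \<bullet> (A *v clipped T a w s)) \<le> norm (onorm ((*v) A) * (norm (clipped T a w s))\<^sup>2)"
      using abs_quadratic_form_le[of _ A] by (intro AE_I2) (auto intro: order_trans[OF _ abs_ge_self])
    have "(\<lambda>s. A *v clipped T a w s) \<in> borel_measurable lborel"
      using measurable_compose[OF L2fun_measurable[OF f] Am] by simp
    then show "(\<lambda>s. clipped T a w s \<bullet> (A *v clipped T a w s)) \<in> borel_measurable lborel"
      using L2fun_measurable[OF f] by (intro borel_measurable_inner) auto
  qed
  moreover have "clipped T a w s \<bullet> (A *v clipped T a w s) = indicator {0..T} s *\<^sub>R (a s w \<bullet> (A *v a s w))" for s
    by (simp add: clipped_def indicator_def)
  ultimately show "set_integrable lborel {0..T} (\<lambda>s. a s w \<bullet> (A *v a s w))"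
    unfolding set_integrable_def by simp
  have "(norm (clipped T a w s))\<^sup>2 = indicator {0..T} s *\<^sub>R (norm (a s w))\<^sup>2" for s
    by (simp add: clipped_def indicator_def)
  with sq show "set_integrable lborel {0..T} (\<lambda>s. (norm (a s w))\<^sup>2)"
    unfolding set_integrable_def by simp
qed

section \<open>The model and its quadratic exponent\<close>

locale volterra_principal_agent = brownian_filtration M F T B
  for M :: "'a measure" and F T and B :: "real \<Rightarrow> 'a \<Rightarrow> real ^ 'd" +
  fixes g0 :: "real \<Rightarrow> real" and K :: "real \<Rightarrow> real \<Rightarrow> real ^ 'd" and \<gamma>P \<gamma>A :: real and \<Gamma> :: "real ^ 'd ^ 'd"
  assumes kernel: "volterra_kernel T K"
    and gP: "\<gamma>P > 0" and gA: "\<gamma>A > 0"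
    and sym: "transpose \<Gamma> = \<Gamma>" and pos: "\<And>x. x \<noteq> 0 \<Longrightarrow> x \<bullet> (\<Gamma> *v x) > 0"
begin

abbreviation "G \<equiv> matrix_inv \<Gamma>"
abbreviation "H \<equiv> \<gamma>P *\<^sub>R mat 1 + G"
abbreviation "N \<equiv> (\<gamma>A + \<gamma>P) *\<^sub>R mat 1 + G"

definition optimal :: "real \<Rightarrow> real ^ 'd" where
  "optimal t = matrix_inv N *v (H *v K T t)"

definition exponent :: real where
  "exponent = \<gamma>P / 2 * L2_inner T (K T) (\<lambda>s. (\<gamma>P *\<^sub>R mat 1 - H ** matrix_inv N ** H) *v K T s)"

lemma scaled_identity_vec: "(c *\<^sub>R mat 1 + A) *v x = c *\<^sub>R x + A *v x" for A :: "real ^ 'd ^ 'd"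
  by (simp add: matrix_vector_mult_add_rdistrib scaleR_matrix_vector_assoc[symmetric])

text \<open>Symmetry of \<open>\<Gamma>\<close>, tested at \<open>G *v x\<close> and
  \<open>G *v y\<close>.\<close>

lemma G_sym: "(G *v x) \<bullet> y = x \<bullet> (G *v y)"
proof -
  note inv = matrix_inv_mult_vec[OF pos]
  have "(\<Gamma> *v u) \<bullet> v = u \<bullet> (\<Gamma> *v v)" for u v
    by (metis dot_lmul_matrix sym transpose_matrix_vector)
  from this[of "G *v x" "G *v y"] show ?thesis by (simp add: inv)
qed

lemma G_pos: "x \<noteq> 0 \<Longrightarrow> x \<bullet> (G *v x) > 0"
proof -
  note inv = matrix_inv_mult_vec[OF pos]
  assume "x \<noteq> 0"
  then have "G *v x \<noteq> 0" using inv(1)[of x] by force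
  from pos[OF this] show ?thesis by (simp add: inv inner_commute)
qed

lemma N_pos: "x \<noteq> 0 \<Longrightarrow> x \<bullet> (N *v x) > 0"
  using G_pos[of x] gA gP by (simp add: scaled_identity_vec inner_add_right add_pos_pos)

lemma N_nonneg: "x \<bullet> (N *v x) \<ge> 0"
  using N_pos[of x] by (cases "x = 0") auto

text \<open>Here \<open>b\<close> stands for a value of \<open>\<beta>\<close> and \<open>k\<close>
  for one of the kernel. The left side is quadratic in \<open>b\<close> with Hessian
  \<open>\<gamma>P *\<^sub>R N\<close>; the right side is its Taylor expansion at the stationary
  point \<open>b'\<close>. Facts 1 to 6 expand everything into inner products, with the symmetry of
  \<open>G\<close> used to match the mixed terms.\<close>

lemma quadratic_completion:
  fixes b k :: "real ^ 'd"
  defines "b' \<equiv> matrix_inv N *v (H *v k)"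
  shows "1/2 * (norm ((G *v b + \<gamma>P *\<^sub>R b) + (- \<gamma>P) *\<^sub>R k))\<^sup>2 - 1/2 * (norm (G *v b))\<^sup>2 + \<gamma>P * f_star \<gamma>A \<Gamma> b
    = \<gamma>P / 2 * (k \<bullet> ((\<gamma>P *\<^sub>R mat 1 - H ** matrix_inv N ** H) *v k)) + \<gamma>P / 2 * ((b - b') \<bullet> (N *v (b - b')))"
proof -
  let ?w = "H *v k"
  \<comment> \<open>The first-order condition for the minimiser.\<close>
  have Nb': "N *v b' = ?w" unfolding b'_def by (rule matrix_inv_mult_vec(1)[OF N_pos])
  have w: "?w = \<gamma>P *\<^sub>R k + G *v k" by (rule scaled_identity_vec)
  have Nsym: "(N *v x) \<bullet> y = x \<bullet> (N *v y)" for x y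
    by (simp add: scaled_identity_vec inner_add_left inner_add_right G_sym)
  have Hsym: "x \<bullet> (H *v y) = (H *v x) \<bullet> y" for x y
    by (simp add: scaled_identity_vec inner_add_left inner_add_right G_sym)
  have "k \<bullet> ((\<gamma>P *\<^sub>R mat 1 - H ** matrix_inv N ** H) *v k) = k \<bullet> (\<gamma>P *\<^sub>R k - H *v b')"
    by (simp add: matrix_vector_mult_diff_rdistrib scaleR_matrix_vector_assoc[symmetric] matrix_vector_mul_assoc[symmetric] b'_def del: scaleR_matrix_vector_assoc)
  also have "\<dots> = \<gamma>P * (k \<bullet> k) - ?w \<bullet> b'"
    by (simp add: inner_diff_right Hsym)
  finally have 1: "k \<bullet> ((\<gamma>P *\<^sub>R mat 1 - H ** matrix_inv N ** H) *v k) = \<gamma>P * (k \<bullet> k) - ?w \<bullet> b'" .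
  have "(b - b') \<bullet> (N *v (b - b')) = b \<bullet> (N *v b) - b \<bullet> ?w - b' \<bullet> (N *v b) + b' \<bullet> ?w"
    by (simp add: matrix_vector_mult_diff_distrib inner_diff_left inner_diff_right Nb')
  also have "b' \<bullet> (N *v b) = b \<bullet> ?w"
    using Nsym[of b' b] Nb' by (simp add: inner_commute)
  finally have 2: "(b - b') \<bullet> (N *v (b - b')) = b \<bullet> (N *v b) - 2 * (b \<bullet> ?w) + ?w \<bullet> b'"
    by (simp add: inner_commute)
  have 3: "b \<bullet> (N *v b) = (\<gamma>A + \<gamma>P) * (b \<bullet> b) + b \<bullet> (G *v b)"
    by (simp add: scaled_identity_vec inner_add_right)
  have 4: "b \<bullet> ?w = \<gamma>P * (b \<bullet> k) + (G *v b) \<bullet> k"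
    unfolding w by (simp add: inner_add_right G_sym)
  have 5: "f_star \<gamma>A \<Gamma> b = 1/2 * (\<gamma>A * (b \<bullet> b) - b \<bullet> (G *v b))"
    unfolding f_star_def by (simp add: matrix_vector_mult_diff_rdistrib scaleR_matrix_vector_assoc[symmetric] inner_diff_right)
  have 6: "(norm ((G *v b + \<gamma>P *\<^sub>R b) + (- \<gamma>P) *\<^sub>R k))\<^sup>2
    = (norm (G *v b))\<^sup>2 + \<gamma>P\<^sup>2 * (b \<bullet> b) + \<gamma>P\<^sup>2 * (k \<bullet> k) + 2 * \<gamma>P * (b \<bullet> (G *v b)) - 2 * \<gamma>P * ((G *v b) \<bullet> k) - 2 * \<gamma>P\<^sup>2 * (b \<bullet> k)"
    unfolding power2_norm_eq_inner
    by (simp add: inner_add_left inner_add_right inner_commute power2_eq_square algebra_simps)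
  show ?thesis
    unfolding 1 2 3 4 5 6 by (simp add: power2_eq_square field_simps)
qed

lemma kernel_in_admissible: "(\<lambda>s _. K T s) \<in> admissible M F T"
  by (rule kernel_admissible[OF kernel])

lemma optimal_admissible: "(\<lambda>s _. optimal s) \<in> admissible M F T"
proof -
  have "bounded_linear (\<lambda>x. matrix_inv N *v (H *v x))"
    using bounded_linear_compose[OF matrix_vector_mul_bounded_linear matrix_vector_mul_bounded_linear] .
  from admissible_linear[OF kernel_in_admissible this] show ?thesis by (simp add: optimal_def)
qed

lemma admissible_diff:
  assumes "a \<in> admissible M F T" "b \<in> admissible M F T"
  shows "(\<lambda>s w. a s w - b s w) \<in> admissible M F T"
  using admissible_add[OF assms(1) admissible_linear[OF assms(2) bounded_linear_scaleR_right[of "-1"]]] by simp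

lemma best_reply_admissible: "\<beta> \<in> admissible M F T \<Longrightarrow> best_reply \<Gamma> \<beta> \<in> admissible M F T"
  unfolding best_reply_def[abs_def] by (rule admissible_linear[OF _ matrix_vector_mul_bounded_linear])

text \<open>The process \<open>h\<close> of the overview. The bracketing and the scalar
  \<open>- \<gamma>P\<close> follow the shapes in \<open>ito_integral_add\<close> and
  \<open>ito_integral_scaleR\<close>.\<close>

definition tilt :: "(real \<Rightarrow> 'a \<Rightarrow> real ^ 'd) \<Rightarrow> real \<Rightarrow> 'a \<Rightarrow> real ^ 'd" where
  "tilt \<beta> s w = (G *v \<beta> s w + \<gamma>P *\<^sub>R \<beta> s w) + (- \<gamma>P) *\<^sub>R K T s"

text \<open>The excess of the integrated exponent over its minimum \<open>exponent\<close>.\<close>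

definition loss :: "(real \<Rightarrow> 'a \<Rightarrow> real ^ 'd) \<Rightarrow> 'a \<Rightarrow> real" where
  "loss \<beta> w = \<gamma>P / 2 * (LBINT s:{0..T}. (\<beta> s w - optimal s) \<bullet> (N *v (\<beta> s w - optimal s)))"

definition tilt_density :: "(real \<Rightarrow> 'a \<Rightarrow> real ^ 'd) \<Rightarrow> 'a \<Rightarrow> real" where
  "tilt_density \<beta> w = exp (Ito (tilt \<beta>) w - 1/2 * (LBINT s:{0..T}. (norm (tilt \<beta> s w))\<^sup>2))"

lemma tilt_admissible:
  assumes "\<beta> \<in> admissible M F T"
  shows "tilt \<beta> \<in> admissible M F T"
  unfolding tilt_def[abs_def] using assms
  by (intro admissible_add admissible_linear[OF _ matrix_vector_mul_bounded_linear]
      admissible_linear[OF _ bounded_linear_scaleR_right] kernel_in_admissible)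

lemma ito_integral_tilt:
  assumes b: "\<beta> \<in> admissible M F T"
  shows "AE w in M. Ito (tilt \<beta>) w
    = Ito (best_reply \<Gamma> \<beta>) w + \<gamma>P * Ito \<beta> w - \<gamma>P * Ito (\<lambda>s _. K T s) w"
proof -
  have a: "(\<lambda>s w. G *v \<beta> s w) \<in> admissible M F T" by (rule admissible_linear[OF b matrix_vector_mul_bounded_linear])
  have c: "(\<lambda>s w. \<gamma>P *\<^sub>R \<beta> s w) \<in> admissible M F T" by (rule admissible_linear[OF b bounded_linear_scaleR_right])
  have d: "(\<lambda>s w. (- \<gamma>P) *\<^sub>R K T s) \<in> admissible M F T"
    by (rule admissible_linear[OF kernel_in_admissible bounded_linear_scaleR_right])
  show ?thesis
    using ito_integral_add[OF admissible_add[OF a c] d] ito_integral_add[OF a c]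
      ito_integral_scaleR[OF b, of \<gamma>P] ito_integral_scaleR[OF kernel_in_admissible, of "- \<gamma>P"]
  proof eventually_elim
    case (elim w)
    have "tilt \<beta> = (\<lambda>s w. (G *v \<beta> s w + \<gamma>P *\<^sub>R \<beta> s w) + (- \<gamma>P) *\<^sub>R K T s)"
      "best_reply \<Gamma> \<beta> = (\<lambda>s w. G *v \<beta> s w)"
      by (auto simp: tilt_def best_reply_def fun_eq_iff)
    then show ?case using elim by simp
  qed
qed

lemma loss_nonneg: "loss \<beta> w \<ge> 0"
  unfolding loss_def set_lebesgue_integral_def
  using gP N_nonneg by (intro mult_nonneg_nonneg integral_nonneg_AE AE_I2) (auto simp: indicator_def)

lemma admissible_L2fun: "a \<in> admissible M F T \<Longrightarrow> AE w in M. L2fun (clipped T a w)"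
  using admissible_bound[of a] by (metis (no_types, lifting) eventually_mono)

text \<open>\<open>quadratic_completion\<close> integrated over time. It holds almost surely, since
  splitting the integrals requires square-integrable paths.\<close>

lemma path_identity:
  assumes b: "\<beta> \<in> admissible M F T"
  shows "AE w in M. 1/2 * (LBINT s:{0..T}. (norm (tilt \<beta> s w))\<^sup>2) - 1/2 * (LBINT s:{0..T}. (norm (best_reply \<Gamma> \<beta> s w))\<^sup>2)
      + \<gamma>P * (LBINT s:{0..T}. f_star \<gamma>A \<Gamma> (\<beta> s w)) = exponent + loss \<beta> w"
  using admissible_L2fun[OF tilt_admissible[OF b]] admissible_L2fun[OF best_reply_admissible[OF b]]
    admissible_L2fun[OF b] admissible_L2fun[OF kernel_in_admissible] admissible_L2fun[OF admissible_diff[OF b optimal_admissible]]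
proof eventually_elim
  case (elim w)
  let ?A = "\<gamma>P *\<^sub>R mat 1 - H ** matrix_inv N ** H"
  have i: "set_integrable lborel {0..T} (\<lambda>s. (norm (tilt \<beta> s w))\<^sup>2)"
    "set_integrable lborel {0..T} (\<lambda>s. (norm (best_reply \<Gamma> \<beta> s w))\<^sup>2)"
    "set_integrable lborel {0..T} (\<lambda>s. f_star \<gamma>A \<Gamma> (\<beta> s w))"
    "set_integrable lborel {0..T} (\<lambda>s. K T s \<bullet> (?A *v K T s))"
    "set_integrable lborel {0..T} (\<lambda>s. (\<beta> s w - optimal s) \<bullet> (N *v (\<beta> s w - optimal s)))"
    using set_integrable_quadratic(2)[OF elim(1)] set_integrable_quadratic(2)[OF elim(2)]
      set_integrable_quadratic(1)[OF elim(3), of "\<gamma>A *\<^sub>R mat 1 - G"] set_integrable_quadratic(1)[OF elim(4), of ?A]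
      set_integrable_quadratic(1)[OF elim(5), of N]
    by (simp_all only: f_star_def set_integrable_mult_right)
  have "1/2 * (LBINT s:{0..T}. (norm (tilt \<beta> s w))\<^sup>2) - 1/2 * (LBINT s:{0..T}. (norm (best_reply \<Gamma> \<beta> s w))\<^sup>2)
      + \<gamma>P * (LBINT s:{0..T}. f_star \<gamma>A \<Gamma> (\<beta> s w))
    = (LBINT s:{0..T}. 1/2 * (norm (tilt \<beta> s w))\<^sup>2 - 1/2 * (norm (best_reply \<Gamma> \<beta> s w))\<^sup>2 + \<gamma>P * f_star \<gamma>A \<Gamma> (\<beta> s w))"
    using i by (simp only: set_integral_add set_integral_diff set_integral_mult_right set_integrable_mult_right)
  also have "\<dots> = (LBINT s:{0..T}. \<gamma>P / 2 * (K T s \<bullet> (?A *v K T s)) + \<gamma>P / 2 * ((\<beta> s w - optimal s) \<bullet> (N *v (\<beta> s w - optimal s))))"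
    unfolding tilt_def best_reply_def optimal_def by (simp only: quadratic_completion)
  also have "\<dots> = \<gamma>P / 2 * (LBINT s:{0..T}. K T s \<bullet> (?A *v K T s)) + \<gamma>P / 2 * (LBINT s:{0..T}. (\<beta> s w - optimal s) \<bullet> (N *v (\<beta> s w - optimal s)))"
    using i by (simp only: set_integral_add set_integral_mult_right set_integrable_mult_right)
  finally show ?case by (simp only: exponent_def L2_inner_def loss_def)
qed

lemma f_star_measurable: "f_star \<gamma>A \<Gamma> \<in> borel_measurable borel"
  unfolding f_star_def[abs_def]
  by (intro borel_measurable_times borel_measurable_const borel_measurable_inner borel_measurable_continuous_onI
      continuous_on_id linear_continuous_on matrix_vector_mul_bounded_linear)

lemma loss_measurable:
  assumes "\<beta> \<in> admissible M F T"
  shows "loss \<beta> \<in> borel_measurable M"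
proof -
  have "(\<lambda>x. x \<bullet> (N *v x)) \<in> borel_measurable borel"
    by (intro borel_measurable_inner borel_measurable_continuous_onI
      continuous_on_id linear_continuous_on matrix_vector_mul_bounded_linear)
  from set_integral_measurable[OF admissible_diff[OF assms optimal_admissible] this]
  show ?thesis unfolding loss_def[abs_def] by (intro borel_measurable_times) auto
qed

text \<open>The pathwise bound on the difference of two admissible processes bounds the quadratic
  form. This makes \<open>exp (loss \<beta> w)\<close> a bounded factor of the integrable
  \<open>tilt_density\<close>.\<close>

lemma loss_bounded:
  assumes "\<beta> \<in> admissible M F T"
  obtains C where "AE w in M. loss \<beta> w \<le> C"
proof -
  note d = admissible_diff[OF assms optimal_admissible]
  let ?d = "\<lambda>s w. \<beta> s w - optimal s"
  from admissible_bound[OF d] obtain A where A: "A > 0"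
    "AE w in M. L2fun (clipped T ?d w) \<and> sq_norm (clipped T ?d w) < ennreal A"
    by blast
  have "AE w in M. loss \<beta> w \<le> \<gamma>P / 2 * (onorm ((*v) N) * A)"
    using A(2)
  proof eventually_elim
    case (elim w)
    then have f: "L2fun (clipped T ?d w)" and "ennreal (LBINT s:{0..T}. (norm (?d s w))\<^sup>2) < ennreal A"
      using set_integral_clipped_square[of T ?d w] by auto
    then have le: "(LBINT s:{0..T}. (norm (?d s w))\<^sup>2) \<le> A"
      using ennreal_leI[of A "LBINT s:{0..T}. (norm (?d s w))\<^sup>2"] by (cases "(LBINT s:{0..T}. (norm (?d s w))\<^sup>2) \<le> A") auto
    have "(LBINT s:{0..T}. ?d s w \<bullet> (N *v ?d s w)) \<le> (LBINT s:{0..T}. onorm ((*v) N) * (norm (?d s w))\<^sup>2)"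
      using set_integrable_quadratic(1)[OF f, of N] set_integrable_quadratic(2)[OF f]
      by (intro set_integral_mono set_integrable_mult_right) (auto intro: order_trans[OF abs_ge_self abs_quadratic_form_le])
    also have "\<dots> = onorm ((*v) N) * (LBINT s:{0..T}. (norm (?d s w))\<^sup>2)" by simp
    also have "\<dots> \<le> onorm ((*v) N) * A"
      by (intro mult_left_mono le onorm_pos_le matrix_vector_mul_bounded_linear)
    finally show ?case unfolding loss_def using gP by (intro mult_left_mono) auto
  qed
  with that show ?thesis by blast
qed

lemma tilt_density_measurable:
  assumes "\<beta> \<in> admissible M F T"
  shows "tilt_density \<beta> \<in> borel_measurable M"
proof -
  have "(\<lambda>x :: real^'d. (norm x)\<^sup>2) \<in> borel_measurable borel" by measurable
  note [measurable] = ito_integral_measurable[OF tilt_admissible[OF assms]] set_integral_measurable[OF tilt_admissible[OF assms] this]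
  show ?thesis unfolding tilt_density_def[abs_def] by measurable
qed

lemma expectation_tilt_density:
  assumes "\<beta> \<in> admissible M F T"
  shows "integrable M (tilt_density \<beta>)" "expectation (tilt_density \<beta>) = 1"
proof -
  have nn: "(\<integral>\<^sup>+w. ennreal (tilt_density \<beta> w) \<partial>M) = 1"
    unfolding tilt_density_def by (rule expectation_exponential[OF tilt_admissible[OF assms]])
  show int: "integrable M (tilt_density \<beta>)"
    using nn tilt_density_measurable[OF assms] by (intro integrableI_bounded) (auto simp: tilt_density_def)
  show "expectation (tilt_density \<beta>) = 1"
    using nn nn_integral_eq_integral[OF int] by (simp add: tilt_density_def)
qed

lemma integrable_tilt_loss:
  assumes b: "\<beta> \<in> admissible M F T"
  shows "integrable M (\<lambda>w. tilt_density \<beta> w * exp (loss \<beta> w))"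
proof -
  note [measurable] = tilt_density_measurable[OF b] loss_measurable[OF b]
  obtain C where C: "AE w in M. loss \<beta> w \<le> C" using loss_bounded[OF b] .
  show ?thesis
  proof (rule Bochner_Integration.integrable_bound)
    show "integrable M (\<lambda>w. exp C * tilt_density \<beta> w)" using expectation_tilt_density[OF b] by simp
    show "AE w in M. norm (tilt_density \<beta> w * exp (loss \<beta> w)) \<le> norm (exp C * tilt_density \<beta> w)"
      using C by eventually_elim (simp add: tilt_density_def abs_mult)
  qed measurable
qed

text \<open>The factor by which \<open>\<beta>\<close> enlarges the principal's optimal
  disutility.\<close>

abbreviation "premium \<beta> \<equiv> expectation (\<lambda>w. tilt_density \<beta> w * exp (loss \<beta> w))"

text \<open>The density is positive with mean 1, so its product with
  \<open>exp (loss \<beta> w) - 1\<close> is nonnegative with mean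
  \<open>premium \<beta> - 1\<close>. If that mean vanishes, so does the loss almost surely.\<close>

lemma expectation_tilt_loss:
  assumes b: "\<beta> \<in> admissible M F T"
  shows "premium \<beta> \<ge> 1"
    and "premium \<beta> = 1 \<Longrightarrow> AE w in M. loss \<beta> w = 0"
proof -
  let ?X = "\<lambda>w. tilt_density \<beta> w * exp (loss \<beta> w) - tilt_density \<beta> w"
  have int: "integrable M ?X"
    using integrable_tilt_loss[OF b] expectation_tilt_density[OF b] by simp
  have E: "expectation ?X = premium \<beta> - 1"
    using integrable_tilt_loss[OF b] expectation_tilt_density[OF b] by simp
  have nn: "?X w \<ge> 0" for w
    using loss_nonneg[of \<beta> w] by (simp add: tilt_density_def)
  have "expectation ?X \<ge> 0" by (intro integral_nonneg_AE AE_I2 nn)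
  then show "premium \<beta> \<ge> 1" using E by simp
  assume "premium \<beta> = 1"
  then have "AE w in M. ?X w = 0"
    using E integral_nonneg_eq_0_iff_AE[OF int AE_I2[OF nn]] by simp
  then show "AE w in M. loss \<beta> w = 0"
    by eventually_elim (simp add: tilt_density_def)
qed

text \<open>A nonnegative integrand with integral 0 vanishes almost everywhere, and \<open>N\<close>
  is positive definite.\<close>

lemma loss_eq_0_imp:
  assumes b: "\<beta> \<in> admissible M F T" and l: "AE w in M. loss \<beta> w = 0"
  shows "AE w in M. AE s in lborel. s \<in> {0..T} \<longrightarrow> \<beta> s w = optimal s"
  using l admissible_L2fun[OF admissible_diff[OF b optimal_admissible]]
proof eventually_elim
  case (elim w)
  let ?q = "\<lambda>s. indicator {0..T} s *\<^sub>R ((\<beta> s w - optimal s) \<bullet> (N *v (\<beta> s w - optimal s)))"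
  have int: "integrable lborel ?q"
    using set_integrable_quadratic(1)[OF elim(2), of N] unfolding set_integrable_def .
  have "(\<integral>s. ?q s \<partial>lborel) = 0"
    using elim(1) gP unfolding loss_def set_lebesgue_integral_def by simp
  then have "AE s in lborel. ?q s = 0"
    using integral_nonneg_eq_0_iff_AE[OF int] N_nonneg by (auto simp: indicator_def)
  then show ?case
  proof eventually_elim
    case (elim s)
    show ?case
    proof
      assume "s \<in> {0..T}"
      with elim have "(\<beta> s w - optimal s) \<bullet> (N *v (\<beta> s w - optimal s)) = 0" by simp
      then have "\<beta> s w - optimal s = 0" using N_pos[of "\<beta> s w - optimal s"] by (metis less_irrefl)
      then show "\<beta> s w = optimal s" by simp
    qed
  qed
qed

section \<open>The principal's expected utility and its maximum\<close>

abbreviation "utility \<beta> y \<equiv> principal_utility M F T B g0 K \<gamma>P (best_reply \<Gamma> \<beta>) (contract M F T B \<gamma>A \<Gamma> y \<beta>)"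
abbreviation "best_value y \<equiv> - exp (- \<gamma>P * (g0 T - y) + exponent)"

theorem principal_utility_eq:
  assumes b: "\<beta> \<in> admissible M F T"
  shows "integrable (effort_measure M F T B (best_reply \<Gamma> \<beta>))
      (\<lambda>w. cara_utility \<gamma>P (output_process M F B g0 K T w - contract M F T B \<gamma>A \<Gamma> y \<beta> w))"
    and "utility \<beta> y
      = best_value y * premium \<beta>"
proof -
  let ?I = "Ito"
  let ?D = "\<lambda>w. exp (?I (best_reply \<Gamma> \<beta>) w - 1/2 * (LBINT s:{0..T}. (norm (best_reply \<Gamma> \<beta> s w))\<^sup>2))"
  let ?U = "\<lambda>w. cara_utility \<gamma>P (output_process M F B g0 K T w - contract M F T B \<gamma>A \<Gamma> y \<beta> w)"
  let ?c = "exp (- \<gamma>P * (g0 T - y) + exponent)"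
  have "(\<lambda>x :: real^'d. (norm x)\<^sup>2) \<in> borel_measurable borel" by measurable
  note [measurable] = ito_integral_measurable[OF best_reply_admissible[OF b]] ito_integral_measurable[OF b]
    ito_integral_measurable[OF kernel_in_admissible] set_integral_measurable[OF best_reply_admissible[OF b] this]
    set_integral_measurable[OF b f_star_measurable] tilt_density_measurable[OF b] loss_measurable[OF b]
  have D: "?D \<in> borel_measurable M" by measurable
  have U: "?U \<in> borel_measurable M"
    unfolding cara_utility_def output_process_def contract_def by measurable
  \<comment> \<open>The exponents of density and utility add up. \<open>ito_integral_tilt\<close>
    gathers the three stochastic integrals into one, and \<open>path_identity\<close> trades the
    time integrals for that of the tilt, \<open>exponent\<close> and the loss.\<close>
  have eq: "AE w in M. ?D w *\<^sub>R ?U w = - ?c * (tilt_density \<beta> w * exp (loss \<beta> w))"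
    using path_identity[OF b] ito_integral_tilt[OF b]
  proof eventually_elim
    case (elim w)
    have "?D w *\<^sub>R ?U w = - exp ((?I (best_reply \<Gamma> \<beta>) w - 1/2 * (LBINT s:{0..T}. (norm (best_reply \<Gamma> \<beta> s w))\<^sup>2))
        - \<gamma>P * (g0 T + ?I (\<lambda>s _. K T s) w - (y + (LBINT s:{0..T}. f_star \<gamma>A \<Gamma> (\<beta> s w)) + ?I \<beta> w)))"
    proof -
      have "exp p *\<^sub>R (- exp (- \<gamma>P * z)) = - exp (p - \<gamma>P * z)" for p z
        by (simp add: exp_diff exp_minus divide_inverse)
      then show ?thesis unfolding cara_utility_def output_process_def contract_def by (simp only:)
    qed
    also have "\<dots> = - exp ((- \<gamma>P * (g0 T - y) + exponent) + ((?I (tilt \<beta>) w - 1/2 * (LBINT s:{0..T}. (norm (tilt \<beta> s w))\<^sup>2)) + loss \<beta> w))"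
      using elim by (simp add: algebra_simps)
    also have "\<dots> = - ?c * (tilt_density \<beta> w * exp (loss \<beta> w))"
      unfolding tilt_density_def by (simp only: exp_add mult_minus_left)
    finally show ?case .
  qed
  have int: "integrable M (\<lambda>w. ?D w *\<^sub>R ?U w)"
    by (subst integrable_cong_AE[OF _ _ eq]) (use D U integrable_tilt_loss[OF b] in \<open>auto intro!: borel_measurable_scaleR\<close>)
  show "integrable (effort_measure M F T B (best_reply \<Gamma> \<beta>)) ?U"
    unfolding effort_measure_def by (subst integrable_density) (use D U int in auto)
  have "utility \<beta> y = expectation (\<lambda>w. ?D w *\<^sub>R ?U w)"
    unfolding principal_utility_def effort_measure_def by (subst integral_density) (use D U in auto)
  also have "\<dots> = expectation (\<lambda>w. - ?c * (tilt_density \<beta> w * exp (loss \<beta> w)))"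
    by (rule integral_cong_AE[OF _ _ eq]) (use D U in \<open>auto intro!: borel_measurable_scaleR\<close>)
  also have "\<dots> = - ?c * premium \<beta>"
    by (rule integral_mult_right_zero)
  finally show "utility \<beta> y
      = - ?c * premium \<beta>" .
qed

text \<open>\<open>best_value y\<close> is negative, so a factor of at least 1 lowers it, and
  equality forces the factor to be 1.\<close>

lemma principal_utility_le:
  assumes b: "\<beta> \<in> admissible M F T"
  shows "utility \<beta> y \<le> best_value y"
    and "utility \<beta> y = best_value y
      \<Longrightarrow> AE w in M. AE s in lborel. s \<in> {0..T} \<longrightarrow> \<beta> s w = optimal s"
proof -
  show "utility \<beta> y \<le> best_value y"
    unfolding principal_utility_eq(2)[OF b] using expectation_tilt_loss(1)[OF b] by simp
  assume "utility \<beta> y = best_value y"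
  then have "premium \<beta> = 1"
    unfolding principal_utility_eq(2)[OF b] by simp
  then show "AE w in M. AE s in lborel. s \<in> {0..T} \<longrightarrow> \<beta> s w = optimal s"
    by (intro loss_eq_0_imp[OF b] expectation_tilt_loss(2)[OF b])
qed

lemma principal_utility_optimal:
  "utility (\<lambda>t _. optimal t) y
    = best_value y"
proof -
  have "loss (\<lambda>t _. optimal t) w = 0" for w by (simp add: loss_def)
  then show ?thesis
    unfolding principal_utility_eq(2)[OF optimal_admissible] by (simp add: expectation_tilt_density(2)[OF optimal_admissible])
qed

lemma V_SB_at_eq: "V_SB_at M F T B g0 K \<gamma>P \<gamma>A \<Gamma> y = best_value y"
  unfolding V_SB_at_def
proof (rule cSup_eq_maximum)
  show "best_value y
    \<in> (\<lambda>\<beta>. utility \<beta> y) ` admissible M F T"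
    using principal_utility_optimal[of y] by (intro image_eqI[OF _ optimal_admissible]) simp
qed (use principal_utility_le(1) in auto)

text \<open>A larger \<open>y\<close> is a larger payment to the agent and lowers
  \<open>best_value\<close>, so the participation constraint binds.\<close>

lemma V_SB_eq: "V_SB M F T B g0 K \<gamma>P \<gamma>A \<Gamma> y0 = best_value y0"
  unfolding V_SB_def V_SB_at_eq
  by (rule cSup_eq_maximum) (use gP in \<open>auto intro!: mult_left_mono\<close>)

text \<open>Turns uniqueness of the optimal \<open>\<beta>\<close> into uniqueness of the contract.
  The time integrals agree path by path; the stochastic integrals agree as functions by
  \<open>ito_integral_cong_AE\<close>.\<close>

lemma contract_cong_AE:
  assumes b: "\<beta> \<in> admissible M F T" "\<beta>' \<in> admissible M F T"
    and eq: "AE w in M. AE s in lborel. s \<in> {0..T} \<longrightarrow> \<beta> s w = \<beta>' s w"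
  shows "AE w in M. contract M F T B \<gamma>A \<Gamma> y \<beta> w = contract M F T B \<gamma>A \<Gamma> y \<beta>' w"
  using eq admissible_L2fun[OF b(1)] admissible_L2fun[OF b(2)]
proof eventually_elim
  case (elim w)
  have "set_integrable lborel {0..T} (\<lambda>s. f_star \<gamma>A \<Gamma> (\<beta> s w))" "set_integrable lborel {0..T} (\<lambda>s. f_star \<gamma>A \<Gamma> (\<beta>' s w))"
    using set_integrable_quadratic(1)[OF elim(2), of "\<gamma>A *\<^sub>R mat 1 - G"] set_integrable_quadratic(1)[OF elim(3), of "\<gamma>A *\<^sub>R mat 1 - G"]
    by (simp_all only: f_star_def set_integrable_mult_right)
  then have m: "(\<lambda>s. indicator {0..T} s *\<^sub>R f_star \<gamma>A \<Gamma> (\<beta> s w)) \<in> borel_measurable lborel"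
    "(\<lambda>s. indicator {0..T} s *\<^sub>R f_star \<gamma>A \<Gamma> (\<beta>' s w)) \<in> borel_measurable lborel"
    unfolding set_integrable_def by (blast dest: borel_measurable_integrable)+
  have "(LBINT s:{0..T}. f_star \<gamma>A \<Gamma> (\<beta> s w)) = (LBINT s:{0..T}. f_star \<gamma>A \<Gamma> (\<beta>' s w))"
    unfolding set_lebesgue_integral_def
    by (rule integral_cong_AE[OF m]) (use elim(1) in eventually_elim, auto simp: indicator_def)
  then show ?case by (simp add: contract_def ito_integral_cong_AE[OF eq])
qed

end

theorem theorem5p1:
  fixes M :: "'a measure"
    and F :: "real \<Rightarrow> 'a measure"
    and T :: real
    and B :: "real \<Rightarrow> 'a \<Rightarrow> real ^ 'd"
    and g0 :: "real \<Rightarrow> real"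
    and K :: "real \<Rightarrow> real \<Rightarrow> real ^ 'd"
    and \<gamma>P \<gamma>A y0 \<phi>0 :: real
    and \<Gamma> :: "real ^ 'd ^ 'd"
    and \<beta>s :: "real \<Rightarrow> real ^ 'd"
    and \<xi>s :: "'a \<Rightarrow> real"
  assumes "T > 0"
    and "filtered_prob_space M F T"
    and "brownian_motion M F T B"
    and "g0 \<in> borel_measurable (restrict_space borel {0..T})"
    and "volterra_kernel T K"
    and "\<gamma>P > 0" and "\<gamma>A > 0"
    and "transpose \<Gamma> = \<Gamma>" and "\<And>x. x \<noteq> 0 \<Longrightarrow> x \<bullet> (\<Gamma> *v x) > 0"
    and "\<beta>s = (\<lambda>t. matrix_inv ((\<gamma>A + \<gamma>P) *\<^sub>R mat 1 + matrix_inv \<Gamma>)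
                     *v ((\<gamma>P *\<^sub>R mat 1 + matrix_inv \<Gamma>) *v K T t))"
    and "\<phi>0 = \<gamma>P / 2 *
           L2_inner T (K T)
             (\<lambda>s. (\<gamma>P *\<^sub>R mat 1
                    - (\<gamma>P *\<^sub>R mat 1 + matrix_inv \<Gamma>)
                      ** matrix_inv ((\<gamma>A + \<gamma>P) *\<^sub>R mat 1 + matrix_inv \<Gamma>)
                      ** (\<gamma>P *\<^sub>R mat 1 + matrix_inv \<Gamma>)) *v K T s)"
    and "\<xi>s = (\<lambda>\<omega>. y0 + (LBINT s:{0..T}. f_star \<gamma>A \<Gamma> (\<beta>s s))
                      + ito_integral M F B T (\<lambda>s _. \<beta>s s) \<omega>)"
  shows
    "(\<forall>y\<ge>y0. \<forall>\<beta>\<in>admissible M F T.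
        integrable (effort_measure M F T B (best_reply \<Gamma> \<beta>))
          (\<lambda>\<omega>. cara_utility \<gamma>P (output_process M F B g0 K T \<omega> - contract M F T B \<gamma>A \<Gamma> y \<beta> \<omega>)))
     \<and> (\<lambda>t _. \<beta>s t) \<in> admissible M F T
     \<and> (\<forall>y\<ge>y0.
          principal_utility M F T B g0 K \<gamma>P (best_reply \<Gamma> (\<lambda>t _. \<beta>s t))
              (contract M F T B \<gamma>A \<Gamma> y (\<lambda>t _. \<beta>s t))
            = V_SB_at M F T B g0 K \<gamma>P \<gamma>A \<Gamma> y
          \<and> (\<forall>\<beta>\<in>admissible M F T.
               principal_utility M F T B g0 K \<gamma>P (best_reply \<Gamma> \<beta>) (contract M F T B \<gamma>A \<Gamma> y \<beta>)
                 = V_SB_at M F T B g0 K \<gamma>P \<gamma>A \<Gamma> y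
               \<longrightarrow> (AE \<omega> in M. AE s in lborel. s \<in> {0..T} \<longrightarrow>
                      best_reply \<Gamma> \<beta> s \<omega> = matrix_inv \<Gamma> *v \<beta>s s))
          \<and> V_SB_at M F T B g0 K \<gamma>P \<gamma>A \<Gamma> y = - exp (- \<gamma>P * (g0 T - y) + \<phi>0))
     \<and> V_SB M F T B g0 K \<gamma>P \<gamma>A \<Gamma> y0 = V_SB_at M F T B g0 K \<gamma>P \<gamma>A \<Gamma> y0
     \<and> \<xi>s = contract M F T B \<gamma>A \<Gamma> y0 (\<lambda>t _. \<beta>s t)
     \<and> principal_utility M F T B g0 K \<gamma>P (best_reply \<Gamma> (\<lambda>t _. \<beta>s t)) \<xi>s
         = V_SB M F T B g0 K \<gamma>P \<gamma>A \<Gamma> y0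
     \<and> (\<forall>y\<ge>y0. \<forall>\<beta>\<in>admissible M F T.
          principal_utility M F T B g0 K \<gamma>P (best_reply \<Gamma> \<beta>) (contract M F T B \<gamma>A \<Gamma> y \<beta>)
            = V_SB M F T B g0 K \<gamma>P \<gamma>A \<Gamma> y0
          \<longrightarrow> (AE \<omega> in M. contract M F T B \<gamma>A \<Gamma> y \<beta> \<omega> = \<xi>s \<omega>))"
proof -
  interpret volterra_principal_agent M F T B g0 K \<gamma>P \<gamma>A \<Gamma>
    by unfold_locales (fact assms)+
  have \<beta>s: "\<beta>s = optimal"
    unfolding assms(10) by (simp add: fun_eq_iff optimal_def)
  have \<phi>0: "\<phi>0 = exponent"
    unfolding assms(11) by (simp only: exponent_def)
  \<comment> \<open>An equality of functions: both sides refer to the same chosen version of the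
    stochastic integral.\<close>
  have \<xi>s: "\<xi>s = contract M F T B \<gamma>A \<Gamma> y0 (\<lambda>t _. \<beta>s t)"
    unfolding assms(12) by (simp add: contract_def fun_eq_iff)
  have opt_value: "principal_utility M F T B g0 K \<gamma>P (best_reply \<Gamma> (\<lambda>t _. \<beta>s t)) (contract M F T B \<gamma>A \<Gamma> y (\<lambda>t _. \<beta>s t))
      = V_SB_at M F T B g0 K \<gamma>P \<gamma>A \<Gamma> y" for y
    unfolding V_SB_at_eq \<beta>s by (rule principal_utility_optimal)
  have V_SB: "V_SB M F T B g0 K \<gamma>P \<gamma>A \<Gamma> y0 = V_SB_at M F T B g0 K \<gamma>P \<gamma>A \<Gamma> y0"
    unfolding V_SB_at_eq V_SB_eq ..
  have unique_effort: "AE \<omega> in M. AE s in lborel. s \<in> {0..T} \<longrightarrow> best_reply \<Gamma> \<beta> s \<omega> = matrix_inv \<Gamma> *v \<beta>s s"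
    if "\<beta> \<in> admissible M F T"
      and "principal_utility M F T B g0 K \<gamma>P (best_reply \<Gamma> \<beta>) (contract M F T B \<gamma>A \<Gamma> y \<beta>) = V_SB_at M F T B g0 K \<gamma>P \<gamma>A \<Gamma> y"
    for \<beta> y
    using principal_utility_le(2)[OF that[unfolded V_SB_at_eq]]
  proof eventually_elim
    case (elim \<omega>)
    then show ?case by eventually_elim (simp add: best_reply_def \<beta>s)
  qed
  have unique_contract: "AE \<omega> in M. contract M F T B \<gamma>A \<Gamma> y \<beta> \<omega> = \<xi>s \<omega>"
    if y: "y \<ge> y0" and b: "\<beta> \<in> admissible M F T"
      and eq: "principal_utility M F T B g0 K \<gamma>P (best_reply \<Gamma> \<beta>) (contract M F T B \<gamma>A \<Gamma> y \<beta>) = V_SB M F T B g0 K \<gamma>P \<gamma>A \<Gamma> y0"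
    for \<beta> y
  proof -
    \<comment> \<open>Uniqueness of \<open>\<beta>\<close> is known for a fixed \<open>y\<close>
      only. Attaining the optimum at \<open>y0\<close> forces
      \<open>best_value y0 \<le> best_value y\<close>, hence \<open>y \<le> y0\<close>, which
      together with \<open>y0 \<le> y\<close> fixes \<open>y\<close>.\<close>
    have "\<gamma>P * y \<le> \<gamma>P * y0"
      using principal_utility_le(1)[OF b, of y] unfolding eq V_SB_eq by (simp add: algebra_simps)
    then have yy: "y = y0" using y gP by simp
    have "AE \<omega> in M. AE s in lborel. s \<in> {0..T} \<longrightarrow> \<beta> s \<omega> = optimal s"
      using principal_utility_le(2)[OF b, of y] eq unfolding V_SB_eq yy by blast
    from contract_cong_AE[OF b optimal_admissible this, of y0] show ?thesis
      unfolding \<xi>s \<beta>s yy .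
  qed
  show ?thesis
    using principal_utility_eq(1) optimal_admissible opt_value unique_effort V_SB \<xi>s unique_contract
    unfolding \<phi>0 V_SB_at_eq[symmetric] by (simp add: \<beta>s V_SB_at_eq)
qed

end
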